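(* Let $X=\mathbb R\times(0,\infty)\times\mathbb R$ with the Lebesgue measure $\omega$ and the outer measures $\mu,\nu$ generated by dyadic strips and dyadic trees as described in the context. There exists a constant $C=C(p,q,r)$ such that: (i) for every $q,r\in(0,\infty)$ and every $f\in L^q_\mu(\ell^q_\nu(\ell^r_\omega))$ on $X$, $C^{-1}\|f\|_{L^q_\nu(\ell^r_\omega)}\le\|f\|_{L^q_\mu(\ell^q_\nu(\ell^r_\omega))}\le C\|f\|_{L^q_\nu(\ell^r_\omega)}$; (ii) for every $p,q,r\in(1,\infty)$ and every $f\in L^p_\mu(\ell^q_\nu(\ell^r_\omega))$ on $X$, $$C^{-1}\|f\|_{L^p_\mu(\ell^q_\nu(\ell^r_\omega))}\le\sup_{\|g\|_{L^{p'}_\mu(\ell^{q'}_\nu(\ell^{r'}_\omega))}=1}\|fg\|_{L^1(X,\omega)}\le C\|f\|_{L^p_\mu(\ell^q_\nu(\ell^r_\omega))};$$ (iii) for every $p,q,r\in(1,\infty)$ and every collection $\{f_n:n\in\mathbb N\}\subseteq L^p_\mu(\ell^q_\nu(\ell^r_\omega))$ on $X$, $\|\sum_n f_n\|_{L^p_\mu(\ell^q_\nu(\ell^r_\omega))}\le C\sum_n\|f_n\|_{L^p_\mu(\ell^q_\nu(\ell^r_\omega))}$.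
   Context: $s'$ denotes the Hölder conjugate of $s$. Dyadic intervals: $I(m,l)=(2^lm,2^l(m+1)]$, $m,l\in\mathbb Z$. Tiles: $H(m,l,n)=I(m,l)\times(2^{l-1},2^l]\times I(n,-l)$. Dyadic strips: $D(m,l)=I(m,l)\times(0,2^l]\times\mathbb R$, forming the collection $\mathcal D$, with $\sigma(D(m,l))=2^l$. Dyadic trees: for $m,l,n\in\mathbb Z$, $T(m,l,n)=\bigcup_{l'\le l}\bigcup_{m':\,I(m',l')\subseteq I(m,l)}H(m',l',N(n,l'))$, where $N(n,l')$ is the integer with $I(n,-l)\subseteq I(N(n,l'),-l')$; they form the collection $\mathcal T$, with $\tau(T(m,l,n))=2^l$. Outer measures: $\mu(A)=\inf\{\sum_{S\in\mathcal S'}\sigma(S):\mathcal S'\subseteq\mathcal D,\ A\subseteq\bigcup_{S\in\mathcal S'}S\}$, and $\nu$ defined likewise from $(\mathcal T,\tau)$. Iterated spaces, for $\omega$-measurable $f$ and $r\in(0,\infty)$: $\ell^r_\omega(f)(T)=\nu(T)^{-1/r}\|f1_T\|_{L^r(X,\omega)}$ for $T\in\mathcal T$; $\|f\|_{L^\infty_\nu(\ell^r_\omega)}=\sup_{T\in\mathcal T}\ell^r_\omega(f)(T)$; $\nu(\ell^r_\omega(f)>\lambda)=\inf\{\nu(B):B\subseteq X\text{ measurable},\ \|f1_{X\setminus B}\|_{L^\infty_\nu(\ell^r_\omega)}\le\lambda\}$; for $q\in(0,\infty)$, $\|f\|_{L^q_\nu(\ell^r_\omega)}=(\int_0^\infty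 q\lambda^{q-1}\nu(\ell^r_\omega(f)>\lambda)d\lambda)^{1/q}$. Then $\ell^q_\nu(\ell^r_\omega)(f)(D)=\mu(D)^{-1/q}\|f1_D\|_{L^q_\nu(\ell^r_\omega)}$ for $D\in\mathcal D$; $\|f\|_{L^\infty_\mu(\ell^q_\nu(\ell^r_\omega))}=\sup_{D\in\mathcal D}\ell^q_\nu(\ell^r_\omega)(f)(D)$; $\mu(\ell^q_\nu(\ell^r_\omega)(f)>\lambda)=\inf\{\mu(B):\|f1_{X\setminus B}\|_{L^\infty_\mu(\ell^q_\nu(\ell^r_\omega))}\le\lambda\}$; for $p\in(0,\infty)$, $\|f\|_{L^p_\mu(\ell^q_\nu(\ell^r_\omega))}=(\int_0^\infty p\lambda^{p-1}\mu(\ell^q_\nu(\ell^r_\omega)(f)>\lambda)d\lambda)^{1/p}$. Membership means finiteness of the quasi-norm. *)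

theory Defs
  imports "HOL-Analysis.Analysis"
begin

type_synonym pt = "real \<times> real \<times> real"

definition Xset :: "pt set" where
  "Xset = UNIV \<times> {0<..} \<times> UNIV"

definition dyint :: "int \<Rightarrow> int \<Rightarrow> real set" where
  "dyint m l = {2 powr (real_of_int l) * real_of_int m <.. 2 powr (real_of_int l) * (real_of_int m + 1)}"

definition tile :: "int \<Rightarrow> int \<Rightarrow> int \<Rightarrow> pt set" where
  "tile m l n = dyint m l \<times> {2 powr (real_of_int l - 1) <.. 2 powr (real_of_int l)} \<times> dyint n (- l)"

definition strip :: "int \<Rightarrow> int \<Rightarrow> pt set" where
  "strip m l = dyint m l \<times> {0<..2 powr (real_of_int l)} \<times> UNIV"

definition strips :: "pt set set" where
  "strips = {strip m l | m l. True}"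

definition sigma_w :: "pt set \<Rightarrow> ennreal" where
  "sigma_w S = ennreal (2 powr (real_of_int (THE l. \<exists>m. S = strip m l)))"

definition Nidx :: "int \<Rightarrow> int \<Rightarrow> int \<Rightarrow> int" where
  "Nidx n l l' = (THE N. dyint n (- l) \<subseteq> dyint N (- l'))"

definition tree :: "int \<Rightarrow> int \<Rightarrow> int \<Rightarrow> pt set" where
  "tree m l n = (\<Union>l'\<in>{l'. l' \<le> l}. \<Union>m'\<in>{m'. dyint m' l' \<subseteq> dyint m l}. tile m' l' (Nidx n l l'))"

definition trees :: "pt set set" where
  "trees = {tree m l n | m l n. True}"

definition tau_w :: "pt set \<Rightarrow> ennreal" where
  "tau_w T = ennreal (2 powr (real_of_int (THE l. \<exists>m n. T = tree m l n)))"

definition gen_outer :: "'a set set \<Rightarrow> ('a set \<Rightarrow> ennreal) \<Rightarrow> 'a set \<Rightarrow> ennreal" where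
  "gen_outer E w A = (INF S' \<in> {S'. S' \<subseteq> E \<and> A \<subseteq> \<Union>S'}. infsum w S')"

definition mu :: "pt set \<Rightarrow> ennreal" where
  "mu = gen_outer strips sigma_w"

definition nu :: "pt set \<Rightarrow> ennreal" where
  "nu = gen_outer trees tau_w"

definition enn_root :: "real \<Rightarrow> ennreal \<Rightarrow> ennreal" where
  "enn_root r x = (if x = top then top else ennreal (enn2real x powr (1 / r)))"

definition restr :: "(pt \<Rightarrow> complex) \<Rightarrow> pt set \<Rightarrow> pt \<Rightarrow> complex" where
  "restr f A = (\<lambda>x. of_real (indicator A x) * f x)"

definition Lr_omega :: "real \<Rightarrow> (pt \<Rightarrow> complex) \<Rightarrow> ennreal" where
  "Lr_omega r f = enn_root r (\<integral>\<^sup>+x\<in>Xset. ennreal (norm (f x) powr r) \<partial>lebesgue)"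

definition ell_omega :: "real \<Rightarrow> (pt \<Rightarrow> complex) \<Rightarrow> pt set \<Rightarrow> ennreal" where
  "ell_omega r f T = enn_root r (inverse (nu T)) * Lr_omega r (restr f T)"

definition Linf_nu :: "real \<Rightarrow> (pt \<Rightarrow> complex) \<Rightarrow> ennreal" where
  "Linf_nu r f = (SUP T\<in>trees. ell_omega r f T)"

definition nu_super :: "real \<Rightarrow> (pt \<Rightarrow> complex) \<Rightarrow> real \<Rightarrow> ennreal" where
  "nu_super r f lam = (INF B \<in> {B. B \<in> sets lebesgue \<and> B \<subseteq> Xset \<and>
        Linf_nu r (restr f (Xset - B)) \<le> ennreal lam}. nu B)"

definition Lq_nu :: "real \<Rightarrow> real \<Rightarrow> (pt \<Rightarrow> complex) \<Rightarrow> ennreal" where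
  "Lq_nu q r f = enn_root q (\<integral>\<^sup>+lam\<in>{0<..}. ennreal (q * lam powr (q - 1)) * nu_super r f lam \<partial>lborel)"

definition ell_nu :: "real \<Rightarrow> real \<Rightarrow> (pt \<Rightarrow> complex) \<Rightarrow> pt set \<Rightarrow> ennreal" where
  "ell_nu q r f D = enn_root q (inverse (mu D)) * Lq_nu q r (restr f D)"

definition Linf_mu :: "real \<Rightarrow> real \<Rightarrow> (pt \<Rightarrow> complex) \<Rightarrow> ennreal" where
  "Linf_mu q r f = (SUP D\<in>strips. ell_nu q r f D)"

definition mu_super :: "real \<Rightarrow> real \<Rightarrow> (pt \<Rightarrow> complex) \<Rightarrow> real \<Rightarrow> ennreal" where
  "mu_super q r f lam = (INF B \<in> {B. B \<in> sets lebesgue \<and> B \<subseteq> Xset \<and>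
        Linf_mu q r (restr f (Xset - B)) \<le> ennreal lam}. mu B)"

definition Lp_mu :: "real \<Rightarrow> real \<Rightarrow> real \<Rightarrow> (pt \<Rightarrow> complex) \<Rightarrow> ennreal" where
  "Lp_mu p q r f = enn_root p (\<integral>\<^sup>+lam\<in>{0<..}. ennreal (p * lam powr (p - 1)) * mu_super q r f lam \<partial>lborel)"

definition conj_exp :: "real \<Rightarrow> real" where
  "conj_exp s = s / (s - 1)"

end

(*
  All quasi-norms depend on f only through the numbers x(P), the L^r norms of f on the tiles P, and B may be
  taken to be a union of generators in every superlevel measure. One outer construction, applied to sums of
  r-th powers with trees and then again with strips, produces both norms, and monotonicity, homogeneity, the
  Fatou property and Hoelder's inequality pass from a functional to its outer construction.

  Duality needs a matching lower bound. If, at a single level, one can select generators that clear x together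
  with a y that pairs with x at least like their total weight and has bounded dual size, then stacking the
  levels gives an extremal partner. For trees the selection is greedy and y = x^(r-1). For strips one takes the
  maximal strips of large size and the tree-level partner y of x on them; y may have large dual size on small
  strips, but only where many of the selected trees overlap, and by Hoelder's inequality discarding these
  strips costs at most half of the pairing. The countable triangle inequality follows from duality and Fatou.

  For p = q, the strips on which the selected trees overlap many times give one inequality, and duality gives
  the other when q, r > 1. Taking roots of x reduces general q, r to that case.
*)
theory Submission
  imports Defs "HOL-Library.Diagonal_Subsequence"
begin


section \<open>Real powers of extended nonnegative reals\<close>

text \<open>The spaces are given by superlevel measures, so no triangle inequality comes for free;
  everything is drawn from properties that the outer construction inherits. They are stated for
  powers of the quasi-norms, where Hoelder's inequality takes the additive form
  \<open>dual_bound\<close>, which can be summed over generators. The obstacle in the lower bound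
  for strips is locality: a tree-level partner is controlled globally, while dual sizes are needed
  on each single strip. Hence \<open>partner\<close> also bounds y on an arbitrary set Z, in terms
  of generators covering the traces on Z of the selected ones. The geometry behind this: a strip
  meets a tree in nothing or in one tree, whose weight is the length of the overlap of the two
  intervals. So disjoint strips split a tree without increasing its weight, and the top intervals
  over a point of the line are nested. Partners are built for finitely supported sequences, where
  the sums involved are finite and can be absorbed; the Fatou property reaches the general
  case.\<close>

definition epow :: "ennreal \<Rightarrow> real \<Rightarrow> ennreal" where
  "epow x r = (if x = top then top else ennreal (enn2real x powr r))"

lemma epow_ennreal: "0 \<le> a \<Longrightarrow> epow (ennreal a) r = ennreal (a powr r)"
  by (simp add: epow_def)

lemma epow_top [simp]: "epow top r = top"
  by (simp add: epow_def)

lemma epow_0 [simp]: "epow 0 r = 0"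
  by (simp add: epow_def)

lemma enn_root_epow: "enn_root r x = epow x (1 / r)"
  by (simp add: epow_def enn_root_def)

text \<open>Holds for every exponent, since \<open>0 powr r = 0\<close> by convention even when
  \<open>r\<close> is not positive.\<close>

lemma epow_eq_0_iff [simp]: "epow x r = 0 \<longleftrightarrow> x = 0"
  by (cases x rule: ennreal_cases) (auto simp: epow_ennreal)

lemma epow_eq_top_iff [simp]: "epow x r = top \<longleftrightarrow> x = top"
  by (cases x rule: ennreal_cases) (auto simp: epow_ennreal)

lemma epow_less_top_iff [simp]: "epow x r < top \<longleftrightarrow> x < top"
  by (simp add: less_top[symmetric])

lemma epow_epow: "epow (epow x a) b = epow x (a * b)"
  by (cases x rule: ennreal_cases) (auto simp: epow_ennreal powr_powr)

lemma epow_1 [simp]: "epow x 1 = x"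
  by (cases x rule: ennreal_cases) (auto simp: epow_ennreal)

lemma epow_mono: "0 < r \<Longrightarrow> x \<le> y \<Longrightarrow> epow x r \<le> epow y r"
  by (cases x rule: ennreal_cases; cases y rule: ennreal_cases)
     (auto simp: epow_ennreal powr_mono2 ennreal_leI top_unique)

text \<open>A Galois connection between a power and its inverse; it replaces continuity when powers
  meet suprema and lower limits.\<close>

lemma epow_swap_le: "0 < r \<Longrightarrow> epow x r \<le> y \<longleftrightarrow> x \<le> epow y (1 / r)"
  using epow_mono[of r x "epow y (1/r)"] epow_mono[of "1/r" "epow x r" y]
  by (auto simp: epow_epow)

lemma epow_le_iff: "0 < r \<Longrightarrow> epow x r \<le> epow y r \<longleftrightarrow> x \<le> y"
  by (simp add: epow_swap_le epow_epow)

lemma epow_mult: "epow (x * y) r = epow x r * epow y r"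
proof (cases "x = 0 \<or> y = 0 \<or> x = top \<or> y = top")
  case True
  then show ?thesis by (auto simp: ennreal_mult_top ennreal_top_mult)
next
  case False
  then show ?thesis
    by (cases x rule: ennreal_cases; cases y rule: ennreal_cases)
       (auto simp: epow_ennreal ennreal_mult[symmetric] powr_mult)
qed

lemma epow_add: "0 < a \<Longrightarrow> 0 < b \<Longrightarrow> epow x (a + b) = epow x a * epow x b"
  by (cases x rule: ennreal_cases) (auto simp: epow_ennreal ennreal_mult[symmetric] powr_add ennreal_top_mult)

lemma epow_SUP_le:
  assumes "0 < r"
  shows "epow (SUP i\<in>I. x i) r \<le> (SUP i\<in>I. epow (x i) r)"
proof -
  have "x i \<le> epow (SUP i\<in>I. epow (x i) r) (1 / r)" if "i \<in> I" for i
    using that assms by (subst epow_swap_le[symmetric]) (auto intro: SUP_upper)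
  then show ?thesis
    using assms by (simp add: epow_swap_le SUP_least)
qed

lemma epow_liminf_le:
  assumes r: "0 < r"
  shows "epow (liminf x) r \<le> liminf (\<lambda>j. epow (x j) r)"
proof (subst epow_swap_le[OF r], rule dense_le)
  fix y :: ennreal assume "y < liminf x"
  then have "\<forall>\<^sub>F j in sequentially. y < x j" by (simp add: less_LiminfD)
  then have "\<forall>\<^sub>F j in sequentially. epow y r \<le> epow (x j) r"
    by eventually_elim (simp add: epow_le_iff r)
  then have "epow y r \<le> liminf (\<lambda>j. epow (x j) r)" by (rule Liminf_bounded)
  then show "y \<le> epow (liminf (\<lambda>j. epow (x j) r)) (1 / r)"
    using r by (simp add: epow_swap_le)
qed

section \<open>Sums over index sets\<close>

text \<open>Unordered sums are integrals for the counting measure, so that Fatou, monotone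
  convergence and the exchange of sums come from integration theory.\<close>

abbreviation nsum :: "'a set \<Rightarrow> ('a \<Rightarrow> ennreal) \<Rightarrow> ennreal" where
  "nsum A f \<equiv> nn_integral (count_space A) f"

lemma nsum_ind: "nsum A f = (\<integral>\<^sup>+x. f x * indicator A x \<partial>count_space UNIV)"
  by (cases "A = UNIV") (auto simp: nn_integral_count_space_indicator)

lemma nsum_empty [simp]: "nsum {} f = 0"
  by (simp add: nn_integral_count_space_finite)

lemma nsum_mono_set: "A \<subseteq> B \<Longrightarrow> nsum A f \<le> nsum B f"
  unfolding nsum_ind[of A] nsum_ind[of B]
  by (intro nn_integral_mono) (auto split: split_indicator)

lemma nsum_ge: "a \<in> A \<Longrightarrow> f a \<le> nsum A f"
  using nsum_mono_set[of "{a}" A f] by (simp add: nn_integral_count_space_finite)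

lemma nsum_UN_le:
  fixes G :: "'i \<Rightarrow> 'a set"
  assumes "countable I"
  shows "nsum (\<Union>i\<in>I. G i) f \<le> nsum I (\<lambda>i. nsum (G i) f)"
proof -
  have "f x * indicator (\<Union>i\<in>I. G i) x \<le> nsum I (\<lambda>i. f x * indicator (G i) x)" for x
  proof (cases "x \<in> (\<Union>i\<in>I. G i)")
    case True
    then obtain i where i: "i \<in> I" "x \<in> G i" by auto
    then show ?thesis using nsum_ge[OF i(1), of "\<lambda>i. f x * indicator (G i) x"] True by simp
  qed auto
  then have "nsum (\<Union>i\<in>I. G i) f \<le> (\<integral>\<^sup>+x. nsum I (\<lambda>i. f x * indicator (G i) x) \<partial>count_space UNIV)"
    unfolding nsum_ind[of "\<Union>i\<in>I. G i"] by (intro nn_integral_mono)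
  also have "\<dots> = nsum I (\<lambda>i. nsum (G i) f)"
    unfolding nsum_ind[of "G _"] using assms by (rule nn_integral_count_space_nn_integral) auto
  finally show ?thesis .
qed

lemma nsum_Un_le: "nsum (A \<union> B) f \<le> nsum A f + nsum B f"
  using nsum_UN_le[of "{True,False}" "\<lambda>b. if b then A else B" f]
  by (auto simp: nn_integral_count_space_finite Un_commute)

lemma nsum_UN_nat_le: "nsum (\<Union>i::nat. G i) f \<le> (\<Sum>i. nsum (G i) f)"
  using nsum_UN_le[of "UNIV::nat set" G f] by (simp add: nn_integral_count_space_nat)

section \<open>Weighted integrals of decreasing functions on the half line\<close>

text \<open>When \<open>S\<close> is a superlevel measure, this is the \<open>q\<close>-th power of
  the outer quasi-norm.\<close>

definition wint :: "real \<Rightarrow> (real \<Rightarrow> ennreal) \<Rightarrow> ennreal" where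
  "wint q S = (\<integral>\<^sup>+lam\<in>{0<..}. ennreal (q * lam powr (q - 1)) * S lam \<partial>lborel)"

definition decr :: "(real \<Rightarrow> ennreal) \<Rightarrow> bool" where
  "decr S \<longleftrightarrow> (\<forall>a b. 0 < a \<longrightarrow> a \<le> b \<longrightarrow> S b \<le> S a)"

text \<open>Superlevel sets of a decreasing function are intervals. The indicator removes the
  nonpositive levels, about which \<open>decr\<close> says nothing.\<close>

lemma decr_measurable [measurable_dest]:
  assumes "decr S"
  shows "(\<lambda>lam. S lam * indicator {0<..} lam) \<in> borel_measurable borel"
proof (rule borel_measurableI_greater)
  fix y :: ennreal
  have "is_interval {x \<in> space borel. y < S x * indicator {0<..} x}"
    unfolding is_interval_1
  proof (safe, simp_all)
    fix a b x :: real
    assume *: "y < S a * indicator {0<..} a" "y < S b * indicator {0<..} b" "a \<le> x" "x \<le> b"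
    then have "0 < a" by (auto split: split_indicator_asm)
    then have "S b \<le> S x" "0 < b" using assms * by (auto simp: decr_def)
    then show "y < S x * indicator {0<..} x" using * \<open>0 < a\<close> by auto
  qed
  then show "{x \<in> space borel. y < S x * indicator {0<..} x} \<in> sets borel"
    by (rule real_interval_borel_measurable)
qed

lemma wint_alt: "wint q S = (\<integral>\<^sup>+lam. ennreal (q * lam powr (q - 1)) * (S lam * indicator {0<..} lam) \<partial>lborel)"
  unfolding wint_def by (simp add: mult.assoc)

lemma wint_mono: "(\<And>lam. 0 < lam \<Longrightarrow> S lam \<le> S' lam) \<Longrightarrow> wint q S \<le> wint q S'"
  unfolding wint_alt by (intro nn_integral_mono mult_left_mono) (auto split: split_indicator)

lemma wint_cmult:
  assumes "decr S" shows "wint q (\<lambda>lam. c * S lam) = c * wint q S"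
proof -
  have [measurable]: "(\<lambda>lam. S lam * indicator {0<..} lam) \<in> borel_measurable borel"
    using assms by (rule decr_measurable)
  have "wint q (\<lambda>lam. c * S lam) =
    (\<integral>\<^sup>+lam. c * (ennreal (q * lam powr (q - 1)) * (S lam * indicator {0<..} lam)) \<partial>lborel)"
    unfolding wint_alt by (intro nn_integral_cong) (simp add: ac_simps)
  also have "\<dots> = c * wint q S" unfolding wint_alt by (rule nn_integral_cmult) measurable
  finally show ?thesis .
qed

lemma wint_nsum:
  assumes "countable I" "\<And>i. i \<in> I \<Longrightarrow> decr (S i)"
  shows "wint q (\<lambda>lam. nsum I (\<lambda>i. S i lam)) = nsum I (\<lambda>i. wint q (S i))"
proof -
  have m: "(\<lambda>lam. S i lam * indicator {0<..} lam) \<in> borel_measurable borel" if "i \<in> I" for i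
    using assms(2)[OF that] by (rule decr_measurable)
  have "wint q (\<lambda>lam. nsum I (\<lambda>i. S i lam)) =
    (\<integral>\<^sup>+lam. nsum I (\<lambda>i. ennreal (q * lam powr (q - 1)) * (S i lam * indicator {0<..} lam)) \<partial>lborel)"
    unfolding wint_alt
    by (intro nn_integral_cong) (auto simp: nn_integral_cmult[symmetric] nn_integral_multc[symmetric])
  also have "\<dots> = nsum I (\<lambda>i. wint q (S i))"
    unfolding wint_alt using assms(1) m by (intro nn_integral_count_space_nn_integral) auto
  finally show ?thesis .
qed

lemma wint_suminf:
  assumes "\<And>i. decr (S i)"
  shows "wint q (\<lambda>lam. \<Sum>i. S i lam) = (\<Sum>i. wint q (S i))"
  using wint_nsum[of "UNIV::nat set" S q] assms by (simp add: nn_integral_count_space_nat)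

lemma wint_liminf:
  assumes "\<And>i. decr (S i)"
  shows "wint q (\<lambda>lam. liminf (\<lambda>i. S i lam)) \<le> liminf (\<lambda>i. wint q (S i))"
proof -
  have m [measurable]: "(\<lambda>lam. S i lam * indicator {0<..} lam) \<in> borel_measurable borel" for i
    using assms by (rule decr_measurable)
  have "ennreal (q * lam powr (q - 1)) * (liminf (\<lambda>i. S i lam) * indicator {0<..} lam) \<le>
     liminf (\<lambda>i. ennreal (q * lam powr (q - 1)) * (S i lam * indicator {0<..} lam))" for lam
  proof (cases "q * lam powr (q - 1) \<le> 0 \<or> lam \<le> 0")
    case True then show ?thesis by (auto simp: ennreal_neg)
  next
    case False
    have "ennreal (q * lam powr (q - 1)) * liminf (\<lambda>i. S i lam)
      \<le> liminf (\<lambda>i. ennreal (q * lam powr (q - 1)) * S i lam)"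
      unfolding liminf_SUP_INF SUP_mult_left_ennreal
      by (intro SUP_mono bexI INF_greatest mult_left_mono) (auto intro: INF_lower)
    then show ?thesis using False by simp
  qed
  then have "wint q (\<lambda>lam. liminf (\<lambda>i. S i lam)) \<le> (\<integral>\<^sup>+lam. liminf (\<lambda>i. ennreal (q * lam powr (q - 1)) * (S i lam * indicator {0<..} lam)) \<partial>lborel)"
    unfolding wint_alt by (intro nn_integral_mono)
  also have "\<dots> \<le> liminf (\<lambda>i. wint q (S i))"
    unfolding wint_alt by (intro nn_integral_liminf) simp
  finally show ?thesis .
qed

lemma wint_scale:
  assumes S: "decr S" and c: "0 < c"
  shows "wint q S = ennreal (c powr q) * wint q (\<lambda>lam. S (c * lam))"
proof -
  have m [measurable]: "(\<lambda>lam. S lam * indicator {0<..} lam) \<in> borel_measurable borel"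
    using S by (rule decr_measurable)
  have d: "decr (\<lambda>lam. S (c * lam))" using S c by (auto simp: decr_def)
  note decr_measurable[OF d, measurable]
  have eq: "ennreal (q * (c * lam) powr (q - 1)) * (S (c * lam) * indicator {0<..} (c * lam)) =
      ennreal (c powr (q - 1)) * (ennreal (q * lam powr (q - 1)) * (S (c * lam) * indicator {0<..} lam))" for lam
  proof (cases "0 < lam")
    case True
    then have "q * (c * lam) powr (q - 1) = c powr (q - 1) * (q * lam powr (q - 1))"
      using c by (simp add: powr_mult)
    then show ?thesis by (simp only: ennreal_mult' mult.assoc) (simp add: True c ennreal_mult' mult.assoc)
  next
    case False
    then show ?thesis using c by (simp add: zero_less_mult_iff)
  qed
  have "wint q S = ennreal c * (\<integral>\<^sup>+lam. ennreal (q * (c * lam) powr (q - 1)) * (S (c * lam) * indicator {0<..} (c * lam)) \<partial>lborel)"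
    unfolding wint_alt using c by (subst nn_integral_real_affine[where c = c and t = 0]) auto
  also have "\<dots> = ennreal c * (\<integral>\<^sup>+lam. ennreal (c powr (q - 1)) * (ennreal (q * lam powr (q - 1)) * (S (c * lam) * indicator {0<..} lam)) \<partial>lborel)"
    by (simp only: eq)
  also have "\<dots> = ennreal c * (ennreal (c powr (q - 1)) * wint q (\<lambda>lam. S (c * lam)))"
    unfolding wint_alt by (subst nn_integral_cmult) auto
  also have "\<dots> = ennreal (c powr q) * wint q (\<lambda>lam. S (c * lam))"
  proof -
    have "c * c powr (q - 1) = c powr q" using c powr_add[of c 1 "q - 1"] by simp
    then show ?thesis using c by (simp add: mult.assoc[symmetric] ennreal_mult[symmetric])
  qed
  finally show ?thesis .
qed

lemma nn_integral_powr_Icc: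
  assumes "0 < q" "0 \<le> L"
  shows "(\<integral>\<^sup>+lam. ennreal (q * lam powr (q - 1)) * indicator {0..L} lam \<partial>lborel) = ennreal (L powr q)"
proof -
  have "((\<lambda>lam. q * lam powr (q - 1)) has_integral q * (L powr (q - 1 + 1) / (q - 1 + 1))) {0..L}"
    using assms by (intro has_integral_mult_right has_integral_powr_from_0) auto
  then have h: "((\<lambda>lam. q * lam powr (q - 1)) has_integral L powr q) {0..L}"
    using assms by simp
  have "(\<integral>\<^sup>+lam. ennreal (q * lam powr (q - 1)) * indicator {0..L} lam \<partial>lborel)
    = (\<integral>\<^sup>+lam. ennreal (indicator {0..L} lam * (q * lam powr (q - 1))) \<partial>lborel)"
    by (intro nn_integral_cong) (auto split: split_indicator)
  also have "\<dots> = ennreal (L powr q)"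
    using assms by (intro nn_integral_has_integral_lebesgue[OF _ h]) auto
  finally show ?thesis .
qed

lemma wint_indicator:
  assumes "0 < q" "0 \<le> L"
  shows "wint q (\<lambda>lam. indicator {..<L} lam) = ennreal (L powr q)"
    and "wint q (\<lambda>lam. indicator {..L} lam) = ennreal (L powr q)"
proof -
  have ne: "AE lam in lborel. lam \<noteq> (0::real) \<and> lam \<noteq> L"
    using AE_lborel_singleton[of 0] AE_lborel_singleton[of L] by eventually_elim auto
  show "wint q (\<lambda>lam. indicator {..<L} lam) = ennreal (L powr q)"
    "wint q (\<lambda>lam. indicator {..L} lam) = ennreal (L powr q)"
    unfolding nn_integral_powr_Icc[OF assms, symmetric] wint_alt
    by (intro nn_integral_cong_AE eventually_mono[OF ne], auto split: split_indicator)+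
qed

lemma wint_step:
  assumes "0 < q" "0 \<le> L"
  shows "wint q (\<lambda>lam. c * indicator {..<L} lam) = c * ennreal (L powr q)"
proof -
  have "decr (\<lambda>lam. indicator {..<L} lam)" by (auto simp: decr_def split: split_indicator)
  from wint_cmult[OF this] show ?thesis using wint_indicator[OF assms] by simp
qed

text \<open>Chebyshev's inequality: up to \<open>L\<close> the function is at least
  \<open>S L\<close>.\<close>

lemma wint_ge:
  assumes "decr S" "0 < q" "0 < L"
  shows "ennreal (L powr q) * S L \<le> wint q S"
proof -
  have "decr (\<lambda>lam. indicator {..L} lam)" by (auto simp: decr_def split: split_indicator)
  from wint_cmult[OF this] have "S L * ennreal (L powr q) = wint q (\<lambda>lam. S L * indicator {..L} lam)"
    using wint_indicator[of q L] assms by simp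
  also have "\<dots> \<le> wint q S"
    using assms by (intro wint_mono) (auto simp: decr_def split: split_indicator)
  finally show ?thesis by (simp add: mult.commute)
qed


section \<open>Homogeneous functionals and the outer construction\<close>

definition cut :: "('p \<Rightarrow> ennreal) \<Rightarrow> 'p set \<Rightarrow> 'p \<Rightarrow> ennreal" where
  "cut x A = (\<lambda>P. x P * indicator A P)"

lemma cut_le: "cut x A P \<le> x P"
  by (auto simp: cut_def split: split_indicator)

lemma cut_mono: "(\<And>P. P \<in> A \<Longrightarrow> x P \<le> y P) \<Longrightarrow> A \<subseteq> B \<Longrightarrow> cut x A P \<le> cut y B P"
  by (auto simp: cut_def split: split_indicator)

lemma cut_empty [simp]: "cut x {} = (\<lambda>P. 0)"
  by (simp add: cut_def)

lemma cut_UNIV [simp]: "cut x UNIV = x"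
  by (simp add: cut_def)

lemma cut_cut [simp]: "cut (cut x A) B = cut x (A \<inter> B)"
  by (auto simp: cut_def split: split_indicator)

lemma cut_eq_0: "(\<And>P. P \<in> A \<Longrightarrow> x P = 0) \<Longrightarrow> cut x A = (\<lambda>P. 0)"
  by (rule ext) (auto simp: cut_def indicator_def)

lemma cut_scale: "cut (\<lambda>P. c * x P) A = (\<lambda>P. c * cut x A P)"
  by (simp add: cut_def mult.assoc)

definition fsup :: "('p \<Rightarrow> ennreal) \<Rightarrow> bool" where
  "fsup x \<longleftrightarrow> finite {P. x P \<noteq> 0} \<and> (\<forall>P. x P < top)"

lemma fsup_mono: "fsup x \<Longrightarrow> (\<And>P. y P \<le> x P) \<Longrightarrow> fsup y"
  unfolding fsup_def by (metis (mono_tags, lifting) Collect_mono bot.extremum_uniqueI bot_ennreal infinite_super order_le_less_trans)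

lemma fsup_cut: "fsup x \<Longrightarrow> fsup (cut x A)"
  by (rule fsup_mono[OF _ cut_le])

lemma fsup_scale: "fsup x \<Longrightarrow> fsup (\<lambda>P. ennreal c * x P)"
  unfolding fsup_def by (auto simp: ennreal_mult_less_top elim!: finite_subset[rotated])

text \<open>The clause for \<open>SUP\<close> replaces the triangle inequality: countably many terms are allowed, at the price of an
  arbitrarily small geometric loss.\<close>

definition good :: "real \<Rightarrow> (('p \<Rightarrow> ennreal) \<Rightarrow> ennreal) \<Rightarrow> bool" where
  "good r \<Phi> \<longleftrightarrow>
    (\<forall>x y. (\<forall>P. x P \<le> y P) \<longrightarrow> \<Phi> x \<le> \<Phi> y) \<and>
    \<Phi> (\<lambda>P. 0) = 0 \<and>
    (\<forall>c x. 0 < c \<longrightarrow> \<Phi> (\<lambda>P. ennreal c * x P) = ennreal (c powr r) * \<Phi> x) \<and>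
    (\<forall>x P. \<Phi> x = 0 \<longrightarrow> x P = 0) \<and>
    (\<forall>x y. (\<forall>P. x P \<le> liminf (\<lambda>j. y j P)) \<longrightarrow> \<Phi> x \<le> liminf (\<lambda>j. \<Phi> (y j))) \<and>
    (\<forall>e>0. \<exists>C>0. \<forall>x. \<Phi> (\<lambda>P. SUP i. x i P) \<le> ennreal C * (\<Sum>i::nat. ennreal (2 powr (e * real i)) * \<Phi> (x i))) \<and>
    (\<forall>x. fsup x \<longrightarrow> \<Phi> x < top)"

lemma goodD:
  assumes "good r \<Phi>"
  shows good_mono: "(\<And>P. x P \<le> y P) \<Longrightarrow> \<Phi> x \<le> \<Phi> y"
    and good_zero: "\<Phi> (\<lambda>P. 0) = 0"
    and good_scale: "0 < c \<Longrightarrow> \<Phi> (\<lambda>P. ennreal c * x P) = ennreal (c powr r) * \<Phi> x"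
    and good_definite: "\<Phi> x = 0 \<Longrightarrow> x P = 0"
    and good_liminf: "(\<And>P. x P \<le> liminf (\<lambda>j. ys j P)) \<Longrightarrow> \<Phi> x \<le> liminf (\<lambda>j. \<Phi> (ys j))"
    and good_SUP: "0 < e \<Longrightarrow> \<exists>C>0. \<forall>x. \<Phi> (\<lambda>P. SUP i. x i P) \<le> ennreal C * (\<Sum>i::nat. ennreal (2 powr (e * real i)) * \<Phi> (x i))"
    and good_fsup: "fsup x \<Longrightarrow> \<Phi> x < top"
proof -
  note d = assms[unfolded good_def]
  note d2 = d[THEN conjunct2] note d3 = d2[THEN conjunct2] note d4 = d3[THEN conjunct2]
  note d5 = d4[THEN conjunct2] note d6 = d5[THEN conjunct2]
  show "(\<And>P. x P \<le> y P) \<Longrightarrow> \<Phi> x \<le> \<Phi> y" by (rule d[THEN conjunct1, rule_format])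
  show "\<Phi> (\<lambda>P. 0) = 0" by (rule d2[THEN conjunct1])
  show "0 < c \<Longrightarrow> \<Phi> (\<lambda>P. ennreal c * x P) = ennreal (c powr r) * \<Phi> x" by (rule d3[THEN conjunct1, rule_format])
  show "\<Phi> x = 0 \<Longrightarrow> x P = 0" by (rule d4[THEN conjunct1, rule_format])
  show "(\<And>P. x P \<le> liminf (\<lambda>j. ys j P)) \<Longrightarrow> \<Phi> x \<le> liminf (\<lambda>j. \<Phi> (ys j))"
    by (rule d5[THEN conjunct1, rule_format])
  show "0 < e \<Longrightarrow> \<exists>C>0. \<forall>x. \<Phi> (\<lambda>P. SUP i. x i P) \<le> ennreal C * (\<Sum>i::nat. ennreal (2 powr (e * real i)) * \<Phi> (x i))"
    by (rule d6[THEN conjunct1, rule_format])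
  show "fsup x \<Longrightarrow> \<Phi> x < top" by (rule d6[THEN conjunct2, rule_format])
qed

lemma good_cut_mono: "good r \<Phi> \<Longrightarrow> A \<subseteq> B \<Longrightarrow> \<Phi> (cut x A) \<le> \<Phi> (cut x B)"
  by (rule good_mono[of r \<Phi>]) (auto intro: cut_mono)

text \<open>If \<open>x P\<close> were infinite, every multiple of the unit mass at \<open>P\<close>
  would lie below \<open>x\<close>, and homogeneity of positive degree would make
  \<open>\<Phi> x\<close> infinite.\<close>

lemma good_less_top:
  assumes g: "good r \<Phi>" and r: "0 < r" and fin: "\<Phi> x < top"
  shows "x P < top"
proof (rule ccontr)
  assume "\<not> x P < top"
  then have xP: "x P = top" by (simp add: less_top[symmetric])
  define d :: "_ \<Rightarrow> ennreal" where "d = indicator {P}"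
  have "\<Phi> d \<noteq> 0" using good_definite[OF g, of d P] by (auto simp: d_def)
  have "ennreal (c powr r) * \<Phi> d \<le> \<Phi> x" if "c > 0" for c
    using xP by (subst good_scale[OF g that, symmetric], intro good_mono[OF g])
       (auto simp: d_def split: split_indicator)
  moreover obtain b where b: "\<Phi> x = ennreal b" "b \<ge> 0"
    using fin by (cases "\<Phi> x" rule: ennreal_cases) auto
  ultimately have *: "ennreal (c powr r) * \<Phi> d \<le> ennreal b" if "c > 0" for c
    using that by auto
  show False
  proof (cases "\<Phi> d = top")
    case True then show ?thesis using *[of 1] by (simp add: top_unique)
  next
    case False
    then obtain a where a: "\<Phi> d = ennreal a" "a > 0"
      using \<open>\<Phi> d \<noteq> 0\<close> by (cases "\<Phi> d" rule: ennreal_cases) (auto simp: less_le)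
    \<comment> \<open>With this multiple the bound reads \<open>b + 1 \<le> b\<close>.\<close>
    define c where "c = ((b + 1) / a) powr (1 / r)"
    have "c > 0" "c powr r = (b + 1) / a" using a b r by (auto simp: c_def powr_powr)
    then show ?thesis using *[of c] a b False by (simp add: ennreal_mult[symmetric])
  qed
qed

text \<open>Quasi-norms are kept in powered form: \<open>\<Phi>\<close> is homogeneous of degree \<open>r\<close>, and \<open>out r \<Phi> q\<close> below is the
  \<open>q\<close>-th power of the outer quasi-norm built from the sizes \<open>(\<Phi> (cut x (m g)) / w g)\<close> to the power \<open>1 / r\<close>.\<close>

locale outer =
  fixes m :: "'g::countable \<Rightarrow> 'p set" and w :: "'g \<Rightarrow> ennreal"
  assumes w_pos: "0 < w g" and w_fin: "w g < top"
    and finite_above: "finite {g. P \<in> m g \<and> w g \<le> ennreal A}"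
    and cover: "\<exists>g. P \<in> m g"
begin

text \<open>The condition on an exceptional set, in powered form: off the union of \<open>G\<close>
  all sizes are at most \<open>lam\<close>.\<close>

definition clears :: "real \<Rightarrow> (('p \<Rightarrow> ennreal) \<Rightarrow> ennreal) \<Rightarrow> ('p \<Rightarrow> ennreal) \<Rightarrow> real \<Rightarrow> 'g set \<Rightarrow> bool" where
  "clears r \<Phi> x lam G \<longleftrightarrow> (\<forall>g. \<Phi> (cut x (m g - \<Union>(m ` G))) \<le> ennreal (lam powr r) * w g)"

text \<open>A clearing family carries its own cover, so the infimum over exceptional sets and the
  infimum in the outer measure of each of them are taken together; \<open>super_bridge\<close> shows
  that this gives the same value.\<close>

definition super :: "real \<Rightarrow> (('p \<Rightarrow> ennreal) \<Rightarrow> ennreal) \<Rightarrow> ('p \<Rightarrow> ennreal) \<Rightarrow> real \<Rightarrow> ennreal" where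
  "super r \<Phi> x lam = (INF G\<in>{G. clears r \<Phi> x lam G}. nsum G w)"

definition out :: "real \<Rightarrow> (('p \<Rightarrow> ennreal) \<Rightarrow> ennreal) \<Rightarrow> real \<Rightarrow> ('p \<Rightarrow> ennreal) \<Rightarrow> ennreal" where
  "out r \<Phi> q x = wint q (super r \<Phi> x)"

lemma super_le: "clears r \<Phi> x lam G \<Longrightarrow> super r \<Phi> x lam \<le> nsum G w"
  unfolding super_def by (rule INF_lower) auto

text \<open>Only finitely many generators over \<open>P\<close> are no heavier than a fixed one over
  \<open>P\<close>, so a least weight exists and is positive. Families of smaller total weight
  cannot cover \<open>P\<close>.\<close>

lemma min_weight:
  obtains w0 where "0 < w0" "w0 < top" "\<And>g. P \<in> m g \<Longrightarrow> w0 \<le> w g"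
proof -
  obtain g0 where g0: "P \<in> m g0" using cover by auto
  obtain A where A: "w g0 = ennreal A" using w_fin[of g0] by (metis ennreal_enn2real_if less_irrefl)
  define F where "F = {g. P \<in> m g \<and> w g \<le> ennreal A}"
  have F: "finite F" "g0 \<in> F" using finite_above g0 A by (auto simp: F_def)
  have min: "Min (w ` F) \<le> w g" if "P \<in> m g" for g
  proof (cases "g \<in> F")
    case False
    then have "w g0 \<le> w g" using that A by (auto simp: F_def)
    moreover have "Min (w ` F) \<le> w g0" using F by auto
    ultimately show ?thesis by order
  qed (use F in auto)
  have "Min (w ` F) \<in> w ` F" using F by (intro Min_in) auto
  then show ?thesis using that[of "Min (w ` F)"] min w_pos w_fin by auto
qed

lemma sum_less_min_weight:
  assumes "\<And>g. P \<in> m g \<Longrightarrow> w0 \<le> w g" "nsum G w < w0"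
  shows "P \<notin> \<Union>(m ` G)"
  using assms nsum_ge[of _ G w] by (fastforce simp: not_less[symmetric])

context
  fixes r :: real and \<Phi> :: "('p \<Rightarrow> ennreal) \<Rightarrow> ennreal"
  assumes \<Phi>: "good r \<Phi>" and r: "0 < r"
begin

lemma clears_UNIV: "clears r \<Phi> x lam UNIV"
  unfolding clears_def
proof
  fix g
  have "m g - \<Union>(range m) = {}" by auto
  then show "\<Phi> (cut x (m g - \<Union>(range m))) \<le> ennreal (lam powr r) * w g"
    by (simp only: cut_empty good_zero[OF \<Phi>]) simp
qed

lemma clears_mono:
  assumes "clears r \<Phi> y lam G" "\<And>P. x P \<le> y P" "lam \<le> lam'" "0 < lam"
  shows "clears r \<Phi> x lam' G"
  unfolding clears_def
proof
  fix g
  have "\<Phi> (cut x (m g - \<Union>(m ` G))) \<le> \<Phi> (cut y (m g - \<Union>(m ` G)))"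
    using assms(2) by (intro good_mono[OF \<Phi>] cut_mono) auto
  also have "\<dots> \<le> ennreal (lam powr r) * w g" using assms(1) by (auto simp: clears_def)
  also have "\<dots> \<le> ennreal (lam' powr r) * w g"
    using assms r by (intro mult_right_mono ennreal_leI powr_mono2) auto
  finally show "\<Phi> (cut x (m g - \<Union>(m ` G))) \<le> ennreal (lam' powr r) * w g" .
qed

lemma super_mono: "(\<And>P. x P \<le> y P) \<Longrightarrow> lam \<le> lam' \<Longrightarrow> 0 < lam \<Longrightarrow> super r \<Phi> x lam' \<le> super r \<Phi> y lam"
  unfolding super_def by (rule INF_superset_mono) (auto intro: clears_mono)

lemma decr_super: "decr (super r \<Phi> x)"
  unfolding decr_def by (auto intro: super_mono)

lemma super_near:
  assumes "0 < e"
  obtains G where "clears r \<Phi> x lam G" "nsum G w \<le> super r \<Phi> x lam + ennreal e"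
proof (cases "super r \<Phi> x lam = top")
  case True
  then show ?thesis using that[OF clears_UNIV] by auto
next
  case False
  then have "super r \<Phi> x lam < super r \<Phi> x lam + ennreal e"
    using assms by (cases "super r \<Phi> x lam" rule: ennreal_cases) (auto simp: ennreal_less_iff simp flip: ennreal_plus)
  then have "\<exists>G. clears r \<Phi> x lam G \<and> nsum G w < super r \<Phi> x lam + ennreal e"
    unfolding super_def INF_less_iff by auto
  then show ?thesis using that by (auto dest: less_imp_le)
qed

lemma clears_scale:
  assumes "0 < c" "0 < lam"
  shows "clears r \<Phi> (\<lambda>P. ennreal c * x P) (c * lam) G \<longleftrightarrow> clears r \<Phi> x lam G"
proof -
  have "ennreal (c powr r) * a \<le> ennreal ((c * lam) powr r) * b \<longleftrightarrow> a \<le> ennreal (lam powr r) * b" for a b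
    using assms by (simp add: powr_mult ennreal_mult mult.assoc ennreal_mult_le_mult_iff)
  then show ?thesis
    by (simp add: clears_def cut_scale good_scale[OF \<Phi> assms(1)])
qed

lemma super_scale:
  assumes "0 < c" "0 < lam"
  shows "super r \<Phi> (\<lambda>P. ennreal c * x P) (c * lam) = super r \<Phi> x lam"
  unfolding super_def clears_scale[OF assms] ..

text \<open>Only finitely many generators of bounded weight contain a given tile, so nearly optimal clearing families
  converge along a diagonal subsequence to a family that clears the limit.\<close>

lemma super_liminf:
  assumes xy: "\<And>P. x P \<le> liminf (\<lambda>j. y j P)" and lam: "0 < lam"
  shows "super r \<Phi> x lam \<le> liminf (\<lambda>j. super r \<Phi> (y j) lam)"
proof (rule ccontr)
  assume "\<not> ?thesis"
  then have "liminf (\<lambda>j. super r \<Phi> (y j) lam) < super r \<Phi> x lam" by simp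
  then obtain A' where A': "liminf (\<lambda>j. super r \<Phi> (y j) lam) < A'" "A' < super r \<Phi> x lam"
    using dense by blast
  obtain A where A: "A' = ennreal A" using A'(2) by (cases A' rule: ennreal_cases) auto
  obtain s where s: "strict_mono s" "(\<lambda>j. super r \<Phi> (y (s j)) lam) \<longlonglongrightarrow> liminf (\<lambda>j. super r \<Phi> (y j) lam)"
    using liminf_subseq_lim[of "\<lambda>j. super r \<Phi> (y j) lam"] by (auto simp: o_def)
  from order_tendstoD(2)[OF s(2) A'(1)]
  have "\<forall>\<^sub>F j in sequentially. super r \<Phi> (y (s j)) lam < A'" .
  then obtain j0 where j0: "\<And>j. j \<ge> j0 \<Longrightarrow> super r \<Phi> (y (s j)) lam < A'"
    unfolding eventually_sequentially by auto
  define z where "z j = y (s (j + j0))" for j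
  have xz: "x P \<le> liminf (\<lambda>j. z j P)" for P
  proof -
    have "strict_mono (\<lambda>j. s (j + j0))" using s(1) by (auto simp: strict_mono_def)
    from liminf_subseq_mono[OF this, of "\<lambda>j. y j P"] xy[of P] show ?thesis
      by (simp add: z_def o_def)
  qed
  have "\<exists>G. clears r \<Phi> (z j) lam G \<and> nsum G w < A'" for j
    using j0[of "j + j0"] unfolding super_def INF_less_iff z_def by auto
  then obtain G where G: "\<And>j. clears r \<Phi> (z j) lam (G j)" "\<And>j. nsum (G j) w < A'" by metis
  \<comment> \<open>\<open>Q n u\<close> says that membership of the \<open>n\<close>-th generator
    is constant along \<open>u\<close>; along the diagonal sequence every membership is then
    eventually constant.\<close>
  define Q where "Q n u \<longleftrightarrow> (\<exists>b. \<forall>j. ((from_nat n :: 'g) \<in> G (u j)) = b)" for n and u :: "nat \<Rightarrow> nat"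
  interpret subseqs Q
  proof
    fix n and u :: "nat \<Rightarrow> nat" assume u: "strict_mono u"
    have "\<exists>b. infinite {j. (from_nat n \<in> G (u j)) = b}"
    proof (rule ccontr)
      assume "\<not> ?thesis"
      then have "finite ({j. (from_nat n \<in> G (u j)) = True} \<union> {j. (from_nat n \<in> G (u j)) = False})" by blast
      moreover have "{j. (from_nat n \<in> G (u j)) = True} \<union> {j. (from_nat n \<in> G (u j)) = False} = UNIV" by auto
      ultimately show False by (metis infinite_UNIV_nat)
    qed
    then obtain b where "infinite {j. (from_nat n \<in> G (u j)) = b}" by auto
    from infinite_enumerate[OF this] show "\<exists>r'. strict_mono r' \<and> Q n (u \<circ> r')"
      unfolding Q_def by auto
  qed
  define d where "d = diagseq"
  have ev: "\<exists>b. \<forall>\<^sub>F j in sequentially. (g \<in> G (d j)) = b" for g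
  proof -
    have "Q (to_nat g) (d \<circ> (+) (Suc (to_nat g)))"
      unfolding d_def by (rule diagseq_holds) (auto simp: Q_def)
    then obtain b where "\<forall>j. (g \<in> G (d (Suc (to_nat g) + j))) = b" unfolding Q_def by auto
    then have "\<forall>j\<ge>Suc (to_nat g). (g \<in> G (d j)) = b" by (metis le_Suc_ex)
    then show ?thesis unfolding eventually_sequentially by auto
  qed
  define H where "H = {g. \<forall>\<^sub>F j in sequentially. g \<in> G (d j)}"
  have evH: "\<forall>\<^sub>F j in sequentially. (g \<in> G (d j)) = (g \<in> H)" for g
  proof (cases "g \<in> H")
    case False
    obtain b where b: "\<forall>\<^sub>F j in sequentially. (g \<in> G (d j)) = b" using ev[of g] by auto
    show ?thesis
    proof (cases b)
      case True
      then have "g \<in> H" using b by (simp add: H_def)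
      with False show ?thesis by simp
    next
      case f: False
      from b show ?thesis by eventually_elim (simp add: f False)
    qed
  qed (auto simp: H_def)
  have "nsum H w \<le> A'"
  proof -
    have "nsum H w \<le> (\<integral>\<^sup>+g. liminf (\<lambda>j. w g * indicator (G (d j)) g) \<partial>count_space UNIV)"
      unfolding nsum_ind[of H]
    proof (intro nn_integral_mono Liminf_bounded)
      fix g show "\<forall>\<^sub>F j in sequentially. w g * indicator H g \<le> w g * indicator (G (d j)) g"
        using evH[of g] by eventually_elim (auto split: split_indicator)
    qed
    also have "\<dots> \<le> liminf (\<lambda>j. nsum (G (d j)) w)"
      unfolding nsum_ind[of "G _"] by (rule nn_integral_liminf) simp
    also have "\<dots> \<le> A'"
      by (rule Liminf_le) (auto intro!: always_eventually less_imp_le G(2))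
    finally show ?thesis .
  qed
  moreover have "clears r \<Phi> x lam H"
    unfolding clears_def
  proof
    fix g
    have "cut x (m g - \<Union>(m ` H)) P \<le> liminf (\<lambda>j. cut (z (d j)) (m g - \<Union>(m ` G (d j))) P)" for P
    proof (cases "P \<in> m g - \<Union>(m ` H)")
      case True
      have "\<forall>\<^sub>F j in sequentially. \<forall>h\<in>{h. P \<in> m h \<and> w h \<le> ennreal A}. (h \<in> G (d j)) = (h \<in> H)"
        using evH by (intro eventually_ball_finite finite_above) auto
      then have "\<forall>\<^sub>F j in sequentially. P \<in> m g - \<Union>(m ` G (d j))"
      proof eventually_elim
        case (elim j)
        have "h \<notin> G (d j)" if "P \<in> m h" for h
        proof
          assume h: "h \<in> G (d j)"
          then have "w h \<le> nsum (G (d j)) w" by (rule nsum_ge)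
          also have "\<dots> \<le> ennreal A" using G(2)[of "d j"] A by simp
          finally show False using elim that h True by auto
        qed
        then show ?case using True by auto
      qed
      then have "liminf (\<lambda>j. cut (z (d j)) (m g - \<Union>(m ` G (d j))) P) = liminf (\<lambda>j. z (d j) P)"
        by (intro Liminf_eq) (erule eventually_mono, simp add: cut_def)
      moreover have "liminf (\<lambda>j. z j P) \<le> liminf (\<lambda>j. z (d j) P)"
        using liminf_subseq_mono[OF subseq_diagseq, of "\<lambda>j. z j P"] by (simp add: d_def o_def)
      ultimately show ?thesis using True xz[of P] by (simp add: cut_def)
    qed (simp add: cut_def)
    then have "\<Phi> (cut x (m g - \<Union>(m ` H))) \<le> liminf (\<lambda>j. \<Phi> (cut (z (d j)) (m g - \<Union>(m ` G (d j)))))"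
      by (rule good_liminf[OF \<Phi>])
    also have "\<dots> \<le> ennreal (lam powr r) * w g"
      using G(1) by (intro Liminf_le always_eventually) (auto simp: clears_def)
    finally show "\<Phi> (cut x (m g - \<Union>(m ` H))) \<le> ennreal (lam powr r) * w g" .
  qed
  ultimately have "super r \<Phi> x lam \<le> A'" using super_le order_trans by blast
  with A'(2) show False by simp
qed

text \<open>The \<open>i\<close>-th term is cleared at a level lowered by
  \<open>2 powr (- d * real i)\<close>. Since \<open>d * r\<close> exceeds \<open>e\<close>, this
  outweighs the loss \<open>2 powr (e * real i)\<close> in the bound for suprema, and the condition
  on \<open>c\<close> makes the resulting geometric series at most one.\<close>

lemma super_SUP:
  assumes C: "0 < C" "\<And>x. \<Phi> (\<lambda>P. SUP i. x i P) \<le> ennreal C * (\<Sum>i::nat. ennreal (2 powr (e * real i)) * \<Phi> (x i))"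
    and d: "e < d * r" and lam: "0 < lam" and c: "0 < c" "C * c powr r \<le> 1 - 2 powr (e - d * r)"
  shows "super r \<Phi> (\<lambda>P. SUP i. x i P) lam \<le> (\<Sum>i. super r \<Phi> (x i) (c * 2 powr (- d * real i) * lam))"
proof (rule ennreal_le_epsilon)
  fix e' :: real assume e': "0 < e'"
  define l where "l i = c * 2 powr (- d * real i) * lam" for i :: nat
  have "\<exists>G. clears r \<Phi> (x i) (l i) G \<and> nsum G w \<le> super r \<Phi> (x i) (l i) + ennreal (e' * (1/2) ^ Suc i)" for i
    using super_near[of "e' * (1/2) ^ Suc i" "x i" "l i"] e' by auto
  then obtain G where G: "\<And>i. clears r \<Phi> (x i) (l i) (G i)"
     "\<And>i. nsum (G i) w \<le> super r \<Phi> (x i) (l i) + ennreal (e' * (1/2) ^ Suc i)" by metis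
  have "clears r \<Phi> (\<lambda>P. SUP i. x i P) lam (\<Union>i. G i)"
    unfolding clears_def
  proof
    fix g
    define \<rho> where "\<rho> = 2 powr (e - d * r)"
    have \<rho>: "0 < \<rho>" "\<rho> < 1" unfolding \<rho>_def using d powr_less_one[of 2 "e - d * r"] by (auto simp: powr_less_one)
    have "cut (\<lambda>P. SUP i. x i P) (m g - \<Union>(m ` (\<Union>i. G i))) P \<le> (SUP i. cut (x i) (m g - \<Union>(m ` G i)) P)" for P
      by (cases "P \<in> m g - \<Union>(m ` (\<Union>i. G i))") (auto simp: cut_def)
    then have "\<Phi> (cut (\<lambda>P. SUP i. x i P) (m g - \<Union>(m ` (\<Union>i. G i)))) \<le> \<Phi> (\<lambda>P. SUP i. cut (x i) (m g - \<Union>(m ` G i)) P)"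
      by (rule good_mono[OF \<Phi>])
    also have "\<dots> \<le> ennreal C * (\<Sum>i. ennreal (2 powr (e * real i)) * \<Phi> (cut (x i) (m g - \<Union>(m ` G i))))"
      by (rule C)
    also have "\<dots> \<le> ennreal C * (\<Sum>i. ennreal (2 powr (e * real i)) * (ennreal (l i powr r) * w g))"
      using G(1) by (intro mult_left_mono suminf_le) (auto simp: clears_def)
    also have "\<dots> = ennreal C * (\<Sum>i. ennreal ((c * lam) powr r * \<rho> ^ i) * w g)"
    proof -
      have "2 powr (e * real i) * l i powr r = (c * lam) powr r * \<rho> ^ i" for i
        using c lam \<rho> by (simp add: l_def \<rho>_def powr_mult powr_powr powr_realpow[symmetric] powr_add[symmetric] algebra_simps)
      then show ?thesis by (simp add: mult.assoc[symmetric] ennreal_mult[symmetric])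
    qed
    also have "\<dots> = ennreal C * ennreal ((c * lam) powr r / (1 - \<rho>)) * w g"
    proof -
      have "(\<Sum>i. ennreal ((c * lam) powr r * \<rho> ^ i)) = ennreal ((c * lam) powr r / (1 - \<rho>))"
        using \<rho> suminf_geometric[of \<rho>]
        by (subst suminf_ennreal2) (auto intro!: summable_mult summable_geometric simp: suminf_mult divide_inverse)
      then show ?thesis by (simp add: mult.assoc)
    qed
    also have "\<dots> \<le> ennreal (lam powr r) * w g"
    proof (rule mult_right_mono)
      have "C * ((c * lam) powr r / (1 - \<rho>)) = (C * c powr r / (1 - \<rho>)) * lam powr r"
        using c lam by (simp add: powr_mult)
      also have "\<dots> \<le> 1 * lam powr r" using c \<rho> by (intro mult_right_mono) (auto simp: \<rho>_def)
      finally show "ennreal C * ennreal ((c * lam) powr r / (1 - \<rho>)) \<le> ennreal (lam powr r)"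
        using C(1) \<rho> by (simp add: ennreal_mult[symmetric] ennreal_leI)
    qed simp
    finally show "\<Phi> (cut (\<lambda>P. SUP i. x i P) (m g - \<Union>(m ` (\<Union>i. G i)))) \<le> ennreal (lam powr r) * w g" .
  qed
  then have "super r \<Phi> (\<lambda>P. SUP i. x i P) lam \<le> nsum (\<Union>i. G i) w" by (rule super_le)
  also have "\<dots> \<le> (\<Sum>i. nsum (G i) w)" by (rule nsum_UN_nat_le)
  also have "\<dots> \<le> (\<Sum>i. super r \<Phi> (x i) (l i) + ennreal (e' * (1/2) ^ Suc i))"
    using G(2) by (intro suminf_le) auto
  also have "\<dots> = (\<Sum>i. super r \<Phi> (x i) (l i)) + (\<Sum>i. ennreal (e' * (1/2) ^ Suc i))"
    by (rule suminf_add[symmetric]) auto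
  also have "(\<Sum>i. ennreal (e' * (1/2) ^ Suc i)) = ennreal e'"
    using e' sums_mult[OF power_half_series, of e'] by (intro suminf_ennreal_eq) auto
  finally show "super r \<Phi> (\<lambda>P. SUP i. x i P) lam \<le> (\<Sum>i. super r \<Phi> (x i) (c * 2 powr (- d * real i) * lam)) + ennreal e'"
    by (simp add: l_def)
qed

text \<open>For a generator over \<open>P\<close>, the value of \<open>\<Phi>\<close> on the single
  tile \<open>P\<close> obeys the size bound at arbitrarily small levels, hence it is zero, and
  definiteness concludes.\<close>

lemma clears_small_imp_zero:
  assumes "\<And>e. 0 < e \<Longrightarrow> \<exists>lam G. 0 < lam \<and> lam \<le> e \<and> clears r \<Phi> x lam G \<and> P \<notin> \<Union>(m ` G)"
  shows "x P = 0"
proof -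
  obtain g where g: "P \<in> m g" using cover by auto
  have le: "\<Phi> (cut x {P}) \<le> ennreal (e powr r) * w g" if e: "0 < e" for e
  proof -
    obtain lam G where G: "0 < lam" "lam \<le> e" "clears r \<Phi> x lam G" "P \<notin> \<Union>(m ` G)"
      using assms[OF e] by blast
    have "\<Phi> (cut x {P}) \<le> \<Phi> (cut x (m g - \<Union>(m ` G)))"
      using g G(4) by (intro good_cut_mono[OF \<Phi>]) auto
    also have "\<dots> \<le> ennreal (lam powr r) * w g" using G(3) by (auto simp: clears_def)
    also have "\<dots> \<le> ennreal (e powr r) * w g"
      using G r by (intro mult_right_mono ennreal_leI powr_mono2) auto
    finally show ?thesis .
  qed
  have "\<Phi> (cut x {P}) \<le> 0 + ennreal e" if e: "0 < e" for e
  proof -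
    obtain W where W: "w g = ennreal W" "W > 0" using w_fin[of g] w_pos[of g]
      by (cases "w g" rule: ennreal_cases) auto
    have "\<Phi> (cut x {P}) \<le> ennreal (((e / W) powr (1 / r)) powr r) * w g"
      using e W by (intro le) auto
    also have "\<dots> = ennreal e" using e W r by (simp add: powr_powr ennreal_mult[symmetric])
    finally show ?thesis by simp
  qed
  then have "\<Phi> (cut x {P}) \<le> 0" by (rule ennreal_le_epsilon)
  then have "cut x {P} P = 0" using good_definite[OF \<Phi>] by simp
  then show "x P = 0" by (simp add: cut_def)
qed

text \<open>The support is finite and the weights over each of its tiles are bounded below, so the
  sizes are uniformly bounded; generators that miss the support contribute zero.\<close>

lemma fsup_bound:
  assumes x: "fsup x"
  obtains L where "0 < L" "\<And>g. \<Phi> (cut x (m g)) \<le> ennreal (L powr r) * w g"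
proof -
  define F where "F = {P. x P \<noteq> 0}"
  have F: "finite F" using x by (simp add: F_def fsup_def)
  have "\<exists>w0. 0 < w0 \<and> w0 < top \<and> (\<forall>g. P \<in> m g \<longrightarrow> w0 \<le> w g)" for P using min_weight[of P] by metis
  then obtain v where v: "\<And>P. 0 < v P" "\<And>P. v P < top" "\<And>P g. P \<in> m g \<Longrightarrow> v P \<le> w g" by metis
  have ex: "\<exists>L>0. \<forall>P\<in>F. \<Phi> x \<le> ennreal (L powr r) * v P"
  proof -
    have "\<exists>L>0. \<Phi> x \<le> ennreal (L powr r) * v P" for P
    proof -
      obtain a b where a: "\<Phi> x = ennreal a" "0 \<le> a" and b: "v P = ennreal b" "0 < b"
        using good_fsup[OF \<Phi> x] v(1,2)[of P]
        by (cases "\<Phi> x" rule: ennreal_cases; cases "v P" rule: ennreal_cases) auto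
      have "\<Phi> x \<le> ennreal ((((a + 1) / b) powr (1 / r)) powr r) * v P"
        using a b r by (simp add: powr_powr ennreal_mult[symmetric])
      then show ?thesis using a b by (intro exI[of _ "((a + 1) / b) powr (1 / r)"]) auto
    qed
    then obtain L where L: "\<And>P. L P > 0" "\<And>P. \<Phi> x \<le> ennreal (L P powr r) * v P" by metis
    let ?M = "Max (insert 1 (L ` F))"
    have "\<Phi> x \<le> ennreal (?M powr r) * v P" if "P \<in> F" for P
    proof -
      have "L P \<le> ?M" using F that by auto
      then have "ennreal (L P powr r) * v P \<le> ennreal (?M powr r) * v P"
        using r L(1)[of P] by (intro mult_right_mono ennreal_leI powr_mono2) auto
      then show ?thesis using L(2)[of P] by order
    qed
    moreover have "?M > 0" using F by (meson Max_ge finite_imageI finite_insert insertI1 less_le_trans zero_less_one)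
    ultimately show ?thesis by blast
  qed
  then obtain L where L: "0 < L" "\<And>P. P \<in> F \<Longrightarrow> \<Phi> x \<le> ennreal (L powr r) * v P" by auto
  show ?thesis
  proof (rule that[OF L(1)])
    fix g
    show "\<Phi> (cut x (m g)) \<le> ennreal (L powr r) * w g"
    proof (cases "\<exists>P\<in>F. P \<in> m g")
      case True
      then obtain P where P: "P \<in> F" "P \<in> m g" by auto
      have "\<Phi> (cut x (m g)) \<le> \<Phi> x" by (intro good_mono[OF \<Phi>] cut_le)
      also have "\<dots> \<le> ennreal (L powr r) * v P" by (rule L) fact
      also have "\<dots> \<le> ennreal (L powr r) * w g"
        using P v(3) by (intro mult_left_mono) auto
      finally show ?thesis .
    next
      case False
      then have "cut x (m g) = (\<lambda>P. 0)" by (intro cut_eq_0) (auto simp: F_def)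
      then show ?thesis by (simp add: good_zero[OF \<Phi>])
    qed
  qed
qed

lemma out_good:
  assumes q: "0 < q"
  shows "good q (out r \<Phi> q)"
  unfolding good_def
proof (intro conjI allI impI)
  fix x y :: "'p \<Rightarrow> ennreal" assume "\<forall>P. x P \<le> y P"
  then show "out r \<Phi> q x \<le> out r \<Phi> q y"
    unfolding out_def by (intro wint_mono super_mono) auto
next
  have "clears r \<Phi> (\<lambda>P. 0) lam {}" for lam
    unfolding clears_def by (simp add: cut_def good_zero[OF \<Phi>])
  then have "super r \<Phi> (\<lambda>P. 0) lam = 0" for lam
    using super_le[of r \<Phi> "\<lambda>P. 0" lam "{}"] by simp
  then show "out r \<Phi> q (\<lambda>P. 0) = 0" unfolding out_def wint_def by simp
next
  fix c :: real and x :: "'p \<Rightarrow> ennreal" assume c: "0 < c"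
  have "out r \<Phi> q (\<lambda>P. ennreal c * x P) = ennreal (c powr q) * wint q (\<lambda>lam. super r \<Phi> (\<lambda>P. ennreal c * x P) (c * lam))"
    unfolding out_def by (rule wint_scale[OF decr_super c])
  also have "wint q (\<lambda>lam. super r \<Phi> (\<lambda>P. ennreal c * x P) (c * lam)) = out r \<Phi> q x"
    unfolding out_def by (intro antisym wint_mono) (auto simp: super_scale c)
  finally show "out r \<Phi> q (\<lambda>P. ennreal c * x P) = ennreal (c powr q) * out r \<Phi> q x" .
next
  fix x :: "'p \<Rightarrow> ennreal" and P assume 0: "out r \<Phi> q x = 0"
  have s0: "super r \<Phi> x lam = 0" if "0 < lam" for lam
    using wint_ge[OF decr_super q that, of x] 0 that by (simp add: out_def)
  obtain w0 where w0: "0 < w0" "w0 < top" "\<And>g. P \<in> m g \<Longrightarrow> w0 \<le> w g" by (rule min_weight[of P]) blast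
  show "x P = 0"
  proof (rule clears_small_imp_zero)
    fix e :: real assume e: "0 < e"
    have "super r \<Phi> x e < w0" using s0[OF e] w0 by simp
    then obtain G where G: "clears r \<Phi> x e G" "nsum G w < w0" unfolding super_def INF_less_iff by auto
    have "P \<notin> \<Union>(m ` G)" using w0(3) G(2) by (rule sum_less_min_weight)
    then show "\<exists>lam G. 0 < lam \<and> lam \<le> e \<and> clears r \<Phi> x lam G \<and> P \<notin> \<Union>(m ` G)" using e G by auto
  qed
next
  fix x :: "'p \<Rightarrow> ennreal" and y assume "\<forall>P. x P \<le> liminf (\<lambda>j. y j P)"
  then have "out r \<Phi> q x \<le> wint q (\<lambda>lam. liminf (\<lambda>j. super r \<Phi> (y j) lam))"
    unfolding out_def by (intro wint_mono super_liminf) auto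
  also have "\<dots> \<le> liminf (\<lambda>j. out r \<Phi> q (y j))"
    unfolding out_def by (rule wint_liminf) (rule decr_super)
  finally show "out r \<Phi> q x \<le> liminf (\<lambda>j. out r \<Phi> q (y j))" .
next
  fix e :: real assume e: "0 < e"
  \<comment> \<open>Lowering the level of the \<open>i\<close>-th term by
    \<open>2 powr (- d * real i)\<close> multiplies its contribution by
    \<open>2 powr (d * q * real i)\<close>, which has to be \<open>2 powr (e * real i)\<close>. The
    exponent \<open>e'\<close> is half of \<open>d * r\<close>, which leaves a convergent geometric
    series.\<close>
  define d e' where "d = e / q" and "e' = e * r / (2 * q)"
  have "0 < e'" using e r q by (simp add: e'_def)
  from good_SUP[OF \<Phi> this] obtain C where C: "C > 0"
    "\<And>x. \<Phi> (\<lambda>P. SUP i. x i P) \<le> ennreal C * (\<Sum>i::nat. ennreal (2 powr (e' * real i)) * \<Phi> (x i))" by blast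
  have dr: "e' < d * r" using e r q by (simp add: e'_def d_def field_simps)
  define \<rho> where "\<rho> = 2 powr (e' - d * r)"
  have \<rho>: "0 < \<rho>" "\<rho> < 1" unfolding \<rho>_def using dr powr_less_one[of 2 "e' - d * r"] by auto
  \<comment> \<open>Solves \<open>C * c powr r = 1 - \<rho>\<close>, the summation condition of
    \<open>super_SUP\<close>.\<close>
  define c where "c = ((1 - \<rho>) / C) powr (1 / r)"
  have c: "0 < c" "C * c powr r \<le> 1 - 2 powr (e' - d * r)"
    using C(1) \<rho> r by (auto simp: c_def powr_powr \<rho>_def[symmetric])
  show "\<exists>C>0. \<forall>x. out r \<Phi> q (\<lambda>P. SUP i. x i P) \<le> ennreal C * (\<Sum>i::nat. ennreal (2 powr (e * real i)) * out r \<Phi> q (x i))"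
  proof (intro exI[of _ "c powr - q"] conjI allI)
    show "0 < c powr - q" using c by simp
    fix x :: "nat \<Rightarrow> 'p \<Rightarrow> ennreal"
    let ?a = "\<lambda>i::nat. c * 2 powr (- d * real i)"
    have a: "?a i > 0" for i using c by simp
    have dec: "decr (\<lambda>lam. super r \<Phi> (x i) (?a i * lam))" for i
      using decr_super[of "x i"] a[of i] unfolding decr_def by (metis mult_le_cancel_left_pos mult_pos_pos)
    have "out r \<Phi> q (\<lambda>P. SUP i. x i P) \<le> wint q (\<lambda>lam. \<Sum>i. super r \<Phi> (x i) (?a i * lam))"
      unfolding out_def by (intro wint_mono super_SUP[OF C dr _ c])
    also have "\<dots> = (\<Sum>i. wint q (\<lambda>lam. super r \<Phi> (x i) (?a i * lam)))"
      by (rule wint_suminf) (rule dec)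
    also have "\<dots> = (\<Sum>i. ennreal (c powr - q) * (ennreal (2 powr (e * real i)) * out r \<Phi> q (x i)))"
    proof (rule suminf_cong)
      fix i
      have b: "?a i powr - q = c powr - q * 2 powr (e * real i)"
        using c q by (simp add: powr_mult powr_powr d_def field_simps)
      have "ennreal (?a i powr - q) * out r \<Phi> q (x i) =
        ennreal (?a i powr - q) * (ennreal (?a i powr q) * wint q (\<lambda>lam. super r \<Phi> (x i) (?a i * lam)))"
        unfolding out_def by (subst wint_scale[OF decr_super a]) rule
      also have "\<dots> = wint q (\<lambda>lam. super r \<Phi> (x i) (?a i * lam))"
      proof -
        have "?a i powr - q * ?a i powr q = 1" using a[of i] c by (simp only: powr_add[symmetric]) simp
        then have "ennreal (?a i powr - q) * ennreal (?a i powr q) = 1"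
          by (subst ennreal_mult[symmetric]) auto
        then show ?thesis by (simp add: mult.assoc[symmetric])
      qed
      finally show "wint q (\<lambda>lam. super r \<Phi> (x i) (?a i * lam)) = ennreal (c powr - q) * (ennreal (2 powr (e * real i)) * out r \<Phi> q (x i))"
        unfolding b by (simp add: ennreal_mult mult.assoc)
    qed
    also have "\<dots> = ennreal (c powr - q) * (\<Sum>i. ennreal (2 powr (e * real i)) * out r \<Phi> q (x i))"
      by (rule ennreal_suminf_cmult)
    finally show "out r \<Phi> q (\<lambda>P. SUP i. x i P) \<le> ennreal (c powr - q) * (\<Sum>i::nat. ennreal (2 powr (e * real i)) * out r \<Phi> q (x i))" .
  qed
next
  fix x :: "'p \<Rightarrow> ennreal" assume x: "fsup x"
  define F where "F = {P. x P \<noteq> 0}"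
  have F: "finite F" using x by (simp add: F_def fsup_def)
  \<comment> \<open>One generator for each support tile gives a finite family that clears
    \<open>x\<close> at every level, so \<open>super\<close> is bounded; from the level
    \<open>L\<close> of \<open>fsup_bound\<close> on it vanishes.\<close>
  obtain h where h: "\<And>P. P \<in> m (h P)" using cover by metis
  define B where "B = nsum (h ` F) w"
  have B: "B < top" unfolding B_def using F w_fin
    by (simp add: nn_integral_count_space_finite less_top[symmetric])
  have bd: "super r \<Phi> x lam \<le> B" for lam
    unfolding B_def
  proof (rule super_le, unfold clears_def, rule)
    fix g
    have "cut x (m g - \<Union>(m ` h ` F)) = (\<lambda>P. 0)" using h by (intro cut_eq_0) (auto simp: F_def)
    then show "\<Phi> (cut x (m g - \<Union>(m ` h ` F))) \<le> ennreal (lam powr r) * w g" by (simp add: good_zero[OF \<Phi>])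
  qed
  obtain L where L: "0 < L" "\<And>g. \<Phi> (cut x (m g)) \<le> ennreal (L powr r) * w g"
    using fsup_bound[OF x] by blast
  have z: "super r \<Phi> x lam = 0" if "L \<le> lam" for lam
  proof -
    have "clears r \<Phi> x lam {}"
      unfolding clears_def
    proof
      fix g
      have "\<Phi> (cut x (m g)) \<le> ennreal (L powr r) * w g" by (rule L)
      also have "\<dots> \<le> ennreal (lam powr r) * w g"
        using that L(1) r by (intro mult_right_mono ennreal_leI powr_mono2) auto
      finally show "\<Phi> (cut x (m g - \<Union>(m ` {}))) \<le> ennreal (lam powr r) * w g" by simp
    qed
    from super_le[OF this] show ?thesis by simp
  qed
  have "out r \<Phi> q x \<le> wint q (\<lambda>lam. B * indicator {..<L} lam)"
    unfolding out_def using bd z by (intro wint_mono) (auto split: split_indicator simp: not_less)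
  also have "\<dots> = B * ennreal (L powr q)" using L q by (intro wint_step) auto
  also have "\<dots> < top" using B by (simp add: ennreal_mult_less_top)
  finally show "out r \<Phi> q x < top" .
qed

end

end


section \<open>Power sums and Young's inequality\<close>

definition psum :: "real \<Rightarrow> ('p \<Rightarrow> ennreal) \<Rightarrow> ennreal" where
  "psum r x = nsum UNIV (\<lambda>P. epow (x P) r)"

definition pairing :: "('p \<Rightarrow> ennreal) \<Rightarrow> ('p \<Rightarrow> ennreal) \<Rightarrow> ennreal" where
  "pairing x y = nsum UNIV (\<lambda>P. x P * y P)"

text \<open>Hoelder's inequality in Young's form. By homogeneity the product form follows, see
  \<open>norm_bound\<close>; the additive form passes through the outer construction more
  easily.\<close>

definition dual_bound :: "(('p \<Rightarrow> ennreal) \<Rightarrow> ennreal) \<Rightarrow> (('p \<Rightarrow> ennreal) \<Rightarrow> ennreal) \<Rightarrow> real \<Rightarrow> bool" where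
  "dual_bound \<Phi> \<Psi> K \<longleftrightarrow> 0 < K \<and> (\<forall>x y. pairing x y \<le> ennreal K * (\<Phi> x + \<Psi> y))"

lemma psum_good:
  assumes r: "0 < r"
  shows "good r (psum r :: ('p \<Rightarrow> ennreal) \<Rightarrow> ennreal)"
  unfolding good_def
proof (intro conjI allI impI)
  fix x y :: "'p \<Rightarrow> ennreal" assume "\<forall>P. x P \<le> y P"
  then show "psum r x \<le> psum r y" unfolding psum_def by (intro nn_integral_mono epow_mono r) auto
next
  show "psum r (\<lambda>P::'p. 0) = 0" by (simp add: psum_def)
next
  fix c :: real and x :: "'p \<Rightarrow> ennreal" assume "0 < c"
  then show "psum r (\<lambda>P. ennreal c * x P) = ennreal (c powr r) * psum r x"
    by (simp add: psum_def epow_mult epow_ennreal nn_integral_cmult)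
next
  fix x :: "'p \<Rightarrow> ennreal" and P assume "psum r x = 0"
  then show "x P = 0" using nsum_ge[of P UNIV "\<lambda>P. epow (x P) r"] by (simp add: psum_def)
next
  fix x :: "'p \<Rightarrow> ennreal" and y :: "nat \<Rightarrow> 'p \<Rightarrow> ennreal" assume *: "\<forall>P. x P \<le> liminf (\<lambda>j. y j P)"
  have "psum r x \<le> nsum UNIV (\<lambda>P. liminf (\<lambda>j. epow (y j P) r))"
    unfolding psum_def
    by (intro nn_integral_mono order_trans[OF epow_mono[OF r] epow_liminf_le[OF r]] *[rule_format])
  also have "\<dots> \<le> liminf (\<lambda>j. psum r (y j))"
    unfolding psum_def by (rule nn_integral_liminf) simp
  finally show "psum r x \<le> liminf (\<lambda>j. psum r (y j))" .
next
  fix e :: real assume e: "0 < e"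
  have "psum r (\<lambda>P. SUP i. x i P) \<le> ennreal 1 * (\<Sum>i. ennreal (2 powr (e * real i)) * psum r (x i))" for x :: "nat \<Rightarrow> 'p \<Rightarrow> ennreal"
  proof -
    have "epow (SUP i. x i P) r \<le> (\<Sum>i. epow (x i P) r)" for P
    proof -
      have "epow (SUP i. x i P) r \<le> (SUP i. epow (x i P) r)" by (rule epow_SUP_le[OF r])
      also have "\<dots> \<le> (\<Sum>i. epow (x i P) r)"
        using nsum_ge[of _ "UNIV::nat set" "\<lambda>i. epow (x i P) r"]
        by (intro SUP_least) (simp add: nn_integral_count_space_nat)
      finally show ?thesis .
    qed
    then have "psum r (\<lambda>P. SUP i. x i P) \<le> nsum UNIV (\<lambda>P. \<Sum>i. epow (x i P) r)"
      unfolding psum_def by (intro nn_integral_mono)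
    also have "\<dots> = (\<Sum>i. psum r (x i))"
      unfolding psum_def by (rule nn_integral_suminf) simp
    also have "\<dots> \<le> (\<Sum>i. ennreal (2 powr (e * real i)) * psum r (x i))"
    proof (rule suminf_le)
      fix i :: nat
      have "1 \<le> ennreal (2 powr (e * real i))" using e by (simp add: ge_one_powr_ge_zero)
      then have "1 * psum r (x i) \<le> ennreal (2 powr (e * real i)) * psum r (x i)" by (intro mult_right_mono) auto
      then show "psum r (x i) \<le> ennreal (2 powr (e * real i)) * psum r (x i)" by simp
    qed auto
    finally show ?thesis by simp
  qed
  then show "\<exists>C>0. \<forall>x. psum r (\<lambda>P::'p. SUP i. x i P) \<le> ennreal C * (\<Sum>i. ennreal (2 powr (e * real i)) * psum r (x i))"
    by (intro exI[of _ 1]) auto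
next
  fix x :: "'p \<Rightarrow> ennreal" assume x: "fsup x"
  have "psum r x = (\<Sum>P\<in>{P. x P \<noteq> 0}. epow (x P) r)"
    unfolding psum_def using x by (intro nn_integral_count_space') (auto simp: fsup_def)
  also have "\<dots> < top" using x by (simp add: fsup_def less_top[symmetric])
  finally show "psum r x < top" .
qed

lemma conj_exp_props:
  assumes "1 < q"
  shows "0 < conj_exp q" "1 < conj_exp q" "(q - 1) * conj_exp q = q" "conj_exp (conj_exp q) = q"
    "1 / q + 1 / conj_exp q = 1" "(conj_exp q - 1) * q = conj_exp q" "1 / (q - 1) + 1 = conj_exp q"
  using assms by (auto simp: conj_exp_def field_simps)

text \<open>Without the usual factors: either \<open>b\<close> is at most
  \<open>epow a (r - 1)\<close> and the first term alone dominates, or \<open>a\<close> is at most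
  \<open>epow b (1 / (r - 1))\<close> and the second one does.\<close>

lemma young:
  assumes r: "1 < r"
  shows "a * b \<le> epow a r + epow b (conj_exp r)"
proof (cases "b \<le> epow a (r - 1)")
  case True
  then have "a * b \<le> a * epow a (r - 1)" by (intro mult_left_mono) auto
  also have "\<dots> = epow a r" using epow_add[of 1 "r - 1" a] r by simp
  finally show ?thesis by (simp add: add_increasing2)
next
  case False
  then have "epow a (r - 1) \<le> b" by simp
  then have "a \<le> epow b (1 / (r - 1))" using r by (simp add: epow_swap_le)
  then have "a * b \<le> epow b (1 / (r - 1)) * b" by (intro mult_right_mono) auto
  also have "\<dots> = epow b (conj_exp r)"
    using epow_add[of "1 / (r - 1)" 1 b] r conj_exp_props(7)[OF r] by simp
  finally show ?thesis by (simp add: add_increasing)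
qed

lemma psum_dual_bound: "1 < r \<Longrightarrow> dual_bound (psum r) (psum (conj_exp r)) 1"
  unfolding dual_bound_def psum_def pairing_def
  by (auto simp: nn_integral_add[symmetric] intro!: nn_integral_mono young)

lemma pairing_scale: "pairing (\<lambda>P. ennreal a * x P) (\<lambda>P. ennreal b * y P) = ennreal a * ennreal b * pairing x y"
proof -
  have "pairing (\<lambda>P. ennreal a * x P) (\<lambda>P. ennreal b * y P) = nsum UNIV (\<lambda>P. ennreal a * ennreal b * (x P * y P))"
    unfolding pairing_def by (intro nn_integral_cong) (simp add: ac_simps)
  then show ?thesis unfolding pairing_def by (simp add: nn_integral_cmult)
qed

lemma pairing_mono: "(\<And>P. x P \<le> x' P) \<Longrightarrow> (\<And>P. y P \<le> y' P) \<Longrightarrow> pairing x y \<le> pairing x' y'"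
  unfolding pairing_def by (intro nn_integral_mono mult_mono) auto

text \<open>Rescaling \<open>x\<close> by \<open>1 / a\<close> and \<open>y\<close> by
  \<open>1 / b\<close> brings the two functionals down to \<open>W\<close> and \<open>W'\<close>.
  With \<open>W = W' = w g\<close> this estimates the pairing on one generator from sizes at levels
  \<open>a\<close> and \<open>b\<close>.\<close>

lemma dual_bound_scaled:
  assumes "dual_bound \<Phi> \<Psi> K" "good r \<Phi>" "good s \<Psi>" "0 < a" "0 < b"
    and x: "\<Phi> x \<le> ennreal (a powr r) * W" and y: "\<Psi> y \<le> ennreal (b powr s) * W'"
  shows "pairing x y \<le> ennreal (K * a * b) * (W + W')"
proof -
  have K: "0 < K" using assms by (auto simp: dual_bound_def)
  have cancel: "ennreal ((1 / c) powr t) * (ennreal (c powr t) * V) = V" if "0 < c" for c t V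
    using that by (simp add: mult.assoc[symmetric] ennreal_mult[symmetric] powr_mult[symmetric])
  have "pairing (\<lambda>P. ennreal (1 / a) * x P) (\<lambda>P. ennreal (1 / b) * y P)
     \<le> ennreal K * (\<Phi> (\<lambda>P. ennreal (1 / a) * x P) + \<Psi> (\<lambda>P. ennreal (1 / b) * y P))"
    using assms(1) unfolding dual_bound_def by blast
  also have "\<dots> = ennreal K * (ennreal ((1 / a) powr r) * \<Phi> x + ennreal ((1 / b) powr s) * \<Psi> y)"
    using good_scale[OF assms(2), of "1 / a" x] good_scale[OF assms(3), of "1 / b" y] assms by simp
  also have "\<dots> \<le> ennreal K * (ennreal ((1 / a) powr r) * (ennreal (a powr r) * W) + ennreal ((1 / b) powr s) * (ennreal (b powr s) * W'))"
    using x y by (intro mult_left_mono add_mono) auto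
  also have "\<dots> = ennreal K * (W + W')" using assms(4,5) by (simp add: cancel)
  finally have *: "ennreal (1 / a) * ennreal (1 / b) * pairing x y \<le> ennreal K * (W + W')"
    by (simp only: pairing_scale)
  have "pairing x y = ennreal (a * b) * (ennreal (1 / a) * ennreal (1 / b) * pairing x y)"
    using assms(4,5) by (simp add: mult.assoc[symmetric] ennreal_mult[symmetric])
  also have "\<dots> \<le> ennreal (a * b) * (ennreal K * (W + W'))" by (intro mult_left_mono *) simp
  also have "\<dots> = ennreal (K * a * b) * (W + W')"
    using assms(4,5) K by (simp add: ennreal_mult ac_simps)
  finally show ?thesis .
qed

section \<open>Dyadic sums\<close>

text \<open>Riemann-type sum for \<open>wint q S\<close> at the levels \<open>b powr k\<close>. The
  base stays free because a dual sequence is sampled at \<open>2 powr (k * (q - 1))\<close> when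
  \<open>x\<close> is sampled at \<open>2 powr k\<close>.\<close>

definition dysum :: "real \<Rightarrow> real \<Rightarrow> (real \<Rightarrow> ennreal) \<Rightarrow> ennreal" where
  "dysum b q S = nsum (UNIV :: int set) (\<lambda>k. ennreal (b powr (q * real_of_int k)) * S (b powr real_of_int k))"

lemma powr_cell:
  assumes "0 < q" "0 < a" "a \<le> c" "{a<..<c} \<subseteq> A" "A \<subseteq> {a..c}"
  shows "(\<integral>\<^sup>+lam. ennreal (q * lam powr (q - 1)) * indicator A lam \<partial>lborel) = ennreal (c powr q - a powr q)"
proof -
  have h: "((\<lambda>lam. q * lam powr (q - 1)) has_integral c powr q - a powr q) {a..c}"
    using assms
    by (intro fundamental_theorem_of_calculus)
       (auto intro!: derivative_eq_intros simp: has_real_derivative_iff_has_vector_derivative[symmetric])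
  have ne: "AE lam in lborel. lam \<noteq> (a::real) \<and> lam \<noteq> c"
    using AE_lborel_singleton[of a] AE_lborel_singleton[of c] by eventually_elim auto
  have "(\<integral>\<^sup>+lam. ennreal (q * lam powr (q - 1)) * indicator A lam \<partial>lborel)
    = (\<integral>\<^sup>+lam. ennreal (indicator {a..c} lam * (q * lam powr (q - 1))) \<partial>lborel)"
  proof (intro nn_integral_cong_AE eventually_mono[OF ne])
    fix lam assume *: "lam \<noteq> a \<and> lam \<noteq> c"
    then have "lam \<in> A \<longleftrightarrow> lam \<in> {a..c}" using assms(4,5) by fastforce
    then show "ennreal (q * lam powr (q - 1)) * indicator A lam = ennreal (indicator {a..c} lam * (q * lam powr (q - 1)))"
      by (auto simp: indicator_def)
  qed
  also have "\<dots> = ennreal (c powr q - a powr q)"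
    using assms by (intro nn_integral_has_integral_lebesgue[OF _ h]) auto
  finally show ?thesis .
qed

lemma nn_integral_cells:
  fixes \<kappa> :: "real \<Rightarrow> int"
  assumes [measurable]: "f \<in> borel_measurable borel" "\<kappa> \<in> borel \<rightarrow>\<^sub>M count_space UNIV"
  shows "(\<integral>\<^sup>+lam\<in>{0<..}. f lam \<partial>lborel) = nsum UNIV (\<lambda>k. \<integral>\<^sup>+lam. f lam * indicator {lam. 0 < lam \<and> \<kappa> lam = k} lam \<partial>lborel)"
proof -
  have "f lam * indicator {0<..} lam = nsum UNIV (\<lambda>k. f lam * indicator {lam. 0 < lam \<and> \<kappa> lam = k} lam)" for lam
    by (subst nn_integral_count_space'[of "{\<kappa> lam}"]) (auto simp: indicator_def)
  then have "(\<integral>\<^sup>+lam\<in>{0<..}. f lam \<partial>lborel) = (\<integral>\<^sup>+lam. nsum UNIV (\<lambda>k. f lam * indicator {lam. 0 < lam \<and> \<kappa> lam = k} lam) \<partial>lborel)"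
    by (intro nn_integral_cong) auto
  also have "\<dots> = nsum UNIV (\<lambda>k. \<integral>\<^sup>+lam. f lam * indicator {lam. 0 < lam \<and> \<kappa> lam = k} lam \<partial>lborel)"
    by (rule nn_integral_count_space_nn_integral) auto
  finally show ?thesis .
qed

lemma wint_cells:
  assumes "decr S" and [measurable]: "\<kappa> \<in> borel \<rightarrow>\<^sub>M count_space (UNIV::int set)"
  shows "wint q S = nsum UNIV (\<lambda>k. \<integral>\<^sup>+lam. ennreal (q * lam powr (q - 1)) * (S lam * indicator {0<..} lam) * indicator {lam. 0 < lam \<and> \<kappa> lam = k} lam \<partial>lborel)"
proof -
  note decr_measurable[OF assms(1), measurable]
  have "wint q S = (\<integral>\<^sup>+lam\<in>{0<..}. ennreal (q * lam powr (q - 1)) * (S lam * indicator {0<..} lam) \<partial>lborel)"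
    unfolding wint_alt by (intro nn_integral_cong) (auto split: split_indicator)
  also have "\<dots> = nsum UNIV (\<lambda>k. \<integral>\<^sup>+lam. ennreal (q * lam powr (q - 1)) * (S lam * indicator {0<..} lam) * indicator {lam. 0 < lam \<and> \<kappa> lam = k} lam \<partial>lborel)"
    by (rule nn_integral_cells) auto
  finally show ?thesis .
qed

text \<open>On a cell closed on the right, \<open>S\<close> is at least its value at the right end
  \<open>b powr k\<close>, and the cell has mass
  \<open>(1 - b powr - q) * b powr (q * k)\<close>.\<close>

lemma dysum_le_wint:
  assumes S: "decr S" and b: "1 < b" and q: "0 < q"
  shows "ennreal (1 - b powr - q) * dysum b q S \<le> wint q S"
proof -
  let ?c = "\<lambda>lam. \<lceil>log b lam\<rceil>"
  have cell: "{lam. 0 < lam \<and> ?c lam = k} = {b powr (k - 1)<..b powr k}" for k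
  proof -
    have "(0 < lam \<and> \<lceil>log b lam\<rceil> = k) \<longleftrightarrow> b powr (k - 1) < lam \<and> lam \<le> b powr k" for lam
    proof (cases "0 < lam")
      case True
      then show ?thesis using b by (simp add: ceiling_eq_iff powr_less_iff le_powr_iff)
    next
      case False
      then show ?thesis using powr_gt_zero[of b "k - 1"] b by (auto simp del: powr_gt_zero)
    qed
    then show ?thesis
      by (intro set_eqI) (simp only: mem_Collect_eq greaterThanAtMost_iff atLeastLessThan_iff)
  qed
  have "ennreal (1 - b powr - q) * dysum b q S
    = nsum UNIV (\<lambda>k. ennreal (1 - b powr - q) * (ennreal (b powr (q * real_of_int k)) * S (b powr real_of_int k)))"
    unfolding dysum_def by (simp add: nn_integral_cmult)
  also have "\<dots> \<le> wint q S"
    unfolding wint_cells[OF S, of ?c q, simplified]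
  proof (intro nn_integral_mono)
    fix k :: int
    have "ennreal (1 - b powr - q) * (ennreal (b powr (q * real_of_int k)) * S (b powr real_of_int k))
      = S (b powr k) * ennreal ((b powr k) powr q - (b powr (k - 1)) powr q)"
    proof -
      have "(1 - b powr - q) * b powr (q * k) = (b powr k) powr q - (b powr (k - 1)) powr q"
        using b by (simp add: powr_powr left_diff_distrib powr_add[symmetric] algebra_simps)
      moreover have "0 \<le> 1 - b powr - q" using b q powr_less_one[of b "- q"] by simp
      ultimately show ?thesis by (simp add: mult.assoc[symmetric] ennreal_mult[symmetric] mult.commute[of "S _"])
    qed
    also have "\<dots> = S (b powr k) * (\<integral>\<^sup>+lam. ennreal (q * lam powr (q - 1)) * indicator {b powr (k - 1)<..b powr k} lam \<partial>lborel)"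
      using b q by (subst powr_cell) auto
    also have "\<dots> = (\<integral>\<^sup>+lam. S (b powr k) * (ennreal (q * lam powr (q - 1)) * indicator {b powr (k - 1)<..b powr k} lam) \<partial>lborel)"
      by (rule nn_integral_cmult[symmetric]) simp
    also have "\<dots> \<le> (\<integral>\<^sup>+lam. ennreal (q * lam powr (q - 1)) * (S lam * indicator {0<..} lam) * indicator {b powr (k - 1)<..b powr k} lam \<partial>lborel)"
    proof (intro nn_integral_mono)
      fix lam
      show "S (b powr k) * (ennreal (q * lam powr (q - 1)) * indicator {b powr (k - 1)<..b powr k} lam) \<le>
        ennreal (q * lam powr (q - 1)) * (S lam * indicator {0<..} lam) * indicator {b powr (k - 1)<..b powr k} lam"
      proof (cases "lam \<in> {b powr (k - 1)<..b powr k}")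
        case True
        then have "0 < lam" using powr_gt_zero[of b "k - 1"] b by (auto simp del: powr_gt_zero)
        then have "S (b powr k) \<le> S lam" using S True by (auto simp: decr_def)
        then show ?thesis using True \<open>0 < lam\<close> by (simp add: mult.commute mult_left_mono mult_right_mono)
      qed simp
    qed
    finally show "ennreal (1 - b powr - q) * (ennreal (b powr (q * real_of_int k)) * S (b powr real_of_int k)) \<le>
      (\<integral>\<^sup>+lam. ennreal (q * lam powr (q - 1)) * (S lam * indicator {0<..} lam) * indicator {lam. 0 < lam \<and> ?c lam = k} lam \<partial>lborel)"
      unfolding cell .
  qed
  finally show ?thesis .
qed

lemma dysum_le:
  assumes S: "decr S" and b: "1 < b" and q: "0 < q"
  shows "dysum b q S \<le> ennreal (1 / (1 - b powr - q)) * wint q S"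
proof -
  have p: "0 < 1 - b powr - q" using b q powr_less_one[of b "-q"] by simp
  have "dysum b q S = ennreal (1 / (1 - b powr - q)) * (ennreal (1 - b powr - q) * dysum b q S)"
  proof -
    have "ennreal (1 / (1 - b powr - q)) * ennreal (1 - b powr - q) = ennreal (1 / (1 - b powr - q) * (1 - b powr - q))"
      using p by (intro ennreal_mult[symmetric]) auto
    also have "\<dots> = 1" using p by simp
    finally show ?thesis by (simp add: mult.assoc[symmetric])
  qed
  also have "\<dots> \<le> ennreal (1 / (1 - b powr - q)) * wint q S"
    by (intro mult_left_mono dysum_le_wint S b q) simp
  finally show ?thesis .
qed

text \<open>Now the cells are closed on the left, where \<open>S\<close> is largest; enlarging the
  cell down to zero gives the factor \<open>b powr q\<close>.\<close>

lemma wint_le_dysum: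
  assumes S: "decr S" and b: "1 < b" and q: "0 < q"
  shows "wint q S \<le> ennreal (b powr q) * dysum b q S"
proof -
  let ?c = "\<lambda>lam. \<lfloor>log b lam\<rfloor>"
  have cell: "{lam. 0 < lam \<and> ?c lam = k} = {b powr k..<b powr (k + 1)}" for k
  proof -
    have "(0 < lam \<and> \<lfloor>log b lam\<rfloor> = k) \<longleftrightarrow> b powr k \<le> lam \<and> lam < b powr (k + 1)" for lam
    proof (cases "0 < lam")
      case True
      then show ?thesis using b by (simp add: floor_eq_iff powr_le_iff less_powr_iff)
    next
      case False
      then show ?thesis using powr_gt_zero[of b k] b by (auto simp del: powr_gt_zero)
    qed
    then show ?thesis
      by (intro set_eqI) (simp only: mem_Collect_eq greaterThanAtMost_iff atLeastLessThan_iff)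
  qed
  have "wint q S \<le> nsum UNIV (\<lambda>k::int. ennreal (b powr q) * (ennreal (b powr (q * real_of_int k)) * S (b powr real_of_int k)))"
    unfolding wint_cells[OF S, of ?c q, simplified]
  proof (intro nn_integral_mono)
    fix k :: int
    have "(\<integral>\<^sup>+lam. ennreal (q * lam powr (q - 1)) * (S lam * indicator {0<..} lam) * indicator {b powr k..<b powr (k + 1)} lam \<partial>lborel)
      \<le> (\<integral>\<^sup>+lam. S (b powr k) * (ennreal (q * lam powr (q - 1)) * indicator {b powr k..<b powr (k + 1)} lam) \<partial>lborel)"
    proof (intro nn_integral_mono)
      fix lam
      show "ennreal (q * lam powr (q - 1)) * (S lam * indicator {0<..} lam) * indicator {b powr k..<b powr (k + 1)} lam
        \<le> S (b powr k) * (ennreal (q * lam powr (q - 1)) * indicator {b powr k..<b powr (k + 1)} lam)"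
      proof (cases "lam \<in> {b powr k..<b powr (k + 1)}")
        case True
        then have "0 < lam" using powr_gt_zero[of b k] b by (auto simp del: powr_gt_zero)
        then have "S lam \<le> S (b powr k)" using S True b by (auto simp: decr_def)
        then show ?thesis using True \<open>0 < lam\<close> by (simp add: mult.commute mult_left_mono mult_right_mono)
      qed simp
    qed
    also have "\<dots> = S (b powr k) * (\<integral>\<^sup>+lam. ennreal (q * lam powr (q - 1)) * indicator {b powr k..<b powr (k + 1)} lam \<partial>lborel)"
      by (rule nn_integral_cmult) simp
    also have "\<dots> = S (b powr k) * ennreal ((b powr (k + 1)) powr q - (b powr k) powr q)"
      using b q by (subst powr_cell) auto
    also have "\<dots> \<le> S (b powr k) * ennreal ((b powr (k + 1)) powr q)"
      by (intro mult_left_mono ennreal_leI) auto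
    also have "\<dots> = ennreal (b powr q) * (ennreal (b powr (q * real_of_int k)) * S (b powr real_of_int k))"
    proof -
      have "(b powr (k + 1)) powr q = b powr q * b powr (q * k)"
        using b by (simp add: powr_powr powr_add[symmetric] algebra_simps)
      then show ?thesis by (simp add: ennreal_mult ac_simps)
    qed
    finally show "(\<integral>\<^sup>+lam. ennreal (q * lam powr (q - 1)) * (S lam * indicator {0<..} lam) * indicator {lam. 0 < lam \<and> ?c lam = k} lam \<partial>lborel)
      \<le> ennreal (b powr q) * (ennreal (b powr (q * real_of_int k)) * S (b powr real_of_int k))"
      unfolding cell .
  qed
  also have "\<dots> = ennreal (b powr q) * dysum b q S"
    unfolding dysum_def by (simp add: nn_integral_cmult)
  finally show ?thesis .
qed

lemma nsum_geometric_weights: "nsum (UNIV :: 'i::countable set) (\<lambda>i. ennreal (e * (1/2) ^ Suc (to_nat i))) \<le> ennreal e"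
  if "0 \<le> e"
proof -
  have "nsum (UNIV :: 'i set) (\<lambda>i. ennreal (e * (1/2) ^ Suc (to_nat i))) = nsum (range (to_nat :: 'i \<Rightarrow> nat)) (\<lambda>n. ennreal (e * (1/2) ^ Suc n))"
    by (rule nn_integral_bij_count_space) (simp add: bij_betw_def)
  also have "\<dots> \<le> nsum UNIV (\<lambda>n. ennreal (e * (1/2) ^ Suc n))" by (rule nsum_mono_set) simp
  also have "\<dots> = ennreal e"
    unfolding nn_integral_count_space_nat
    using that sums_mult[OF power_half_series, of e] by (intro suminf_ennreal_eq) auto
  finally show ?thesis .
qed

section \<open>Near-optimal families and Hoelder's inequality for the outer construction\<close>

context outer
begin

lemma near_family:
  assumes \<Phi>: "good r \<Phi>" and r: "0 < r" and b: "1 < b" and e: "0 < e"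
  obtains G :: "int \<Rightarrow> 'g set" where "\<And>k. clears r \<Phi> x (b powr k) (G k)"
    "nsum UNIV (\<lambda>k. ennreal (b powr (q * real_of_int k)) * nsum (G k) w) \<le> dysum b q (super r \<Phi> x) + ennreal e"
proof -
  \<comment> \<open>The error at each level is divided by the weight of that level, so that the
    weighted errors form a series with sum at most \<open>e\<close>.\<close>
  define d where "d k = e * (1/2) ^ Suc (to_nat k) * b powr - (q * real_of_int k)" for k :: int
  have d: "d k > 0" for k using e b by (simp add: d_def)
  have "\<exists>G. clears r \<Phi> x (b powr k) G \<and> nsum G w \<le> super r \<Phi> x (b powr k) + ennreal (d k)" for k :: int
    using super_near[OF \<Phi> r d, of x "b powr k" k] by metis
  then obtain G :: "int \<Rightarrow> 'g set" where G: "\<And>k. clears r \<Phi> x (b powr k) (G k)"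
    "\<And>k. nsum (G k) w \<le> super r \<Phi> x (b powr k) + ennreal (d k)" by metis
  have "nsum UNIV (\<lambda>k. ennreal (b powr (q * real_of_int k)) * nsum (G k) w)
    \<le> nsum UNIV (\<lambda>k. ennreal (b powr (q * real_of_int k)) * super r \<Phi> x (b powr k) + ennreal (e * (1/2) ^ Suc (to_nat k)))"
  proof (intro nn_integral_mono)
    fix k :: int
    have "ennreal (b powr (q * real_of_int k)) * nsum (G k) w
      \<le> ennreal (b powr (q * real_of_int k)) * (super r \<Phi> x (b powr k) + ennreal (d k))"
      by (intro mult_left_mono G) auto
    also have "ennreal (b powr (q * real_of_int k)) * ennreal (d k) = ennreal (e * (1/2) ^ Suc (to_nat k))"
    proof -
      have "b powr (q * real_of_int k) * d k = e * (1/2) ^ Suc (to_nat k)"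
        using b by (simp add: d_def powr_minus)
      then show ?thesis using d[of k] by (simp add: ennreal_mult[symmetric] del: power_Suc)
    qed
    then have "ennreal (b powr (q * real_of_int k)) * (super r \<Phi> x (b powr k) + ennreal (d k))
      = ennreal (b powr (q * real_of_int k)) * super r \<Phi> x (b powr k) + ennreal (e * (1/2) ^ Suc (to_nat k))"
      by (simp only: distrib_left)
    finally show "ennreal (b powr (q * real_of_int k)) * nsum (G k) w \<le>
      ennreal (b powr (q * real_of_int k)) * super r \<Phi> x (b powr k) + ennreal (e * (1/2) ^ Suc (to_nat k))" .
  qed
  also have "\<dots> = dysum b q (super r \<Phi> x) + nsum (UNIV :: int set) (\<lambda>k. ennreal (e * (1/2) ^ Suc (to_nat k)))"
    unfolding dysum_def by (rule nn_integral_add) auto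
  also have "\<dots> \<le> dysum b q (super r \<Phi> x) + ennreal e"
    using e nsum_geometric_weights[of e, where 'i = int] by (intro add_left_mono) auto
  finally show ?thesis using that G by blast
qed

text \<open>Each tile is charged to the last dyadic level at which nearly optimal families for \<open>x\<close> and \<open>y\<close> cover it;
  the levels \<open>2 ^ k\<close> for \<open>x\<close> and \<open>2 ^ (k (q - 1))\<close> for \<open>y\<close> multiply to \<open>2 ^ (k q)\<close>.\<close>

theorem dual_bound_out:
  assumes \<Phi>: "good r \<Phi>" and r: "0 < r" and \<Psi>: "good s \<Psi>" and s: "0 < s"
    and K: "dual_bound \<Phi> \<Psi> K" and q: "1 < q"
  shows "\<exists>K'. dual_bound (out r \<Phi> q) (out s \<Psi> (conj_exp q)) K'"
proof -
  define b where "b = 2 powr (q - 1)"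
  have b: "1 < b" using q by (simp add: b_def)
  note q' = conj_exp_props[OF q]
  have bq: "b powr (conj_exp q * real_of_int k) = 2 powr (q * real_of_int k)" for k
    using q'(3) by (simp add: b_def powr_powr mult.assoc[symmetric])
  have K0: "0 < K" using K by (auto simp: dual_bound_def)
  define D where "D = max (1 / (1 - 2 powr - q)) (1 / (1 - b powr - conj_exp q))"
  have p1: "0 < 1 - 2 powr - q" "0 < 1 - b powr - conj_exp q"
    using q b q'(1) powr_less_one[of 2 "-q"] powr_less_one[of b "- conj_exp q"] by auto
  then have D: "0 < D" by (simp add: D_def less_max_iff_disj)
  have dy1: "dysum 2 q (super r \<Phi> x) \<le> ennreal D * out r \<Phi> q x" for x
    using q unfolding out_def
    by (intro order_trans[OF dysum_le] mult_right_mono ennreal_leI decr_super[OF \<Phi> r]) (auto simp: D_def)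
  have dy2: "dysum b (conj_exp q) (super s \<Psi> y) \<le> ennreal D * out s \<Psi> (conj_exp q) y" for y
    using q' b unfolding out_def
    by (intro order_trans[OF dysum_le] mult_right_mono ennreal_leI decr_super[OF \<Psi> s]) (auto simp: D_def)
  define K' where "K' = 2 * K * 2 powr q * D"
  have "pairing x y \<le> ennreal K' * (out r \<Phi> q x + out s \<Psi> (conj_exp q) y)" for x y
  proof (cases "out r \<Phi> q x + out s \<Psi> (conj_exp q) y = top")
    case True
    have "ennreal K' \<noteq> 0" using K0 D by (simp add: K'_def)
    then show ?thesis unfolding True by (simp add: ennreal_mult_top)
  next
    case fin: False
    have "pairing x y \<le> ennreal K' * (out r \<Phi> q x + out s \<Psi> (conj_exp q) y) + ennreal e'" if e': "0 < e'" for e'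
    proof -
      \<comment> \<open>Each of the two sequences of families brings an error \<open>e\<close>,
        later multiplied by \<open>2 * K * 2 powr q\<close>; together this makes
        \<open>e'\<close>.\<close>
      define e where "e = e' / (4 * K * 2 powr q)"
      have e: "0 < e" using e' K0 by (simp add: e_def)
      obtain G :: "int \<Rightarrow> 'g set" where G: "\<And>k. clears r \<Phi> x (2 powr k) (G k)"
        "nsum UNIV (\<lambda>k. ennreal (2 powr (q * real_of_int k)) * nsum (G k) w) \<le> dysum 2 q (super r \<Phi> x) + ennreal e"
        using near_family[OF \<Phi> r _ e, of 2 x q] by auto
      obtain H :: "int \<Rightarrow> 'g set" where H: "\<And>k. clears s \<Psi> y (b powr k) (H k)"
        "nsum UNIV (\<lambda>k. ennreal (b powr (conj_exp q * real_of_int k)) * nsum (H k) w) \<le> dysum b (conj_exp q) (super s \<Psi> y) + ennreal e"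
        using near_family[OF \<Psi> s b e, of y "conj_exp q"] by auto
      define E where "E k = \<Union>(m ` (G k \<union> H k))" for k
      define Q where "Q = nsum UNIV (\<lambda>k. ennreal (2 powr (q * real_of_int k)) * (nsum (G k) w + nsum (H k) w))"
      have Q: "Q \<le> ennreal D * (out r \<Phi> q x + out s \<Psi> (conj_exp q) y) + (ennreal e + ennreal e)"
      proof -
        have "Q = nsum UNIV (\<lambda>k. ennreal (2 powr (q * real_of_int k)) * nsum (G k) w)
            + nsum UNIV (\<lambda>k. ennreal (b powr (conj_exp q * real_of_int k)) * nsum (H k) w)"
          unfolding Q_def bq by (subst nn_integral_add[symmetric]) (auto simp: distrib_left)
        also have "\<dots> \<le> (ennreal D * out r \<Phi> q x + ennreal e) + (ennreal D * out s \<Psi> (conj_exp q) y + ennreal e)"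
          by (intro add_mono order_trans[OF G(2)] order_trans[OF H(2)] dy1 dy2 order_refl)
        also have "\<dots> = ennreal D * (out r \<Phi> q x + out s \<Psi> (conj_exp q) y) + (ennreal e + ennreal e)"
          by (simp add: distrib_left ac_simps)
        finally show ?thesis .
      qed
      have Qfin: "Q < top"
      proof -
        have "ennreal D * (out r \<Phi> q x + out s \<Psi> (conj_exp q) y) + (ennreal e + ennreal e) < top"
          using fin by (auto simp: ennreal_mult_less_top less_top[symmetric] ennreal_mult_eq_top_iff)
        then show ?thesis using Q by order
      qed
      have cell: "x P * y P \<le> nsum UNIV (\<lambda>k. x P * y P * indicator (E k - E (k + 1)) P)" for P
      proof (cases "x P * y P = 0")
        case True
        then show ?thesis by (simp only: zero_le)
      next
        case nz: False
        obtain w0 where w0: "0 < w0" "w0 < top" "\<And>g. P \<in> m g \<Longrightarrow> w0 \<le> w g" using min_weight[of P] by metis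
        \<comment> \<open>A tile covered at no level would obey the size bounds at arbitrarily small
          levels, which forces \<open>x P = 0\<close>.\<close>
        have ex1: "\<exists>k0. P \<in> E k0"
        proof (rule ccontr)
          assume n: "\<nexists>k0. P \<in> E k0"
          have "x P = 0"
          proof (rule clears_small_imp_zero[OF \<Phi> r])
            fix e :: real assume e: "0 < e"
            define k where "k = \<lfloor>log 2 e\<rfloor>"
            have "2 powr k \<le> e" using e by (simp add: k_def powr_le_iff)
            moreover have "P \<notin> \<Union>(m ` G k)" using n by (auto simp: E_def)
            ultimately show "\<exists>lam G. 0 < lam \<and> lam \<le> e \<and> clears r \<Phi> x lam G \<and> P \<notin> \<Union>(m ` G)"
              using G(1)[of k] by (intro exI[of _ "2 powr k"] exI[of _ "G k"]) auto
          qed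
          with nz show False by simp
        qed
        then obtain k0 where k0: "P \<in> E k0" by blast
        \<comment> \<open>Being covered at all levels from \<open>k0\<close> on would cost at least
          \<open>2 powr (q * k) * w0\<close> at level \<open>k\<close>, against the finite total
          \<open>Q\<close>.\<close>
        have "\<exists>k. P \<in> E k \<and> P \<notin> E (k + 1)"
        proof (rule ccontr)
          assume "\<not> ?thesis"
          then have step: "P \<in> E k \<Longrightarrow> P \<in> E (k + 1)" for k by auto
          have all: "P \<in> E k" if "k0 \<le> k" for k
            using that by (induction k rule: int_ge_induct) (auto intro: k0 step)
          have lower: "ennreal (2 powr (q * real_of_int k)) * w0 \<le> Q" if "k0 \<le> k" for k
          proof -
            obtain g where g: "g \<in> G k \<union> H k" "P \<in> m g" using all[OF \<open>k0 \<le> k\<close>] by (auto simp: E_def)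
            have "w0 \<le> w g" by (rule w0) fact
            also have "w g \<le> nsum (G k) w + nsum (H k) w"
              using g(1) nsum_ge[of g "G k" w] nsum_ge[of g "H k" w]
              by (auto intro: add_increasing add_increasing2)
            finally have "ennreal (2 powr (q * real_of_int k)) * w0 \<le> ennreal (2 powr (q * real_of_int k)) * (nsum (G k) w + nsum (H k) w)"
              by (intro mult_left_mono) auto
            also have "\<dots> \<le> Q" unfolding Q_def by (rule nsum_ge) simp
            finally show ?thesis .
          qed
          obtain c W where c: "Q = ennreal c" "0 \<le> c" and W: "w0 = ennreal W" "0 < W"
            using Qfin w0(1,2) by (cases Q rule: ennreal_cases; cases w0 rule: ennreal_cases) auto
          define k where "k = max (max 0 k0) \<lceil>(c + 1) / W\<rceil>"
          have "c + 1 \<le> W * real_of_int k"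
          proof -
            have "(c + 1) / W \<le> real_of_int \<lceil>(c + 1) / W\<rceil>" by linarith
            also have "\<dots> \<le> real_of_int k" by (simp add: k_def)
            finally show ?thesis using W by (simp add: field_simps)
          qed
          also have "real_of_int k \<le> 2 powr (q * real_of_int k)"
          proof -
            have "real_of_int k < 2 powr real_of_int k"
            proof -
              have "real (nat k) = real_of_int k" by (simp add: k_def)
              then show ?thesis
                using powr_realpow[of 2 "nat k"] of_nat_less_two_power[of "nat k", where 'a = real] by simp
            qed
            also have "\<dots> \<le> 2 powr (q * real_of_int k)" using q by (intro powr_mono) (auto simp: k_def mult_le_cancel_right1)
            finally show ?thesis by simp
          qed
          finally have "c + 1 \<le> W * 2 powr (q * real_of_int k)" using W by simp
          moreover have "2 powr (q * real_of_int k) * W \<le> c"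
            using lower[of k] c W by (simp add: k_def ennreal_mult[symmetric])
          ultimately show False by (simp add: mult.commute)
        qed
        then obtain k where "P \<in> E k - E (k + 1)" by auto
        then show ?thesis using nsum_ge[of k UNIV "\<lambda>k. x P * y P * indicator (E k - E (k + 1)) P"] by auto
      qed
      have "pairing x y \<le> nsum UNIV (\<lambda>P. nsum UNIV (\<lambda>k::int. x P * y P * indicator (E k - E (k + 1)) P))"
        unfolding pairing_def by (intro nn_integral_mono cell)
      also have "\<dots> = nsum UNIV (\<lambda>k::int. nsum UNIV (\<lambda>P. x P * y P * indicator (E k - E (k + 1)) P))"
        by (rule nn_integral_count_space_nn_integral) auto
      also have "\<dots> \<le> nsum UNIV (\<lambda>k::int. ennreal (2 * K * 2 powr q) * (ennreal (2 powr (q * real_of_int k)) * (nsum (G k) w + nsum (H k) w)))"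
      proof (rule nn_integral_mono)
        fix k :: int
        \<comment> \<open>Off \<open>E (k + 1)\<close> the sizes obey the bounds of index
          \<open>k + 1\<close>, which multiply to \<open>2 powr (q * (k + 1))\<close>. The shift of
          the index costs \<open>2 powr q\<close>, and the factor 2 comes from
          \<open>w g + w g\<close>.\<close>
        define c where "c = 2 * K * (2 powr (k + 1)) * (b powr (k + 1))"
        have c: "c = 2 * K * 2 powr q * 2 powr (q * real_of_int k)"
          by (simp add: c_def b_def powr_powr powr_add[symmetric] algebra_simps)
        have one: "nsum (m g - E (k + 1)) (\<lambda>P. x P * y P) \<le> ennreal c * w g" for g
        proof -
          have "nsum (m g - E (k + 1)) (\<lambda>P. x P * y P) = pairing (cut x (m g - E (k + 1))) (cut y (m g - E (k + 1)))"
            unfolding pairing_def nsum_ind[of "m g - _"] by (intro nn_integral_cong) (auto simp: cut_def split: split_indicator)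
          also have "\<dots> \<le> ennreal (K * (2 powr (k + 1)) * (b powr (k + 1))) * (w g + w g)"
          proof (rule dual_bound_scaled[OF K \<Phi> \<Psi>])
            have "\<Phi> (cut x (m g - E (k + 1))) \<le> \<Phi> (cut x (m g - \<Union>(m ` G (k + 1))))"
              by (intro good_cut_mono[OF \<Phi>]) (auto simp: E_def)
            also have "\<dots> \<le> ennreal ((2 powr (k + 1)) powr r) * w g"
              using G(1)[of "k + 1"] by (auto simp: clears_def)
            finally show "\<Phi> (cut x (m g - E (k + 1))) \<le> ennreal ((2 powr (k + 1)) powr r) * w g" .
            have "\<Psi> (cut y (m g - E (k + 1))) \<le> \<Psi> (cut y (m g - \<Union>(m ` H (k + 1))))"
              by (intro good_cut_mono[OF \<Psi>]) (auto simp: E_def)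
            also have "\<dots> \<le> ennreal ((b powr (k + 1)) powr s) * w g"
              using H(1)[of "k + 1"] by (auto simp: clears_def)
            finally show "\<Psi> (cut y (m g - E (k + 1))) \<le> ennreal ((b powr (k + 1)) powr s) * w g" .
          qed (use b in auto)
          also have "\<dots> = ennreal (K * (2 powr (k + 1)) * (b powr (k + 1))) * 2 * w g"
            by (simp add: mult_2 distrib_left mult.assoc)
          also have "ennreal (K * (2 powr (k + 1)) * (b powr (k + 1))) * 2 = ennreal c"
            using K0 b by (simp add: c_def ennreal_mult ac_simps)
          finally show ?thesis .
        qed
        have "nsum UNIV (\<lambda>P. x P * y P * indicator (E k - E (k + 1)) P) = nsum (E k - E (k + 1)) (\<lambda>P. x P * y P)"
          by (simp add: nsum_ind[symmetric])
        also have "\<dots> = nsum (\<Union>g\<in>G k \<union> H k. m g - E (k + 1)) (\<lambda>P. x P * y P)"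
          by (intro arg_cong2[where f = nn_integral] arg_cong[where f = count_space] refl) (auto simp: E_def)
        also have "\<dots> \<le> nsum (G k \<union> H k) (\<lambda>g. nsum (m g - E (k + 1)) (\<lambda>P. x P * y P))"
          by (rule nsum_UN_le) simp
        also have "\<dots> \<le> nsum (G k \<union> H k) (\<lambda>g. ennreal c * w g)" by (intro nn_integral_mono one)
        also have "\<dots> = ennreal c * nsum (G k \<union> H k) w" by (simp add: nn_integral_cmult)
        also have "\<dots> \<le> ennreal c * (nsum (G k) w + nsum (H k) w)" by (intro mult_left_mono nsum_Un_le) simp
        also have "\<dots> = ennreal (2 * K * 2 powr q) * (ennreal (2 powr (q * real_of_int k)) * (nsum (G k) w + nsum (H k) w))"
          using K0 unfolding c by (simp add: ennreal_mult mult.assoc)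
        finally show "nsum UNIV (\<lambda>P. x P * y P * indicator (E k - E (k + 1)) P) \<le>
          ennreal (2 * K * 2 powr q) * (ennreal (2 powr (q * real_of_int k)) * (nsum (G k) w + nsum (H k) w))" .
      qed
      also have "\<dots> = ennreal (2 * K * 2 powr q) * Q"
        unfolding Q_def by (simp add: nn_integral_cmult)
      also have "\<dots> \<le> ennreal (2 * K * 2 powr q) * (ennreal D * (out r \<Phi> q x + out s \<Psi> (conj_exp q) y) + (ennreal e + ennreal e))"
        by (intro mult_left_mono Q) simp
      also have "\<dots> = ennreal K' * (out r \<Phi> q x + out s \<Psi> (conj_exp q) y) + ennreal e'"
      proof -
        have "ennreal (2 * K * 2 powr q) * ennreal D = ennreal K'"
          using K0 D by (simp add: K'_def ennreal_mult)
        moreover have "ennreal (2 * K * 2 powr q) * ((ennreal e + ennreal e)) = ennreal e'"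
        proof -
          have "(ennreal e + ennreal e) = ennreal (2 * e)" using e by (simp flip: ennreal_plus)
          then show ?thesis using K0 e by (simp add: ennreal_mult[symmetric] e_def)
        qed
        ultimately show ?thesis by (simp only: distrib_left mult.assoc[symmetric])
      qed
      finally show ?thesis .
    qed
    then show ?thesis by (rule ennreal_le_epsilon)
  qed
  then show ?thesis
    unfolding dual_bound_def using K0 D by (intro exI[of _ K']) (auto simp: K'_def)
qed

end


section \<open>Extremal partners from a one-level selection\<close>

lemma suminf_one_nonzero:
  fixes f :: "nat \<Rightarrow> ennreal"
  assumes "\<And>i. i \<noteq> n \<Longrightarrow> f i = 0"
  shows "(\<Sum>i. f i) = f n"
  using suminf_finite[of "{n}" f] assms by auto

context outer
begin

text \<open>One halving of the level, normalised to lead from 2 to 1. Keeping the support of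
  \<open>y\<close> inside that of \<open>x\<close> makes partners of finitely supported sequences
  finitely supported.\<close>

definition selects :: "real \<Rightarrow> (('p \<Rightarrow> ennreal) \<Rightarrow> ennreal) \<Rightarrow> (('p \<Rightarrow> ennreal) \<Rightarrow> ennreal) \<Rightarrow> real \<Rightarrow> real \<Rightarrow> bool" where
  "selects r \<Phi> \<Psi> c C \<longleftrightarrow> (\<forall>x. fsup x \<longrightarrow> (\<forall>g. \<Phi> (cut x (m g)) \<le> ennreal (2 powr r) * w g) \<longrightarrow>
     (\<exists>G y. (\<forall>P. y P \<noteq> 0 \<longrightarrow> x P \<noteq> 0 \<and> P \<in> \<Union>(m ` G)) \<and> (\<forall>P. y P < top) \<and>
       clears r \<Phi> x 1 G \<and> (\<forall>g. \<Psi> (cut y (m g)) \<le> ennreal C * w g) \<and>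
       ennreal c * nsum G w \<le> pairing x y))"

text \<open>The selection is applied to what the previous levels left over, with the level halved at each step.\<close>

lemma dual_stack:
  assumes sel: "selects r \<Phi> \<Psi> c C" and \<Phi>: "good r \<Phi>" and r: "0 < r" and x: "fsup x"
  obtains L :: real and G :: "nat \<Rightarrow> 'g set" and y :: "nat \<Rightarrow> 'p \<Rightarrow> ennreal"
  where "0 < L"
    "\<And>n P. y n P \<noteq> 0 \<Longrightarrow> x P \<noteq> 0 \<and> P \<in> \<Union>(m ` G n) \<and> (\<forall>i<n. P \<notin> \<Union>(m ` G i))"
    "\<And>n P. y n P < top"
    "\<And>n. clears r \<Phi> x (L * (1/2) ^ n) (\<Union>i<n. G i)"
    "\<And>n g. \<Psi> (cut (y n) (m g)) \<le> ennreal C * w g"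
    "\<And>n. ennreal (c * (L * (1/2) ^ Suc n)) * nsum (G n) w \<le> pairing x (y n)"
proof -
  obtain L where L: "0 < L" "\<And>g. \<Phi> (cut x (m g)) \<le> ennreal (L powr r) * w g"
    using fsup_bound[OF \<Phi> r x] by blast
  \<comment> \<open>The level reached by step \<open>n\<close>. Before that step the sizes are at
    most \<open>2 * l n\<close>, so the remainder divided by \<open>l n\<close> meets the
    normalisation of \<open>selects\<close>.\<close>
  define l where "l n = L * (1/2) ^ Suc n" for n
  have l: "0 < l n" for n using L by (simp add: l_def)
  define sp where "sp z G y \<longleftrightarrow> (\<forall>P. y P \<noteq> 0 \<longrightarrow> z P \<noteq> 0 \<and> P \<in> \<Union>(m ` G)) \<and> (\<forall>P. y P < top) \<and>
       clears r \<Phi> z 1 G \<and> (\<forall>g. \<Psi> (cut y (m g)) \<le> ennreal C * w g) \<and>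
       ennreal c * nsum G w \<le> pairing z y" for z G y
  define pick where "pick z = (SOME Gy. sp z (fst Gy) (snd Gy))" for z
  define z where "z n R = (\<lambda>P. ennreal (1 / l n) * cut x (- R) P)" for n R
  \<comment> \<open>The tiles covered in the first \<open>n\<close> steps. The choice operator in
    \<open>pick\<close> makes the next selection a function of the remainder, so that plain
    recursion works.\<close>
  define R where "R = rec_nat {} (\<lambda>n R. R \<union> \<Union>(m ` fst (pick (z n R))))"
  define G where "G n = fst (pick (z n (R n)))" for n
  define y where "y n = snd (pick (z n (R n)))" for n
  have R0: "R 0 = {}" and RS: "R (Suc n) = R n \<union> \<Union>(m ` G n)" for n
    by (auto simp: R_def G_def)
  have R: "R n = \<Union>(m ` (\<Union>i<n. G i))" for n
    by (induction n) (auto simp: R0 RS lessThan_Suc)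
  \<comment> \<open>Size bounds and selections share one induction, because the selection of a step
    exists only by the size bound for what is left.\<close>
  have main: "(\<forall>g. \<Phi> (cut x (m g - R n)) \<le> ennreal ((L * (1/2) ^ n) powr r) * w g) \<and> (n > 0 \<longrightarrow> sp (z (n-1) (R (n-1))) (G (n-1)) (y (n-1)))" for n
  proof (induction n)
    case 0
    then show ?case using L by (simp add: R0)
  next
    case (Suc n)
    have eq: "\<Phi> (\<lambda>P. ennreal (1 / l n) * u P) = ennreal ((1 / l n) powr r) * \<Phi> u" for u
      using good_scale[OF \<Phi>, of "1 / l n" u] l[of n] by simp
    have cutz: "cut (z n (R n)) A = (\<lambda>P. ennreal (1 / l n) * cut x (A - R n) P)" for A
    proof -
      have "- R n \<inter> A = A - R n" by auto
      then show ?thesis by (simp add: z_def cut_scale)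
    qed
    have "fsup (z n (R n))" unfolding z_def by (intro fsup_scale fsup_cut x)
    moreover have "\<Phi> (cut (z n (R n)) (m g)) \<le> ennreal (2 powr r) * w g" for g
    proof -
      have "\<Phi> (cut (z n (R n)) (m g)) = ennreal ((1 / l n) powr r) * \<Phi> (cut x (m g - R n))"
        by (simp add: cutz eq)
      also have "\<dots> \<le> ennreal ((1 / l n) powr r) * (ennreal ((L * (1/2) ^ n) powr r) * w g)"
        using Suc.IH by (intro mult_left_mono) auto
      also have "\<dots> = ennreal (2 powr r) * w g"
      proof -
        have "(1 / l n) powr r * (L * (1/2) ^ n) powr r = (1 / l n * (L * (1/2) ^ n)) powr r"
          using l[of n] L by (subst powr_mult) auto
        also have "1 / l n * (L * (1/2) ^ n) = 2" using L by (simp add: l_def field_simps)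
        finally show ?thesis by (simp add: mult.assoc[symmetric] ennreal_mult[symmetric])
      qed
      finally show ?thesis .
    qed
    ultimately have "\<exists>G y. sp (z n (R n)) G y"
      using sel unfolding selects_def sp_def by blast
    then have "\<exists>Gy. sp (z n (R n)) (fst Gy) (snd Gy)" by auto
    then have sp: "sp (z n (R n)) (G n) (y n)"
      unfolding G_def y_def pick_def by (rule someI_ex)
    have "\<Phi> (cut x (m g - R (Suc n))) \<le> ennreal ((L * (1/2) ^ Suc n) powr r) * w g" for g
    proof -
      have "m g - R (Suc n) = (m g - \<Union>(m ` G n)) - R n" by (auto simp: RS)
      then have "ennreal ((1 / l n) powr r) * \<Phi> (cut x (m g - R (Suc n))) = \<Phi> (cut (z n (R n)) (m g - \<Union>(m ` G n)))"
        by (simp add: cutz eq)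
      also have "\<dots> \<le> w g" using sp by (simp add: sp_def clears_def)
      finally have "ennreal (l n powr r) * (ennreal ((1 / l n) powr r) * \<Phi> (cut x (m g - R (Suc n)))) \<le> ennreal (l n powr r) * w g"
        by (intro mult_left_mono) auto
      moreover have "ennreal (l n powr r) * ennreal ((1 / l n) powr r) = 1"
        using l[of n] by (simp add: ennreal_mult[symmetric] powr_mult[symmetric])
      ultimately show ?thesis by (simp add: mult.assoc[symmetric] l_def)
    qed
    then show ?case using sp by simp
  qed
  then have sp: "sp (z n (R n)) (G n) (y n)" for n using main[of "Suc n"] by simp
  show ?thesis
  proof (rule that[of L y G])
    show "0 < L" by fact
    fix n
    show "y n P < top" for P using sp[of n] by (simp add: sp_def)
    show "\<Psi> (cut (y n) (m g)) \<le> ennreal C * w g" for g using sp[of n] by (simp add: sp_def)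
    show "clears r \<Phi> x (L * (1/2) ^ n) (\<Union>i<n. G i)"
      using main[of n] by (simp add: clears_def R)
    have supp: "y n P \<noteq> 0 \<Longrightarrow> x P \<noteq> 0 \<and> P \<in> \<Union>(m ` G n) \<and> P \<notin> R n" for P
      using sp[of n] by (auto simp: sp_def z_def cut_def indicator_def split: if_splits)
    then show "y n P \<noteq> 0 \<Longrightarrow> x P \<noteq> 0 \<and> P \<in> \<Union>(m ` G n) \<and> (\<forall>i<n. P \<notin> \<Union>(m ` G i))" for P
      unfolding R by blast
    have "ennreal c * nsum (G n) w \<le> pairing (z n (R n)) (y n)" using sp[of n] by (simp add: sp_def)
    also have "\<dots> = ennreal (1 / l n) * pairing (cut x (- R n)) (y n)"
      using pairing_scale[of "1 / l n" "cut x (- R n)" 1 "y n"] by (simp add: z_def)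
    also have "pairing (cut x (- R n)) (y n) = pairing x (y n)"
      unfolding pairing_def using supp by (intro nn_integral_cong) (auto simp: cut_def indicator_def)
    finally have "ennreal (l n) * (ennreal c * nsum (G n) w) \<le> ennreal (l n) * (ennreal (1 / l n) * pairing x (y n))"
      by (intro mult_left_mono) auto
    also have "\<dots> = pairing x (y n)"
      using l[of n] by (simp add: mult.assoc[symmetric] ennreal_mult[symmetric])
    also have "ennreal (l n) * (ennreal c * nsum (G n) w) = ennreal (c * (L * (1/2) ^ Suc n)) * nsum (G n) w"
      unfolding l_def[symmetric] mult.assoc[symmetric] using l[of n] by (simp add: ennreal_mult'' mult.commute)
    finally show "ennreal (c * (L * (1/2) ^ Suc n)) * nsum (G n) w \<le> pairing x (y n)" .
  qed
qed

lemma nsum_UN_lessThan_le: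
  assumes "\<And>n. n < k \<Longrightarrow> lam < t n"
  shows "nsum (\<Union>n<k. H n) w \<le> (\<Sum>n. nsum (H n) w * indicator {..<t n} lam)"
proof -
  have "nsum (\<Union>n<k. H n) w \<le> nsum {..<k} (\<lambda>n. nsum (H n) w)" by (rule nsum_UN_le) simp
  also have "\<dots> \<le> nsum UNIV (\<lambda>n. nsum (H n) w * indicator {..<t n} lam)"
    unfolding nsum_ind[of "{..<k}"] using assms
    by (intro nn_integral_mono) (auto split: split_indicator)
  finally show ?thesis by (simp add: nn_integral_count_space_nat)
qed

lemma ex_first_below:
  fixes t :: "nat \<Rightarrow> real"
  assumes "t \<longlonglongrightarrow> 0" "0 < lam"
  obtains n where "t n \<le> lam" "\<And>i. i < n \<Longrightarrow> lam < t i"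
proof -
  have "\<forall>\<^sub>F n in sequentially. t n < lam" using assms by (rule order_tendstoD)
  then obtain n where "t n \<le> lam" using eventually_happens'[OF sequentially_bot] less_imp_le by blast
  then have "t (LEAST n. t n \<le> lam) \<le> lam" by (rule LeastI)
  moreover have "lam < t i" if "i < (LEAST n. t n \<le> lam)" for i
    using not_less_Least[OF that] by simp
  ultimately show ?thesis using that by blast
qed

text \<open>If \<open>n\<close> is the first index with \<open>t n \<le> lam\<close>, the first
  \<open>n\<close> families suffice at level \<open>lam\<close>, and all of them have
  \<open>lam < t i\<close>. Hence \<open>super\<close> lies below the sum of the step functions of
  height \<open>v i\<close> on \<open>lam < t i\<close>, which are integrated one by one.\<close>

lemma out_le_stack:
  assumes \<Phi>: "good r \<Phi>" and r: "0 < r" and q: "0 < q"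
    and t: "t \<longlonglongrightarrow> 0" "\<And>n. 0 \<le> t n"
    and cl: "\<And>n lam. 0 < lam \<Longrightarrow> t n \<le> lam \<Longrightarrow> (\<And>i. i < n \<Longrightarrow> lam < t i) \<Longrightarrow>
       \<exists>G. clears r \<Phi> x lam G \<and> nsum G w \<le> nsum (\<Union>i<n. H i) w"
    and v: "\<And>n. nsum (H n) w \<le> v n"
  shows "out r \<Phi> q x \<le> (\<Sum>n. v n * ennreal (t n powr q))"
proof -
  have dec: "decr (\<lambda>lam. v n * indicator {..<t n} lam)" for n
    by (auto simp: decr_def split: split_indicator)
  have "super r \<Phi> x lam \<le> (\<Sum>n. v n * indicator {..<t n} lam)" if lam: "0 < lam" for lam
  proof -
    obtain n where n: "t n \<le> lam" "\<And>i. i < n \<Longrightarrow> lam < t i" using ex_first_below[OF t(1) lam] by blast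
    obtain G where G: "clears r \<Phi> x lam G" "nsum G w \<le> nsum (\<Union>i<n. H i) w" using cl[OF lam n] by blast
    have "super r \<Phi> x lam \<le> nsum G w" by (rule super_le) fact
    also note G(2)
    also have "nsum (\<Union>i<n. H i) w \<le> (\<Sum>n. nsum (H n) w * indicator {..<t n} lam)"
      by (rule nsum_UN_lessThan_le) (rule n)
    also have "\<dots> \<le> (\<Sum>n. v n * indicator {..<t n} lam)"
      by (intro suminf_le mult_right_mono v) auto
    finally show ?thesis .
  qed
  then have "out r \<Phi> q x \<le> wint q (\<lambda>lam. \<Sum>n. v n * indicator {..<t n} lam)"
    unfolding out_def by (rule wint_mono)
  also have "\<dots> = (\<Sum>n. v n * ennreal (t n powr q))"
    by (subst wint_suminf[OF dec]) (simp add: wint_step q t(2))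
  finally show ?thesis .
qed

text \<open>\<open>a n\<close> stands for the \<open>q\<close>-th power of the \<open>n\<close>-th
  level, and the weighted total of the families is the common size of all quantities. The last
  clause is the local dual bound: with \<open>\<kappa> g = {g}\<close> it becomes the global one,
  with \<open>trim\<close> it bounds \<open>y\<close> on a single strip.\<close>

definition partner :: "real \<Rightarrow> real \<Rightarrow> (('p \<Rightarrow> ennreal) \<Rightarrow> ennreal) \<Rightarrow> (('p \<Rightarrow> ennreal) \<Rightarrow> ennreal) \<Rightarrow> ('p \<Rightarrow> ennreal) \<Rightarrow>
    (nat \<Rightarrow> real) \<Rightarrow> (nat \<Rightarrow> 'g set) \<Rightarrow> ('p \<Rightarrow> ennreal) \<Rightarrow> bool" where
  "partner D c \<Phi> \<Psi> x a G y \<longleftrightarrow>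
     (\<forall>P. y P \<noteq> 0 \<longrightarrow> x P \<noteq> 0) \<and> (\<forall>P. y P < top) \<and>
     (\<Sum>n. ennreal (a n) * nsum (G n) w) < top \<and>
     \<Phi> x \<le> ennreal D * (\<Sum>n. ennreal (a n) * nsum (G n) w) \<and>
     ennreal c * (\<Sum>n. ennreal (a n) * nsum (G n) w) \<le> pairing x y \<and>
     (\<forall>Z \<kappa>. (\<forall>n. \<forall>g\<in>G n. m g \<inter> Z \<subseteq> \<Union>(m ` \<kappa> g)) \<longrightarrow>
        \<Psi> (cut y Z) \<le> ennreal D * (\<Sum>n. ennreal (a n) * nsum (G n) (\<lambda>g. nsum (\<kappa> g) w)))"

lemma partnerD:
  assumes "partner D c \<Phi> \<Psi> x a G y"
  shows "y P \<noteq> 0 \<Longrightarrow> x P \<noteq> 0" "y P < top" "(\<Sum>n. ennreal (a n) * nsum (G n) w) < top"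
    "\<Phi> x \<le> ennreal D * (\<Sum>n. ennreal (a n) * nsum (G n) w)"
    "ennreal c * (\<Sum>n. ennreal (a n) * nsum (G n) w) \<le> pairing x y"
    "(\<And>n g. g \<in> G n \<Longrightarrow> m g \<inter> Z \<subseteq> \<Union>(m ` \<kappa> g)) \<Longrightarrow>
        \<Psi> (cut y Z) \<le> ennreal D * (\<Sum>n. ennreal (a n) * nsum (G n) (\<lambda>g. nsum (\<kappa> g) w))"
  using assms unfolding partner_def by simp_all

lemma partner_UNIV:
  assumes "partner D c \<Phi> \<Psi> x a G y"
  shows "\<Psi> y \<le> ennreal D * (\<Sum>n. ennreal (a n) * nsum (G n) w)"
  using partnerD(6)[OF assms, of UNIV "\<lambda>g. {g}"] by (simp add: nn_integral_count_space_finite)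

text \<open>The layers of \<open>dual_stack\<close> have disjoint supports and are weighted by
  \<open>l n powr (q - 1)\<close>. Multiplied by the level this gives
  \<open>a n = l n powr q\<close> in the pairing; raised to the power \<open>conj_exp q\<close> it
  gives \<open>a n\<close> in the dual functional as well.\<close>

theorem dual_partner:
  assumes sel: "selects r \<Phi> \<Psi> c C" and c: "0 < c" and C: "0 < C"
    and \<Phi>: "good r \<Phi>" and r: "0 < r" and \<Psi>: "good s \<Psi>" and s: "0 < s" and q: "1 < q"
  shows "\<exists>D>0. \<forall>x. fsup x \<longrightarrow> (\<exists>a G y. partner D c (out r \<Phi> q) (out s \<Psi> (conj_exp q)) x a G y)"
proof -
  note q' = conj_exp_props[OF q]
  \<comment> \<open>To the power \<open>s\<close>, the weights of the layers decay like
    \<open>2 powr (- (q - 1) * s * i)\<close>. Half of this rate pays for the loss in the bound for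
    suprema, the other half is the ratio \<open>\<rho>\<close>.\<close>
  define e where "e = (q - 1) * s / 2"
  have e: "0 < e" using q s by (simp add: e_def)
  obtain E where E: "E > 0" "\<And>x. \<Psi> (\<lambda>P. SUP i. x i P) \<le> ennreal E * (\<Sum>i::nat. ennreal (2 powr (e * real i)) * \<Psi> (x i))"
    using good_SUP[OF \<Psi> e] by blast
  define \<rho> where "\<rho> = 2 powr - e"
  have \<rho>: "0 < \<rho>" "\<rho> < 1" using e powr_less_one[of 2 "-e"] by (auto simp: \<rho>_def)
  \<comment> \<open>With this \<open>d\<close> the layers from \<open>n\<close> on have dual size at
    most \<open>d * l n powr (q - 1)\<close> on every generator.\<close>
  define d where "d = (E * C / (1 - \<rho>)) powr (1 / s)"
  have d: "0 < d" "d powr s = E * C / (1 - \<rho>)" using E C \<rho> s by (auto simp: d_def powr_powr)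
  \<comment> \<open>\<open>2 powr q\<close> because \<open>x\<close> is cleared at level
    \<open>2 * l n\<close> before layer \<open>n\<close>; \<open>d powr conj_exp q\<close> because
    \<open>t n powr conj_exp q\<close> is this multiple of \<open>a n\<close>.\<close>
  define D where "D = max (2 powr q) (d powr conj_exp q)"
  have D0: "0 < D" by (simp add: D_def less_max_iff_disj)
  show ?thesis
  proof (intro exI[of _ D] conjI allI impI D0)
    fix x :: "'p \<Rightarrow> ennreal" assume x: "fsup x"
    obtain L G y where L: "0 < L"
      and y_supp: "\<And>n P. y n P \<noteq> 0 \<Longrightarrow> x P \<noteq> 0 \<and> P \<in> \<Union>(m ` G n) \<and> (\<forall>i<n. P \<notin> \<Union>(m ` G i))"
      and y_fin: "\<And>n P. y n P < top"
      and cl: "\<And>n. clears r \<Phi> x (L * (1/2) ^ n) (\<Union>i<n. G i)"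
      and y_bd: "\<And>n g. \<Psi> (cut (y n) (m g)) \<le> ennreal C * w g"
      and y_pair: "\<And>n. ennreal (c * (L * (1/2) ^ Suc n)) * nsum (G n) w \<le> pairing x (y n)"
      using dual_stack[OF sel \<Phi> r x] by metis
    define l where "l n = L * (1/2) ^ Suc n" for n
    have l: "0 < l n" for n using L by (simp add: l_def)
    define Y where "Y n P = ennreal (l n powr (q - 1)) * y n P" for n P
    define a where "a n = l n powr q" for n
    have a0: "0 < a n" for n using l[of n] by (simp add: a_def)
    define yy where "yy P = (\<Sum>n. Y n P)" for P
    have unique: "i = j" if "Y i P \<noteq> 0" "Y j P \<noteq> 0" for i j P
      using y_supp[of i P] y_supp[of j P] that unfolding Y_def by (metis linorder_neqE_nat mult_zero_right)
    have yyn: "yy P = Y n P" if "Y n P \<noteq> 0" for n P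
      unfolding yy_def using unique[OF _ that] by (intro suminf_one_nonzero) auto
    have yy0: "yy P = 0" if "\<And>n. Y n P = 0" for P
      unfolding yy_def using that by simp
    have yy_cases: "yy P = 0 \<or> (\<exists>n. yy P = Y n P \<and> y n P \<noteq> 0)" for P
      using yyn[of _ P] yy0[of P] unfolding Y_def by (metis mult_zero_right)
    have yy_supp: "yy P \<noteq> 0 \<Longrightarrow> x P \<noteq> 0" for P
      using yy_cases[of P] y_supp by metis
    have yy_fin: "yy P < top" for P
      using yy_cases[of P] y_fin by (auto simp: Y_def ennreal_mult_less_top)
    let ?Q = "\<Sum>n. ennreal (a n) * nsum (G n) w"
    have a_eq: "a n = l n powr (q - 1) * l n" for n
      using l[of n] powr_add[of "l n" "q - 1" 1] by (simp add: a_def)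
    have pair: "ennreal c * ?Q \<le> pairing x yy"
    proof -
      have "ennreal c * ?Q = (\<Sum>n. ennreal c * (ennreal (a n) * nsum (G n) w))" by simp
      also have "\<dots> \<le> (\<Sum>n. ennreal (l n powr (q - 1)) * pairing x (y n))"
      proof (rule suminf_le)
        fix n
        have "ennreal c * (ennreal (a n) * nsum (G n) w) = ennreal (l n powr (q - 1)) * (ennreal (c * l n) * nsum (G n) w)"
          using l[of n] c unfolding a_eq by (simp add: ennreal_mult ac_simps)
        also have "\<dots> \<le> ennreal (l n powr (q - 1)) * pairing x (y n)"
          using y_pair[of n] unfolding l_def by (intro mult_left_mono) auto
        finally show "ennreal c * (ennreal (a n) * nsum (G n) w) \<le> ennreal (l n powr (q - 1)) * pairing x (y n)" .
      qed auto
      also have "\<dots> = (\<Sum>n. nsum UNIV (\<lambda>P. x P * Y n P))"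
        unfolding pairing_def Y_def by (subst nn_integral_cmult[symmetric]) (auto simp: ac_simps)
      also have "\<dots> = nsum UNIV (\<lambda>P. \<Sum>n. x P * Y n P)" by (rule nn_integral_suminf[symmetric]) simp
      also have "\<dots> = pairing x yy" unfolding pairing_def yy_def by simp
      finally show ?thesis .
    qed
    \<comment> \<open>Finite support makes the pairing finite, and the lower bound passes this on to
      the weighted total, so that multiples of it may later be cancelled.\<close>
    have "pairing x yy < top"
    proof -
      have "pairing x yy = (\<Sum>P\<in>{P. x P \<noteq> 0}. x P * yy P)"
        unfolding pairing_def using x by (intro nn_integral_count_space') (auto simp: fsup_def)
      also have "\<dots> < top" using x yy_fin by (simp add: fsup_def less_top[symmetric] ennreal_mult_eq_top_iff)
      finally show ?thesis .
    qed
    with pair have "ennreal c * ?Q < top" by (rule order_le_less_trans)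
    then have Q_fin: "?Q < top"
      using c by (auto simp: ennreal_mult_eq_top_iff less_top[symmetric] simp del: ennreal_suminf_cmult)
    have t0: "(\<lambda>n. K * (l n) powr u) \<longlonglongrightarrow> 0" if "0 < u" for K u
    proof -
      have "(\<lambda>n. K * (L powr u * (1/2) powr u * ((1/2) powr u) ^ n)) \<longlonglongrightarrow> K * (L powr u * (1/2) powr u * 0)"
        using that powr01_less_one[of "1/2" u] by (intro tendsto_intros LIMSEQ_power_zero) auto
      moreover have "l n powr u = L powr u * (1/2) powr u * ((1/2) powr u) ^ n" for n
      proof -
        have "l n powr u = L powr u * ((1/2) ^ Suc n) powr u" using L by (simp add: l_def powr_mult del: power_Suc)
        also have "((1/2::real) ^ Suc n) powr u = ((1/2) powr u) ^ Suc n"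
          by (simp add: powr_realpow[symmetric] powr_powr mult.commute del: power_Suc of_nat_Suc)
        finally show ?thesis by simp
      qed
      ultimately show ?thesis by simp
    qed
    have N: "out r \<Phi> q x \<le> ennreal D * ?Q"
    proof -
      have "out r \<Phi> q x \<le> (\<Sum>n. nsum (G n) w * ennreal ((2 * l n) powr q))"
      proof (rule out_le_stack[OF \<Phi> r])
        show "(\<lambda>n. 2 * l n) \<longlonglongrightarrow> 0" using t0[of 1 2] l by (simp add: less_imp_le)
        fix n lam assume "2 * l n \<le> lam"
        then have "clears r \<Phi> x lam (\<Union>i<n. G i)"
          using L by (intro clears_mono[OF \<Phi> r cl[of n]]) (auto simp: l_def)
        then show "\<exists>G'. clears r \<Phi> x lam G' \<and> nsum G' w \<le> nsum (\<Union>i<n. G i) w" by blast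
      qed (use q l in \<open>auto simp: less_imp_le\<close>)
      also have "\<dots> = ennreal (2 powr q) * ?Q"
        unfolding ennreal_suminf_cmult[symmetric] using l
        by (intro suminf_cong) (simp add: powr_mult a_def ennreal_mult ac_simps less_imp_le)
      also have "\<dots> \<le> ennreal D * ?Q" by (intro mult_right_mono ennreal_leI) (auto simp: D_def)
      finally show ?thesis .
    qed
    have N': "out s \<Psi> (conj_exp q) (cut yy Z) \<le> ennreal D * (\<Sum>n. ennreal (a n) * nsum (G n) (\<lambda>g. nsum (\<kappa> g) w))"
      if \<kappa>: "\<forall>n. \<forall>g\<in>G n. m g \<inter> Z \<subseteq> \<Union>(m ` \<kappa> g)" for Z \<kappa>
    proof -
      define t where "t n = d * l n powr (q - 1)" for n
      have "out s \<Psi> (conj_exp q) (cut yy Z) \<le> (\<Sum>n. nsum (G n) (\<lambda>g. nsum (\<kappa> g) w) * ennreal (t n powr conj_exp q))"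
      proof (rule out_le_stack[OF \<Psi> s q'(1)])
        show "t \<longlonglongrightarrow> 0" unfolding t_def using t0[of "q - 1" d] q by simp
        show "0 \<le> t n" for n using d by (simp add: t_def)
        show "nsum (\<Union>g\<in>G n. \<kappa> g) w \<le> nsum (G n) (\<lambda>g. nsum (\<kappa> g) w)" for n
          by (rule nsum_UN_le) simp
        fix n lam assume lam: "0 < lam" "t n \<le> lam"
        \<comment> \<open>These generators cover, inside \<open>Z\<close>, everything selected in
          the first \<open>n\<close> steps; of \<open>yy\<close> only the layers
          \<open>n + i\<close> survive.\<close>
        define H where "H = (\<Union>i<n. \<Union>g\<in>G i. \<kappa> g)"
        have "clears s \<Psi> (cut yy Z) lam H"
          unfolding clears_def
        proof
          fix g
          have "cut (cut yy Z) (m g - \<Union>(m ` H)) P \<le> (SUP i. ennreal (l (n + i) powr (q - 1)) * cut (y (n + i)) (m g) P)" for P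
          proof (cases "P \<in> Z \<and> P \<in> m g \<and> P \<notin> \<Union>(m ` H) \<and> yy P \<noteq> 0")
            case True
            then obtain k where k: "yy P = Y k P" "y k P \<noteq> 0" using yy_cases by metis
            have "P \<in> \<Union>(m ` G k)" using y_supp[OF k(2)] by auto
            then obtain h where h: "h \<in> G k" "P \<in> m h" by auto
            moreover have "m h \<inter> Z \<subseteq> \<Union>(m ` \<kappa> h)" using \<kappa> h(1) by blast
            ultimately have "P \<in> \<Union>(m ` \<kappa> h)" using True by blast
            then have "\<not> k < n" using True h by (auto simp: H_def)
            then obtain i where i: "k = n + i" using le_Suc_ex not_less by blast
            have "cut (cut yy Z) (m g - \<Union>(m ` H)) P = ennreal (l (n + i) powr (q - 1)) * cut (y (n + i)) (m g) P"
              using True k i by (simp add: cut_def Y_def)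
            also have "\<dots> \<le> (SUP i. ennreal (l (n + i) powr (q - 1)) * cut (y (n + i)) (m g) P)"
              by (rule SUP_upper) simp
            finally show ?thesis .
          qed (auto simp: cut_def indicator_def)
          then have "\<Psi> (cut (cut yy Z) (m g - \<Union>(m ` H))) \<le> \<Psi> (\<lambda>P. SUP i. ennreal (l (n + i) powr (q - 1)) * cut (y (n + i)) (m g) P)"
            by (rule good_mono[OF \<Psi>])
          also have "\<dots> \<le> ennreal E * (\<Sum>i. ennreal (2 powr (e * real i)) * \<Psi> (\<lambda>P. ennreal (l (n + i) powr (q - 1)) * cut (y (n + i)) (m g) P))"
            by (rule E)
          also have "\<dots> \<le> ennreal E * (\<Sum>i. ennreal (C * l n powr ((q - 1) * s) * \<rho> ^ i) * w g)"
          proof (intro mult_left_mono suminf_le)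
            fix i
            have "ennreal (2 powr (e * real i)) * \<Psi> (\<lambda>P. ennreal (l (n + i) powr (q - 1)) * cut (y (n + i)) (m g) P)
              \<le> ennreal (2 powr (e * real i)) * (ennreal ((l (n + i) powr (q - 1)) powr s) * (ennreal C * w g))"
              using l[of "n + i"] y_bd by (subst good_scale[OF \<Psi>]) (auto intro!: mult_left_mono)
            also have "\<dots> = ennreal (2 powr (e * real i) * (l (n + i) powr (q - 1)) powr s * C) * w g"
              using C by (simp add: ennreal_mult mult.assoc)
            also have "2 powr (e * real i) * (l (n + i) powr (q - 1)) powr s * C = C * l n powr ((q - 1) * s) * \<rho> ^ i"
            proof -
              have "l (n + i) = l n * 2 powr (- real i)"
              proof -
                have "2 powr (- real i) = (1/2) ^ i"
                  by (simp add: powr_minus powr_realpow power_one_over inverse_eq_divide)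
                then show ?thesis by (simp only: l_def power_add power_Suc add_Suc mult.assoc)
              qed
              then have "(l (n + i) powr (q - 1)) powr s = l n powr ((q - 1) * s) * 2 powr (- real i * ((q - 1) * s))"
                using l[of n] by (simp only: powr_powr powr_mult mult.assoc)
              moreover have "2 powr (e * real i) * 2 powr (- real i * ((q - 1) * s)) = \<rho> ^ i"
              proof -
                have "e * real i + - real i * ((q - 1) * s) = - e * real i" by (simp add: e_def field_simps)
                then show ?thesis
                  unfolding powr_add[symmetric] by (simp only: \<rho>_def powr_powr powr_realpow[symmetric] powr_gt_zero)
              qed
              ultimately show ?thesis by (simp add: ac_simps)
            qed
            finally show "ennreal (2 powr (e * real i)) * \<Psi> (\<lambda>P. ennreal (l (n + i) powr (q - 1)) * cut (y (n + i)) (m g) P)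
              \<le> ennreal (C * l n powr ((q - 1) * s) * \<rho> ^ i) * w g" .
          qed auto
          also have "(\<Sum>i. ennreal (C * l n powr ((q - 1) * s) * \<rho> ^ i) * w g) = ennreal (C * l n powr ((q - 1) * s) / (1 - \<rho>)) * w g"
          proof -
            have "(\<Sum>i. ennreal (C * l n powr ((q - 1) * s) * \<rho> ^ i)) = ennreal (C * l n powr ((q - 1) * s) / (1 - \<rho>))"
              using \<rho> C suminf_geometric[of \<rho>]
              by (subst suminf_ennreal2) (auto intro!: summable_mult summable_geometric simp: suminf_mult divide_inverse)
            then show ?thesis by simp
          qed
          also have "ennreal E * (ennreal (C * l n powr ((q - 1) * s) / (1 - \<rho>)) * w g) = ennreal (t n powr s) * w g"
          proof -
            have "E * (C * l n powr ((q - 1) * s) / (1 - \<rho>)) = t n powr s"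
              using d l[of n] by (simp add: t_def powr_mult powr_powr)
            then show ?thesis using E C \<rho> by (simp add: mult.assoc[symmetric] ennreal_mult[symmetric])
          qed
          also have "\<dots> \<le> ennreal (lam powr s) * w g"
            using lam d s by (intro mult_right_mono ennreal_leI powr_mono2) (auto simp: t_def)
          finally show "\<Psi> (cut (cut yy Z) (m g - \<Union>(m ` H))) \<le> ennreal (lam powr s) * w g" .
        qed
        then show "\<exists>G'. clears s \<Psi> (cut yy Z) lam G' \<and> nsum G' w \<le> nsum (\<Union>i<n. \<Union>g\<in>G i. \<kappa> g) w"
          unfolding H_def by blast
      qed
      also have "\<dots> = ennreal (d powr conj_exp q) * (\<Sum>n. ennreal (a n) * nsum (G n) (\<lambda>g. nsum (\<kappa> g) w))"
        unfolding ennreal_suminf_cmult[symmetric]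
      proof (rule suminf_cong)
        fix n
        have "t n powr conj_exp q = d powr conj_exp q * a n"
          using d l[of n] q'(3) by (simp add: t_def a_def powr_mult powr_powr)
        then show "nsum (G n) (\<lambda>g. nsum (\<kappa> g) w) * ennreal (t n powr conj_exp q) =
          ennreal (d powr conj_exp q) * (ennreal (a n) * nsum (G n) (\<lambda>g. nsum (\<kappa> g) w))"
          using a0[of n] by (simp add: ennreal_mult ac_simps)
      qed
      also have "\<dots> \<le> ennreal D * (\<Sum>n. ennreal (a n) * nsum (G n) (\<lambda>g. nsum (\<kappa> g) w))"
        by (intro mult_right_mono ennreal_leI) (auto simp: D_def)
      finally show ?thesis .
    qed
    show "\<exists>a G y. partner D c (out r \<Phi> q) (out s \<Psi> (conj_exp q)) x a G y"
      unfolding partner_def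
      using yy_supp yy_fin Q_fin N pair N'
      by (intro exI[of _ a] exI[of _ G] exI[of _ yy] conjI) auto
  qed
qed

end


section \<open>Dyadic intervals, trees and strips as sets of tile indices\<close>

text \<open>A dyadic interval is encoded by the pair \<open>(m, l)\<close> of \<^term>\<open>dyint m l\<close>, and a tile by the triple of its
  indices; the ancestor of \<open>(m, l)\<close> that is \<open>d\<close> generations older has position \<open>m div 2 ^ d\<close>.\<close>

definition ivl :: "int \<times> int \<Rightarrow> real set" where
  "ivl = (\<lambda>(m, l). dyint m l)"

definition inside :: "int \<times> int \<Rightarrow> int \<times> int \<Rightarrow> bool" where
  "inside I J \<longleftrightarrow> snd I \<le> snd J \<and> fst I div 2 ^ nat (snd J - snd I) = fst J"

text \<open>Position of the dyadic interval of length \<open>2 powr l\<close> that contains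
  \<open>t\<close>; ceiling minus one because the intervals are open on the left and closed on the
  right.\<close>

definition pos :: "int \<Rightarrow> real \<Rightarrow> int" where
  "pos l t = \<lceil>t / 2 powr real_of_int l\<rceil> - 1"

lemma dyint_iff: "t \<in> dyint m l \<longleftrightarrow> pos l t = m"
proof -
  have "t \<in> dyint m l \<longleftrightarrow> real_of_int m < t / 2 powr real_of_int l \<and> t / 2 powr real_of_int l \<le> real_of_int m + 1"
    by (simp add: dyint_def field_simps)
  also have "\<dots> \<longleftrightarrow> \<lceil>t / 2 powr real_of_int l\<rceil> = m + 1" by (auto simp: ceiling_eq_iff)
  finally show ?thesis by (auto simp: pos_def)
qed

lemma ivl_iff: "t \<in> ivl I \<longleftrightarrow> pos (snd I) t = fst I"
  by (cases I) (simp add: ivl_def dyint_iff)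

text \<open>The shift by one, which matches intervals closed on the right, is what makes passing to
  a coarser grid an exact integer division of positions.\<close>

lemma ceiling_div:
  fixes x :: real assumes "0 < N"
  shows "\<lceil>x / real_of_int N\<rceil> - 1 = (\<lceil>x\<rceil> - 1) div N"
proof -
  define m where "m = \<lceil>x\<rceil> - 1"
  define k where "k = m div N"
  have m: "real_of_int m < x" "x \<le> real_of_int m + 1" unfolding m_def by linarith+
  have "m = k * N + m mod N" "0 \<le> m mod N" "m mod N < N" using assms by (simp_all add: k_def)
  then have "k * N \<le> m" "m < (k + 1) * N" unfolding distrib_right mult_1 by linarith+
  then have "k * N \<le> m" "m + 1 \<le> (k + 1) * N" by auto
  then have "real_of_int (k * N) \<le> real_of_int m" "real_of_int (m + 1) \<le> real_of_int ((k + 1) * N)"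
    by (simp_all only: of_int_le_iff)
  then have "real_of_int k < x / real_of_int N" "x / real_of_int N \<le> real_of_int k + 1"
    using m assms by (simp_all add: field_simps)
  then have "\<lceil>x / real_of_int N\<rceil> = k + 1" by (auto simp: ceiling_eq_iff)
  then show ?thesis by (simp add: k_def m_def)
qed

lemma pos_ancestor:
  assumes "l' \<le> l"
  shows "pos l t = pos l' t div 2 ^ nat (l - l')"
proof -
  have "2 powr real_of_int l = 2 powr real_of_int l' * 2 ^ nat (l - l')"
    using assms by (simp add: powr_realpow[symmetric] powr_add[symmetric])
  then have "pos l t = \<lceil>(t / 2 powr real_of_int l') / real_of_int (2 ^ nat (l - l'))\<rceil> - 1"
    by (simp add: pos_def)
  also have "\<dots> = pos l' t div 2 ^ nat (l - l')" unfolding pos_def by (rule ceiling_div) simp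
  finally show ?thesis .
qed

lemma right_end_mem: "2 powr real_of_int l * (real_of_int m + 1) \<in> dyint m l"
  by (simp add: dyint_def)

lemma ivl_nonempty: obtains t where "t \<in> ivl I"
  using right_end_mem[of "snd I" "fst I"] by (cases I) (simp add: ivl_def)

lemma inside_of_mem: "t \<in> ivl I \<Longrightarrow> t \<in> ivl J \<Longrightarrow> snd I \<le> snd J \<Longrightarrow> inside I J"
  using pos_ancestor[of "snd I" "snd J" t] by (auto simp: ivl_iff inside_def)

lemma inside_mem: "inside I J \<Longrightarrow> t \<in> ivl I \<Longrightarrow> t \<in> ivl J"
  using pos_ancestor[of "snd I" "snd J" t] by (auto simp: ivl_iff inside_def)

lemma inside_iff_subset: "snd I \<le> snd J \<Longrightarrow> inside I J \<longleftrightarrow> ivl I \<subseteq> ivl J"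
  by (metis inside_mem inside_of_mem ivl_nonempty subset_iff)

lemma inside_refl [simp]: "inside I I"
  by (simp add: inside_def)

lemma inside_trans: "inside I J \<Longrightarrow> inside J K \<Longrightarrow> inside I K"
  by (metis inside_mem inside_of_mem ivl_nonempty inside_def order_trans)

lemma inside_antisym: "inside I J \<Longrightarrow> inside J I \<Longrightarrow> I = J"
  by (auto simp: inside_def intro: prod_eqI)

lemma ivl_cases:
  obtains "inside I J" | "\<not> inside I J" "inside J I" | "ivl I \<inter> ivl J = {}" "\<not> inside I J" "\<not> inside J I"
proof (cases "ivl I \<inter> ivl J = {}")
  case True
  then have "\<not> inside I J" "\<not> inside J I" by (metis disjoint_iff inside_mem ivl_nonempty)+
  with True show ?thesis using that by blast
next
  case False
  then obtain t where "t \<in> ivl I" "t \<in> ivl J" by auto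
  then have "inside I J \<or> inside J I" by (cases "snd I \<le> snd J") (auto intro: inside_of_mem)
  then show ?thesis using that by blast
qed

definition ws :: "int \<times> int \<Rightarrow> ennreal" where
  "ws I = ennreal (2 powr real_of_int (snd I))"

lemma ivl_borel [measurable]: "ivl I \<in> sets borel"
  by (cases I) (simp add: ivl_def dyint_def)

lemma emeasure_ivl: "emeasure lborel (ivl I) = ws I"
  by (cases I) (simp add: ivl_def dyint_def ws_def algebra_simps)

lemma ws_mono: "inside I J \<Longrightarrow> ws I \<le> ws J"
  by (simp add: ws_def inside_def ennreal_leI)

section \<open>Trees and strips as the two instances of the outer construction\<close>

type_synonym tidx = "int \<times> int \<times> int"

definition top_ivl :: "tidx \<Rightarrow> int \<times> int" where
  "top_ivl = (\<lambda>(m, l, n). (m, l))"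

text \<open>Frequency intervals grow as the scale drops from \<open>l\<close> to \<open>l'\<close>;
  this is the position of the ancestor of length \<open>2 powr (- l')\<close>. By
  \<open>Nidx_eq\<close> it computes the definite description \<open>Nidx\<close>.\<close>

definition anc :: "int \<Rightarrow> int \<Rightarrow> int \<Rightarrow> int" where
  "anc n l l' = n div 2 ^ nat (l - l')"

lemma anc_anc: "l'' \<le> l' \<Longrightarrow> l' \<le> l \<Longrightarrow> anc (anc n l l') l' l'' = anc n l l''"
  unfolding anc_def
  by (simp add: zdiv_zmult2_eq[symmetric] power_add[symmetric] nat_add_distrib[symmetric])

definition treeT :: "tidx \<Rightarrow> tidx set" where
  "treeT = (\<lambda>(m, l, n). {(m', l', n'). inside (m', l') (m, l) \<and> n' = anc n l l'})"

definition stripT :: "int \<times> int \<Rightarrow> tidx set" where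
  "stripT I = {P. inside (top_ivl P) I}"

definition wt :: "tidx \<Rightarrow> ennreal" where
  "wt T = ws (top_ivl T)"

lemma self_in_treeT: "P \<in> treeT P"
  by (cases P) (simp add: treeT_def anc_def)

lemma finite_level_bound: "finite {l::int. k \<le> l \<and> ennreal (2 powr real_of_int l) \<le> ennreal A}"
proof (rule finite_subset)
  show "{l::int. k \<le> l \<and> ennreal (2 powr real_of_int l) \<le> ennreal A} \<subseteq> {k..\<lceil>log 2 A\<rceil>}"
  proof safe
    fix l :: int assume l: "ennreal (2 powr real_of_int l) \<le> ennreal A" "k \<le> l"
    then have A: "0 < A" by (metis ennreal_le_iff2 powr_gt_zero not_less order_less_le_trans zero_neq_numeral)
    then have "2 powr real_of_int l \<le> A" using l by simp
    then have "real_of_int l \<le> log 2 A" using A by (simp add: le_log_iff)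
    then have "l \<le> \<lceil>log 2 A\<rceil>" by linarith
    then show "l \<in> {k..\<lceil>log 2 A\<rceil>}" using l by simp
  qed
qed simp

interpretation TR: outer treeT wt
proof
  fix g P :: tidx and A :: real
  show "0 < wt g" "wt g < top" by (auto simp: wt_def ws_def)
  show "\<exists>g. P \<in> treeT g" using self_in_treeT by blast
  obtain m' l' n' where P: "P = (m', l', n')" by (cases P)
  let ?L = "{l::int. l' \<le> l \<and> ennreal (2 powr real_of_int l) \<le> ennreal A}"
  \<comment> \<open>A tree over \<open>P\<close> is determined by its scale and its frequency index:
    the time interval is the ancestor of that of \<open>P\<close>, and the frequency index is one of
    the \<open>2 ^ nat (l - l')\<close> descendants of \<open>n'\<close>.\<close>
  have "{g. P \<in> treeT g \<and> wt g \<le> ennreal A} \<subseteq>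
    (\<Union>l\<in>?L. (\<lambda>n. (m' div 2 ^ nat (l - l'), l, n)) ` {n' * 2 ^ nat (l - l')..<(n' + 1) * 2 ^ nat (l - l')})"
  proof safe
    fix m l n assume *: "P \<in> treeT (m, l, n)" "wt (m, l, n) \<le> ennreal A"
    have n: "n' = n div 2 ^ nat (l - l')" using * by (simp add: P treeT_def anc_def)
    have "n = n' * 2 ^ nat (l - l') + n mod 2 ^ nat (l - l')" "0 \<le> n mod 2 ^ nat (l - l')"
      "n mod 2 ^ nat (l - l') < 2 ^ nat (l - l')"
      unfolding n by (rule div_mult_mod_eq[symmetric]) simp_all
    then have "n' * 2 ^ nat (l - l') \<le> n" "n < (n' + 1) * 2 ^ nat (l - l')"
      unfolding distrib_right mult_1 by linarith+
    moreover have "m = m' div 2 ^ nat (l - l')" "l \<in> ?L"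
      using * by (auto simp: P treeT_def inside_def wt_def ws_def top_ivl_def)
    ultimately show "(m, l, n) \<in> (\<Union>l\<in>?L. (\<lambda>n. (m' div 2 ^ nat (l - l'), l, n)) ` {n' * 2 ^ nat (l - l')..<(n' + 1) * 2 ^ nat (l - l')})"
      by auto
  qed
  then show "finite {g. P \<in> treeT g \<and> wt g \<le> ennreal A}"
    by (rule finite_subset) (intro finite_UN_I finite_level_bound finite_imageI finite_atLeastLessThan_int)
qed

interpretation ST: outer stripT ws
proof
  fix I :: "int \<times> int" and P :: tidx and A :: real
  show "0 < ws I" "ws I < top" by (auto simp: ws_def)
  show "\<exists>I. P \<in> stripT I" unfolding stripT_def by (rule exI[of _ "top_ivl P"]) simp
  let ?L = "{l::int. snd (top_ivl P) \<le> l \<and> ennreal (2 powr real_of_int l) \<le> ennreal A}"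
  have "{I. P \<in> stripT I \<and> ws I \<le> ennreal A} \<subseteq> (\<lambda>l. (fst (top_ivl P) div 2 ^ nat (l - snd (top_ivl P)), l)) ` ?L"
    by (auto simp: stripT_def inside_def ws_def)
  then show "finite {I. P \<in> stripT I \<and> ws I \<le> ennreal A}"
    by (rule finite_subset) (intro finite_imageI finite_level_bound)
qed

text \<open>What a strip cuts out of a tree: the tree itself, or the subtree with top interval
  \<open>I\<close> and inherited frequency, or nothing. In each case its weight is the length of the
  overlap, see \<open>nsum_rest\<close>.\<close>

definition rest :: "tidx \<Rightarrow> int \<times> int \<Rightarrow> tidx set" where
  "rest T I = (if inside (top_ivl T) I then {T} else if inside I (top_ivl T)
     then {(fst I, snd I, anc (snd (snd T)) (snd (top_ivl T)) (snd I))} else {})"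

lemma rest_cases:
  obtains (empty) "rest T I = {}" "treeT T \<inter> stripT I = {}" "ivl (top_ivl T) \<inter> ivl I = {}"
  | (single) T' where "rest T I = {T'}" "treeT T \<inter> stripT I = treeT T'" "wt T' = emeasure lborel (ivl (top_ivl T) \<inter> ivl I)" "wt T' \<le> wt T"
proof (cases rule: ivl_cases[of "top_ivl T" I])
  case 1
  have "treeT T \<subseteq> stripT I"
    using 1 by (cases T) (auto simp: treeT_def stripT_def top_ivl_def intro: inside_trans)
  moreover have "ivl (top_ivl T) \<inter> ivl I = ivl (top_ivl T)" using inside_mem[OF 1] by auto
  ultimately show ?thesis using 1 by (intro single[of T]) (auto simp: rest_def wt_def emeasure_ivl)
next
  case 2
  obtain m l n where T: "T = (m, l, n)" by (cases T)
  obtain M L where I: "I = (M, L)" by (cases I)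
  have L: "L \<le> l" using 2 by (simp add: T I top_ivl_def inside_def)
  have "treeT T \<inter> stripT I = treeT (M, L, anc n l L)"
  proof (rule set_eqI)
    fix P :: tidx
    obtain m' l' n' where P: "P = (m', l', n')" by (cases P)
    have sub: "inside (M, L) (m, l)" using 2 by (simp add: T I top_ivl_def)
    show "P \<in> treeT T \<inter> stripT I \<longleftrightarrow> P \<in> treeT (M, L, anc n l L)"
    proof (cases "inside (m', l') (M, L)")
      case True
      then have "inside (m', l') (m, l)" using sub by (rule inside_trans)
      moreover have "l' \<le> L" using True by (simp add: inside_def)
      ultimately show ?thesis using True L by (simp add: P T I treeT_def stripT_def top_ivl_def anc_anc)
    qed (simp add: P T I treeT_def stripT_def top_ivl_def)
  qed
  moreover have "ivl (top_ivl T) \<inter> ivl I = ivl I" using inside_mem[OF 2(2)] by auto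
  ultimately show ?thesis
    using 2 ws_mono[OF 2(2)] by (intro single[of "(M, L, anc n l L)"]) (auto simp: rest_def wt_def emeasure_ivl T I top_ivl_def)
next
  case 3
  have "P \<notin> treeT T \<inter> stripT I" for P
  proof
    assume "P \<in> treeT T \<inter> stripT I"
    then have "inside (top_ivl P) (top_ivl T)" "inside (top_ivl P) I"
      by (auto simp: treeT_def stripT_def top_ivl_def split: prod.splits)
    then show False using 3(1) by (metis disjoint_iff inside_mem ivl_nonempty)
  qed
  then show ?thesis using 3 by (intro empty) (auto simp: rest_def)
qed

lemma rest_cover: "treeT T \<inter> stripT I = \<Union>(treeT ` rest T I)"
  by (cases rule: rest_cases[of T I]) auto

lemma nsum_rest: "nsum (rest T I) wt = emeasure lborel (ivl (top_ivl T) \<inter> ivl I)"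
  by (cases rule: rest_cases[of T I]) (auto simp: nn_integral_count_space_finite)

definition disj :: "(int \<times> int) set \<Rightarrow> bool" where
  "disj M \<longleftrightarrow> disjoint_family_on ivl M"

lemma nsum_meet:
  assumes "disj M" and that: "J \<in> sets borel"
  shows "nsum M (\<lambda>I. emeasure lborel (J \<inter> ivl I)) \<le> emeasure lborel J"
proof -
  have "disjoint_family_on (\<lambda>I. J \<inter> ivl I) M"
    using assms unfolding disj_def disjoint_family_on_def by blast
  then have "nsum M (\<lambda>I. emeasure lborel (J \<inter> ivl I)) = emeasure lborel (\<Union>I\<in>M. J \<inter> ivl I)"
    using that by (intro emeasure_UN_countable[symmetric]) auto
  also have "\<dots> \<le> emeasure lborel J"
    using that by (intro emeasure_mono) auto
  finally show ?thesis .
qed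

lemma nsum_mono_supp:
  assumes "\<And>a. a \<in> A \<Longrightarrow> f a \<noteq> 0 \<Longrightarrow> a \<in> B"
  shows "nsum A f \<le> nsum B f"
  unfolding nsum_ind[of A] nsum_ind[of B]
proof (intro nn_integral_mono)
  fix a show "f a * indicator A a \<le> f a * indicator B a"
    using assms[of a] by (cases "f a = 0") (auto simp: indicator_def)
qed

lemma psum_cut: "0 < r \<Longrightarrow> psum r (cut x A) = nsum A (\<lambda>P. epow (x P) r)"
  unfolding psum_def nsum_ind[of A] by (intro nn_integral_cong) (auto simp: cut_def indicator_def)

section \<open>Additivity over disjoint strips\<close>

lemma clears_strips_union:
  assumes M: "disj M" and r: "0 < r" and supp: "\<And>P. x P \<noteq> 0 \<Longrightarrow> \<exists>I\<in>M. P \<in> stripT I"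
    and G: "\<And>I. I \<in> M \<Longrightarrow> TR.clears r (psum r) (cut x (stripT I)) lam (G I)"
  shows "TR.clears r (psum r) x lam (\<Union>I\<in>M. G I)"
  unfolding TR.clears_def
proof
  fix T
  let ?U = "\<Union>(treeT ` (\<Union>I\<in>M. G I))"
  have "psum r (cut x (treeT T - ?U)) = nsum (treeT T - ?U) (\<lambda>P. epow (x P) r)" using r by (rule psum_cut)
  also have "\<dots> \<le> nsum (\<Union>I\<in>M. treeT T \<inter> stripT I - \<Union>(treeT ` G I)) (\<lambda>P. epow (x P) r)"
  proof (rule nsum_mono_supp)
    fix P assume P: "P \<in> treeT T - ?U" "epow (x P) r \<noteq> 0"
    then obtain I where "I \<in> M" "P \<in> stripT I" using supp[of P] by auto
    then show "P \<in> (\<Union>I\<in>M. treeT T \<inter> stripT I - \<Union>(treeT ` G I))" using P(1) by blast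
  qed
  also have "\<dots> \<le> nsum M (\<lambda>I. nsum (treeT T \<inter> stripT I - \<Union>(treeT ` G I)) (\<lambda>P. epow (x P) r))"
    by (rule nsum_UN_le) simp
  also have "\<dots> \<le> nsum M (\<lambda>I. ennreal (lam powr r) * emeasure lborel (ivl (top_ivl T) \<inter> ivl I))"
  proof (intro nn_integral_mono)
    fix I assume "I \<in> space (count_space M)"
    then have I: "I \<in> M" by simp
    show "nsum (treeT T \<inter> stripT I - \<Union>(treeT ` G I)) (\<lambda>P. epow (x P) r) \<le> ennreal (lam powr r) * emeasure lborel (ivl (top_ivl T) \<inter> ivl I)"
    proof (cases rule: rest_cases[of T I])
      case empty
      then show ?thesis by simp
    next
      case (single T')
      have "nsum (treeT T \<inter> stripT I - \<Union>(treeT ` G I)) (\<lambda>P. epow (x P) r) = psum r (cut x (treeT T \<inter> stripT I - \<Union>(treeT ` G I)))"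
        using r by (rule psum_cut[symmetric])
      also have "\<dots> = psum r (cut (cut x (stripT I)) (treeT T' - \<Union>(treeT ` G I)))"
      proof -
        have "treeT T \<inter> stripT I - \<Union>(treeT ` G I) = stripT I \<inter> (treeT T' - \<Union>(treeT ` G I))"
          using single(2) by blast
        then show ?thesis by simp
      qed
      also have "\<dots> \<le> ennreal (lam powr r) * wt T'" using G[OF I] unfolding TR.clears_def by (rule spec)
      finally show ?thesis using single by simp
    qed
  qed
  also have "\<dots> = ennreal (lam powr r) * nsum M (\<lambda>I. emeasure lborel (ivl (top_ivl T) \<inter> ivl I))"
    by (simp add: nn_integral_cmult)
  also have "\<dots> \<le> ennreal (lam powr r) * wt T"
    using nsum_meet[OF M, of "ivl (top_ivl T)"] by (intro mult_left_mono) (auto simp: emeasure_ivl wt_def)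
  finally show "psum r (cut x (treeT T - ?U)) \<le> ennreal (lam powr r) * wt T" .
qed

text \<open>Together with \<open>strips_le_out\<close> this gives exact additivity over disjoint
  strips that carry the support. Near-optimal families on the strips are united, with summable
  errors since there are countably many strips.\<close>

lemma out_le_strips:
  assumes M: "disj M" and r: "0 < r" and q: "0 < q" and supp: "\<And>P. x P \<noteq> 0 \<Longrightarrow> \<exists>I\<in>M. P \<in> stripT I"
  shows "TR.out r (psum r) q x \<le> nsum M (\<lambda>I. TR.out r (psum r) q (cut x (stripT I)))"
proof -
  note g = psum_good[OF r, where 'p = tidx]
  have "TR.super r (psum r) x lam \<le> nsum M (\<lambda>I. TR.super r (psum r) (cut x (stripT I)) lam)" if "0 < lam" for lam
  proof (rule ennreal_le_epsilon)
    fix e :: real assume e: "0 < e"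
    let ?e = "\<lambda>I::int \<times> int. e * (1/2) ^ Suc (to_nat I)"
    have "\<exists>G. TR.clears r (psum r) (cut x (stripT I)) lam G \<and> nsum G wt \<le> TR.super r (psum r) (cut x (stripT I)) lam + ennreal (?e I)" for I
    proof -
      have "0 < ?e I" using e by simp
      from TR.super_near[OF g r this, of "cut x (stripT I)" lam] show ?thesis by blast
    qed
    then obtain G where G: "\<And>I. TR.clears r (psum r) (cut x (stripT I)) lam (G I)"
      "\<And>I. nsum (G I) wt \<le> TR.super r (psum r) (cut x (stripT I)) lam + ennreal (?e I)" by metis
    have "TR.super r (psum r) x lam \<le> nsum (\<Union>I\<in>M. G I) wt"
      by (intro TR.super_le clears_strips_union[OF M r supp G(1)])
    also have "\<dots> \<le> nsum M (\<lambda>I. nsum (G I) wt)" by (rule nsum_UN_le) simp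
    also have "\<dots> \<le> nsum M (\<lambda>I. TR.super r (psum r) (cut x (stripT I)) lam + ennreal (?e I))"
      by (intro nn_integral_mono G(2))
    also have "\<dots> = nsum M (\<lambda>I. TR.super r (psum r) (cut x (stripT I)) lam) + nsum M (\<lambda>I. ennreal (?e I))"
      by (rule nn_integral_add) auto
    also have "nsum M (\<lambda>I. ennreal (?e I)) \<le> ennreal e"
      using e by (intro order_trans[OF nsum_mono_set[OF subset_UNIV] nsum_geometric_weights]) auto
    finally show "TR.super r (psum r) x lam \<le> nsum M (\<lambda>I. TR.super r (psum r) (cut x (stripT I)) lam) + ennreal e"
      by (simp add: add_left_mono)
  qed
  then have "TR.out r (psum r) q x \<le> wint q (\<lambda>lam. nsum M (\<lambda>I. TR.super r (psum r) (cut x (stripT I)) lam))"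
    unfolding TR.out_def by (rule wint_mono)
  also have "\<dots> = nsum M (\<lambda>I. TR.out r (psum r) q (cut x (stripT I)))"
    unfolding TR.out_def by (rule wint_nsum) (auto intro: TR.decr_super[OF g r])
  finally show ?thesis .
qed

lemma clears_strip_restrict:
  assumes r: "0 < r" and G: "TR.clears r (psum r) x lam G"
  shows "TR.clears r (psum r) (cut x (stripT I)) lam (\<Union>T\<in>G. rest T I)"
  unfolding TR.clears_def
proof
  fix T
  note g = psum_good[OF r, where 'p = tidx]
  let ?U = "\<Union>(treeT ` (\<Union>T\<in>G. rest T I))"
  have U: "?U = \<Union>(treeT ` G) \<inter> stripT I" using rest_cover[of _ I] by blast
  have eq: "stripT I \<inter> (treeT T - ?U) = treeT T \<inter> stripT I - \<Union>(treeT ` G)" unfolding U by blast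
  show "psum r (cut (cut x (stripT I)) (treeT T - ?U)) \<le> ennreal (lam powr r) * wt T"
  proof (cases rule: rest_cases[of T I])
    case empty
    then show ?thesis unfolding cut_cut eq by (simp add: good_zero[OF g])
  next
    case (single T')
    have "psum r (cut x (treeT T' - \<Union>(treeT ` G))) \<le> ennreal (lam powr r) * wt T'" using G unfolding TR.clears_def by (rule spec)
    also have "\<dots> \<le> ennreal (lam powr r) * wt T" by (intro mult_left_mono single) auto
    finally show ?thesis unfolding cut_cut eq single(2) .
  qed
qed

text \<open>The traces on the strips of one clearing family clear the pieces, and all traces of a
  single tree together weigh at most as much as the tree.\<close>

lemma strips_le_out:
  assumes M: "disj M" and r: "0 < r" and q: "0 < q"
  shows "nsum M (\<lambda>I. TR.out r (psum r) q (cut x (stripT I))) \<le> TR.out r (psum r) q x"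
proof -
  note g = psum_good[OF r, where 'p = tidx]
  have "nsum M (\<lambda>I. TR.super r (psum r) (cut x (stripT I)) lam) \<le> TR.super r (psum r) x lam" for lam
    unfolding TR.super_def[of r "psum r" x]
  proof (rule INF_greatest)
    fix G assume "G \<in> {G. TR.clears r (psum r) x lam G}"
    then have G: "TR.clears r (psum r) x lam G" by simp
    have "nsum M (\<lambda>I. TR.super r (psum r) (cut x (stripT I)) lam) \<le> nsum M (\<lambda>I. nsum G (\<lambda>T. nsum (rest T I) wt))"
    proof (intro nn_integral_mono)
      fix I
      have "TR.super r (psum r) (cut x (stripT I)) lam \<le> nsum (\<Union>T\<in>G. rest T I) wt"
        by (intro TR.super_le clears_strip_restrict[OF r G])
      also have "\<dots> \<le> nsum G (\<lambda>T. nsum (rest T I) wt)" by (rule nsum_UN_le) simp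
      finally show "TR.super r (psum r) (cut x (stripT I)) lam \<le> nsum G (\<lambda>T. nsum (rest T I) wt)" .
    qed
    also have "\<dots> = nsum G (\<lambda>T. nsum M (\<lambda>I. nsum (rest T I) wt))"
      by (rule nn_integral_count_space_nn_integral) auto
    also have "\<dots> \<le> nsum G wt"
      unfolding nsum_rest wt_def emeasure_ivl[symmetric] by (intro nn_integral_mono nsum_meet M) simp
    finally show "nsum M (\<lambda>I. TR.super r (psum r) (cut x (stripT I)) lam) \<le> nsum G wt" .
  qed
  then have "wint q (\<lambda>lam. nsum M (\<lambda>I. TR.super r (psum r) (cut x (stripT I)) lam)) \<le> TR.out r (psum r) q x"
    unfolding TR.out_def by (intro wint_mono)
  moreover have "wint q (\<lambda>lam. nsum M (\<lambda>I. TR.super r (psum r) (cut x (stripT I)) lam)) = nsum M (\<lambda>I. TR.out r (psum r) q (cut x (stripT I)))"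
    unfolding TR.out_def by (rule wint_nsum) (auto intro: TR.decr_super[OF g r])
  ultimately show ?thesis by simp
qed

section \<open>Counting functions of weighted tree families\<close>

text \<open>When the scales are bounded, the maximal intervals cover as much as all of them
  (\<open>maxes_above\<close>), and they are disjoint, so that lengths add.\<close>

definition maxes :: "(int \<times> int) set \<Rightarrow> (int \<times> int) set" where
  "maxes B = {I \<in> B. \<forall>J\<in>B. inside I J \<longrightarrow> J = I}"

lemma maxes_disj: "disj (maxes B)"
  unfolding disj_def disjoint_family_on_def
proof (intro ballI impI)
  fix I J assume "I \<in> maxes B" "J \<in> maxes B" "I \<noteq> J"
  then have "\<not> inside I J" "\<not> inside J I" by (auto simp: maxes_def)
  then show "ivl I \<inter> ivl J = {}" by (cases rule: ivl_cases[of I J]) auto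
qed

lemma maxes_above:
  assumes bd: "\<And>I. I \<in> B \<Longrightarrow> snd I \<le> b" and I: "I \<in> B"
  obtains J where "J \<in> maxes B" "inside I J"
proof -
  have "\<exists>J\<in>maxes B. inside I J"
    using I
  proof (induction "nat (b - snd I)" arbitrary: I rule: less_induct)
    case less
    show ?case
    proof (cases "I \<in> maxes B")
      case True
      then show ?thesis by (auto intro: bexI[of _ I])
    next
      case False
      then obtain J where J: "J \<in> B" "inside I J" "J \<noteq> I" using less.prems by (auto simp: maxes_def)
      \<comment> \<open>At equal scale \<open>inside\<close> would force equal positions.\<close>
      have "snd I < snd J" using J(2,3) inside_antisym[of I J] unfolding inside_def
        by (metis div_by_1 diff_self inside_def le_less nat_zero_as_int of_nat_0 order_refl power_0 prod_eqI zero_less_nat_eq nat_0)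
      then have "nat (b - snd J) < nat (b - snd I)" using bd[OF J(1)] by linarith
      from less.hyps[OF this J(1)] show ?thesis using J(2) inside_trans by blast
    qed
  qed
  then show ?thesis using that by blast
qed

lemma nsum_le_finite:
  fixes A :: "'a::countable set"
  assumes "\<And>F. finite F \<Longrightarrow> F \<subseteq> A \<Longrightarrow> sum f F \<le> c"
  shows "nsum A f \<le> c"
proof -
  define B where "B n = {a \<in> A. to_nat a \<le> n}" for n
  have fin: "finite (B n)" for n
  proof (rule inj_on_finite)
    show "inj_on to_nat (B n)" by (rule inj_on_subset[OF inj_to_nat]) simp
    show "to_nat ` B n \<subseteq> {..n}" by (auto simp: B_def)
  qed simp
  have "nsum A f = (\<integral>\<^sup>+x. (SUP n. f x * indicator (B n) x) \<partial>count_space UNIV)"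
    unfolding nsum_ind[of A]
  proof (intro nn_integral_cong antisym)
    fix x
    show "f x * indicator A x \<le> (SUP n. f x * indicator (B n) x)"
    proof (cases "x \<in> A")
      case True
      then have "f x * indicator A x = f x * indicator (B (to_nat x)) x" by (simp add: B_def)
      also have "\<dots> \<le> (SUP n. f x * indicator (B n) x)" by (rule SUP_upper) simp
      finally show ?thesis .
    qed simp
    show "(SUP n. f x * indicator (B n) x) \<le> f x * indicator A x"
      by (intro SUP_least) (auto simp: B_def indicator_def)
  qed
  also have "\<dots> = (SUP n. nsum (B n) f)"
    unfolding nsum_ind[of "B _"]
    by (intro nn_integral_monotone_convergence_SUP)
       (auto simp: incseq_def le_fun_def B_def indicator_def)
  also have "\<dots> \<le> c"
    using fin assms by (intro SUP_least) (auto simp: nn_integral_count_space_finite B_def)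
  finally show ?thesis .
qed

lemma nsum_suminf:
  fixes f :: "'a::countable \<Rightarrow> ennreal"
  shows "nsum UNIV f = (\<Sum>n. f (from_nat n) * indicator (range (to_nat :: 'a \<Rightarrow> nat)) n)"
proof -
  have "nsum UNIV f = nsum UNIV (\<lambda>a::'a. f (from_nat (to_nat a)))" by simp
  also have "\<dots> = nsum (range (to_nat :: 'a \<Rightarrow> nat)) (\<lambda>n. f (from_nat n))"
    by (rule nn_integral_bij_count_space) (simp add: bij_betw_def)
  also have "\<dots> = (\<Sum>n. f (from_nat n) * indicator (range (to_nat :: 'a \<Rightarrow> nat)) n)"
    unfolding nsum_ind[of "range _"] by (rule nn_integral_count_space_nat)
  finally show ?thesis .
qed

text \<open>Weighted trees seen from the line. \<open>height I\<close> is the part of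
  \<open>count\<close> that comes from trees over all of \<open>I\<close>, so it bounds
  \<open>count\<close> from below on \<open>I\<close>, and large heights show up in the measure of a
  superlevel set of \<open>count\<close>.\<close>

locale tree_family =
  fixes a :: "'j::countable \<Rightarrow> ennreal" and T :: "'j \<Rightarrow> tidx"
begin

definition height :: "int \<times> int \<Rightarrow> ennreal" where
  "height I = nsum {j. inside I (top_ivl (T j))} a"

definition count :: "real \<Rightarrow> ennreal" where
  "count t = nsum UNIV (\<lambda>j. a j * indicator (ivl (top_ivl (T j))) t)"

definition total :: ennreal where
  "total = nsum UNIV (\<lambda>j. a j * wt (T j))"

definition bad :: "ennreal \<Rightarrow> (int \<times> int) set" where
  "bad L = {I. L < height I}"

definition bad_tiles :: "ennreal \<Rightarrow> tidx set" where
  "bad_tiles L = (\<Union>I\<in>bad L. stripT I)"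

text \<open>A tree with bad top interval lies entirely in bad tiles and leaves nothing to cover;
  every other tree is cut down to the strip.\<close>

definition trim :: "ennreal \<Rightarrow> int \<times> int \<Rightarrow> tidx \<Rightarrow> tidx set" where
  "trim L D S = (if top_ivl S \<in> bad L then {} else rest S D)"

lemma count_measurable [measurable]: "count \<in> borel_measurable borel"
  unfolding count_def nsum_suminf by measurable

lemma integral_count: "(\<integral>\<^sup>+t. count t \<partial>lborel) = total"
proof -
  have "(\<integral>\<^sup>+t. count t \<partial>lborel) = nsum UNIV (\<lambda>j. \<integral>\<^sup>+t. a j * indicator (ivl (top_ivl (T j))) t \<partial>lborel)"
    unfolding count_def by (rule nn_integral_count_space_nn_integral) auto
  also have "\<dots> = total"
    unfolding total_def by (intro nn_integral_cong) (simp add: nn_integral_cmult_indicator emeasure_ivl wt_def)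
  finally show ?thesis .
qed

lemma height_le_count: "t \<in> ivl I \<Longrightarrow> height I \<le> count t"
  unfolding height_def count_def nsum_ind[of "{j. _ j}"]
  by (intro nn_integral_mono) (auto simp: indicator_def intro: inside_mem)

lemma trim_cover: "treeT S \<inter> (stripT D - bad_tiles L) \<subseteq> \<Union>(treeT ` trim L D S)"
proof (cases "top_ivl S \<in> bad L")
  case True
  have "treeT S \<subseteq> stripT (top_ivl S)"
    by (cases S) (auto simp: treeT_def stripT_def top_ivl_def)
  then show ?thesis using True by (auto simp: bad_tiles_def)
next
  case False
  then show ?thesis using rest_cover[of S D] by (auto simp: trim_def)
qed

text \<open>Top intervals over a point \<open>t\<close> of \<open>ivl D\<close> are nested. Among
  finitely many surviving trees over \<open>t\<close>, the smallest top interval is not bad and all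
  the others contain it, so their weights sum to at most its height, hence to at most
  \<open>L\<close>. Integrating over \<open>ivl D\<close> gives the claim.\<close>

lemma trim_total: "nsum UNIV (\<lambda>j. a j * nsum (trim L D (T j)) wt) \<le> L * ws D"
proof -
  let ?J = "{j. top_ivl (T j) \<notin> bad L}"
  let ?f = "\<lambda>j t. a j * indicator ?J j * indicator (ivl (top_ivl (T j)) \<inter> ivl D) t"
  have "nsum UNIV (\<lambda>j. a j * nsum (trim L D (T j)) wt) = nsum UNIV (\<lambda>j. \<integral>\<^sup>+t. ?f j t \<partial>lborel)"
    by (intro nn_integral_cong) (auto simp: trim_def nsum_rest nn_integral_cmult_indicator)
  also have "\<dots> = (\<integral>\<^sup>+t. nsum UNIV (\<lambda>j. ?f j t) \<partial>lborel)"
    by (rule nn_integral_count_space_nn_integral[symmetric]) auto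
  also have "\<dots> \<le> (\<integral>\<^sup>+t. L * indicator (ivl D) t \<partial>lborel)"
  proof (intro nn_integral_mono)
    fix t
    show "nsum UNIV (\<lambda>j. ?f j t) \<le> L * indicator (ivl D) t"
    proof (cases "t \<in> ivl D")
      case True
      let ?A = "{j \<in> ?J. t \<in> ivl (top_ivl (T j))}"
      have "nsum UNIV (\<lambda>j. ?f j t) = nsum ?A a"
        unfolding nsum_ind[of ?A] using True by (intro nn_integral_cong) (auto simp: indicator_def)
      also have "\<dots> \<le> L"
      proof (rule nsum_le_finite)
        fix F assume F: "finite F" "F \<subseteq> ?A"
        show "sum a F \<le> L"
        proof (cases "F = {}")
          case False
          define j where "j = arg_min_on (\<lambda>j. snd (top_ivl (T j))) F"
          have j: "j \<in> F" "\<And>i. i \<in> F \<Longrightarrow> snd (top_ivl (T j)) \<le> snd (top_ivl (T i))"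
            using arg_min_if_finite[OF F(1) False, of "\<lambda>j. snd (top_ivl (T j))"] unfolding j_def
            by (auto simp: not_less)
          have "F \<subseteq> {i. inside (top_ivl (T j)) (top_ivl (T i))}"
            using j F(2) by (auto intro!: inside_of_mem[of t])
          then have "nsum F a \<le> height (top_ivl (T j))" unfolding height_def by (rule nsum_mono_set)
          also have "\<dots> \<le> L" using j(1) F(2) by (auto simp: bad_def not_less)
          finally show ?thesis using F(1) by (simp add: nn_integral_count_space_finite)
        qed simp
      qed
      finally show ?thesis using True by simp
    qed simp
  qed
  also have "\<dots> = L * ws D" by (simp add: nn_integral_cmult_indicator emeasure_ivl)
  finally show ?thesis .
qed

text \<open>By Markov's inequality a bad interval has length at most \<open>total / L\<close>, so
  scales are bounded and maximal bad intervals exist. They are disjoint and contained in the set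
  where \<open>count\<close> exceeds \<open>L\<close>.\<close>

lemma bad_maxes:
  assumes L: "0 < L" and tot: "total < top"
  shows "I \<in> bad L \<Longrightarrow> \<exists>J\<in>maxes (bad L). inside I J"
    and "nsum (maxes (bad L)) ws \<le> emeasure lborel {t. L < count t}"
    and "L * nsum (maxes (bad L)) ws \<le> total"
proof -
  have sub: "ivl I \<subseteq> {t. L < count t}" if "I \<in> bad L" for I
    using that height_le_count[of _ I] by (auto simp: bad_def intro: less_le_trans)
  have markov: "L * emeasure lborel {t. L < count t} \<le> total"
  proof -
    have "L * emeasure lborel {t. L < count t} = (\<integral>\<^sup>+t. L * indicator {t. L < count t} t \<partial>lborel)"
      by (simp add: nn_integral_cmult_indicator)
    also have "\<dots> \<le> (\<integral>\<^sup>+t. count t \<partial>lborel)"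
      by (intro nn_integral_mono) (auto simp: indicator_def)
    finally show ?thesis by (simp add: integral_count)
  qed
  have one: "L * ws I \<le> total" if "I \<in> bad L" for I
  proof -
    have "L * ws I \<le> L * emeasure lborel {t. L < count t}"
      unfolding emeasure_ivl[symmetric] using sub[OF that] by (intro mult_left_mono emeasure_mono) auto
    then show ?thesis using markov by order
  qed
  have "\<exists>b. \<forall>I\<in>bad L. snd I \<le> b"
  proof (cases "bad L = {}")
    case False
    then have "L < top" using one tot L by (auto simp: less_top[symmetric] ws_def ennreal_mult_eq_top_iff ennreal_top_mult top_unique)
    then obtain l c where l: "L = ennreal l" "0 < l" and c: "total = ennreal c" "0 \<le> c"
      using L tot by (cases L rule: ennreal_cases; cases total rule: ennreal_cases) auto
    have "snd I \<le> \<lceil>log 2 ((c + 1) / l)\<rceil>" if "I \<in> bad L" for I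
    proof -
      have "l * 2 powr real_of_int (snd I) \<le> c" using one[OF that] l c by (simp add: ws_def ennreal_mult[symmetric])
      then have "2 powr real_of_int (snd I) \<le> (c + 1) / l" using l by (simp add: field_simps)
      then have "real_of_int (snd I) \<le> log 2 ((c + 1) / l)" using l c by (simp add: le_log_iff)
      then show ?thesis by linarith
    qed
    then show ?thesis by blast
  qed auto
  then obtain b where b: "\<And>I. I \<in> bad L \<Longrightarrow> snd I \<le> b" by blast
  show "I \<in> bad L \<Longrightarrow> \<exists>J\<in>maxes (bad L). inside I J" using maxes_above[of "bad L" b] b by metis
  have "nsum (maxes (bad L)) ws = nsum (maxes (bad L)) (\<lambda>I. emeasure lborel (ivl I))" by (simp add: emeasure_ivl)
  also have "\<dots> = emeasure lborel (\<Union>I\<in>maxes (bad L). ivl I)"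
    using maxes_disj[of "bad L"] by (intro emeasure_UN_countable[symmetric]) (auto simp: disj_def)
  also have "\<dots> \<le> emeasure lborel {t. L < count t}"
    using sub by (intro emeasure_mono) (auto simp: maxes_def)
  finally show *: "nsum (maxes (bad L)) ws \<le> emeasure lborel {t. L < count t}" .
  show "L * nsum (maxes (bad L)) ws \<le> total"
    using mult_left_mono[OF *, of L] markov by (auto intro: order_trans)
qed

end


section \<open>Selection of trees and of strips\<close>

lemma nsum_disjoint_Un:
  assumes "A \<inter> B = {}"
  shows "nsum (A \<union> B) f = nsum A f + nsum B f"
proof -
  have "nsum (A \<union> B) f = (\<integral>\<^sup>+x. f x * indicator A x + f x * indicator B x \<partial>count_space UNIV)"
    unfolding nsum_ind[of "A \<union> B"] using assms
    by (intro nn_integral_cong) (auto simp: indicator_def)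
  also have "\<dots> = nsum A f + nsum B f"
    unfolding nsum_ind[of A] nsum_ind[of B] by (rule nn_integral_add) auto
  finally show ?thesis .
qed

text \<open>While some tree carries more than its weight, take it and delete its tiles. Each tree is
  paid for by the tiles that it deletes, and no tile pays twice; finiteness of \<open>F\<close> ends
  the process.\<close>

lemma greedy_trees:
  assumes r: "0 < r" and F: "finite F"
  shows "\<exists>G. (\<forall>T. psum r (cut x (F \<inter> (treeT T - \<Union>(treeT ` G)))) \<le> wt T) \<and>
    nsum G wt \<le> nsum (F \<inter> \<Union>(treeT ` G)) (\<lambda>P. epow (x P) r)"
  using F
proof (induction "card F" arbitrary: F rule: less_induct)
  case less
  show ?case
  proof (cases "\<forall>T. psum r (cut x (F \<inter> treeT T)) \<le> wt T")
    case True
    then show ?thesis by (intro exI[of _ "{}"]) auto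
  next
    case False
    then obtain T where T: "wt T < psum r (cut x (F \<inter> treeT T))" by (auto simp: not_le)
    have "F \<inter> treeT T \<noteq> {}"
    proof
      assume "F \<inter> treeT T = {}"
      then have "psum r (cut x (F \<inter> treeT T)) = 0" by (simp add: psum_def)
      with T show False by simp
    qed
    then have "card (F - treeT T) < card F" using less.prems by (intro psubset_card_mono) auto
    from less.hyps[OF this] less.prems obtain G where
      G: "\<And>S. psum r (cut x ((F - treeT T) \<inter> (treeT S - \<Union>(treeT ` G)))) \<le> wt S"
      "nsum G wt \<le> nsum ((F - treeT T) \<inter> \<Union>(treeT ` G)) (\<lambda>P. epow (x P) r)" by auto
    show ?thesis
    proof (intro exI[of _ "insert T G"] conjI allI)
      fix S
      have "F \<inter> (treeT S - \<Union>(treeT ` insert T G)) = (F - treeT T) \<inter> (treeT S - \<Union>(treeT ` G))" by auto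
      then show "psum r (cut x (F \<inter> (treeT S - \<Union>(treeT ` insert T G)))) \<le> wt S" using G(1)[of S] by simp
    next
      have "nsum (insert T G) wt \<le> nsum {T} wt + nsum G wt" using nsum_Un_le[of "{T}" G wt] by simp
      also have "nsum {T} wt = wt T" by (simp add: nn_integral_count_space_finite)
      also have "wt T + nsum G wt \<le> nsum (F \<inter> treeT T) (\<lambda>P. epow (x P) r) + nsum ((F - treeT T) \<inter> \<Union>(treeT ` G)) (\<lambda>P. epow (x P) r)"
        using T G(2) r by (intro add_mono) (auto simp: psum_cut)
      also have "\<dots> = nsum ((F \<inter> treeT T) \<union> ((F - treeT T) \<inter> \<Union>(treeT ` G))) (\<lambda>P. epow (x P) r)"
        by (rule nsum_disjoint_Un[symmetric]) auto
      also have "(F \<inter> treeT T) \<union> ((F - treeT T) \<inter> \<Union>(treeT ` G)) = F \<inter> \<Union>(treeT ` insert T G)" by auto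
      finally show "nsum (insert T G) wt \<le> nsum (F \<inter> \<Union>(treeT ` insert T G)) (\<lambda>P. epow (x P) r)" .
    qed
  qed
qed

text \<open>On the selected trees \<open>epow (y P) (conj_exp r)\<close> and
  \<open>x P * y P\<close> both equal \<open>epow (x P) r\<close>. So dual sizes of \<open>y\<close>
  are bounded by sizes of \<open>x\<close>, and the pairing contains the mass that paid for the
  trees.\<close>

lemma trees_select:
  assumes r: "1 < r"
  shows "TR.selects r (psum r) (psum (conj_exp r)) 1 (2 powr r)"
  unfolding TR.selects_def
proof (intro allI impI)
  fix x :: "tidx \<Rightarrow> ennreal"
  assume x: "fsup x" and bd: "\<forall>T. psum r (cut x (treeT T)) \<le> ennreal (2 powr r) * wt T"
  have r0: "0 < r" using r by simp
  define F where "F = {P. x P \<noteq> 0}"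
  have "finite F" using x by (simp add: F_def fsup_def)
  from greedy_trees[OF r0 this, of x] obtain G where
    G: "\<And>T. psum r (cut x (F \<inter> (treeT T - \<Union>(treeT ` G)))) \<le> wt T"
    "nsum G wt \<le> nsum (F \<inter> \<Union>(treeT ` G)) (\<lambda>P. epow (x P) r)" by blast
  have Fcut: "cut x (F \<inter> A) = cut x A" for A by (rule ext) (auto simp: cut_def F_def indicator_def)
  define y where "y P = epow (x P) (r - 1) * indicator (\<Union>(treeT ` G)) P" for P
  have e: "epow (epow a (r - 1)) (conj_exp r) = epow a r" for a
    using conj_exp_props(3)[OF r] by (simp add: epow_epow)
  have e2: "a * epow a (r - 1) = epow a r" for a using epow_add[of 1 "r - 1" a] r by simp
  show "\<exists>G y. (\<forall>P. y P \<noteq> 0 \<longrightarrow> x P \<noteq> 0 \<and> P \<in> \<Union>(treeT ` G)) \<and> (\<forall>P. y P < top) \<and>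
       TR.clears r (psum r) x 1 G \<and> (\<forall>T. psum (conj_exp r) (cut y (treeT T)) \<le> ennreal (2 powr r) * wt T) \<and>
       ennreal 1 * nsum G wt \<le> pairing x y"
  proof (intro exI[of _ G] exI[of _ y] conjI allI impI)
    fix P
    show "y P \<noteq> 0 \<Longrightarrow> x P \<noteq> 0" "y P \<noteq> 0 \<Longrightarrow> P \<in> \<Union>(treeT ` G)"
      by (auto simp: y_def indicator_def split: if_splits)
    have "x P < top" using x unfolding fsup_def by blast
    then show "y P < top" by (simp add: y_def indicator_def)
  next
    show "TR.clears r (psum r) x 1 G" unfolding TR.clears_def using G(1) by (simp add: Fcut)
  next
    fix T
    have "psum (conj_exp r) (cut y (treeT T)) = nsum (treeT T) (\<lambda>P. epow (y P) (conj_exp r))"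
      using conj_exp_props[OF r] by (intro psum_cut) auto
    also have "\<dots> \<le> nsum (treeT T) (\<lambda>P. epow (x P) r)"
      by (intro nn_integral_mono) (auto simp: y_def indicator_def e)
    also have "\<dots> = psum r (cut x (treeT T))" using r0 by (rule psum_cut[symmetric])
    also have "\<dots> \<le> ennreal (2 powr r) * wt T" using bd by blast
    finally show "psum (conj_exp r) (cut y (treeT T)) \<le> ennreal (2 powr r) * wt T" .
  next
    have "nsum G wt \<le> nsum UNIV (\<lambda>P. epow (x P) r * indicator (F \<inter> \<Union>(treeT ` G)) P)"
      using G(2) by (simp add: nsum_ind[symmetric])
    also have "\<dots> \<le> pairing x y"
      unfolding pairing_def
      by (intro nn_integral_mono) (auto simp: y_def indicator_def e2)
    finally show "ennreal 1 * nsum G wt \<le> pairing x y" by simp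
  qed
qed

section \<open>The tree-level and the strip-level functional\<close>

definition treeN :: "real \<Rightarrow> real \<Rightarrow> (tidx \<Rightarrow> ennreal) \<Rightarrow> ennreal" where
  "treeN r q = TR.out r (psum r) q"

text \<open>Exponents run from the inside out, opposite to \<open>Lp_mu p q r\<close>, and roots are
  omitted: this is a \<open>p\<close>-th power, as \<open>treeN r q\<close> is a \<open>q\<close>-th
  power.\<close>

definition stripL :: "real \<Rightarrow> real \<Rightarrow> real \<Rightarrow> (tidx \<Rightarrow> ennreal) \<Rightarrow> ennreal" where
  "stripL r q p = ST.out q (treeN r q) p"

lemma treeN_good: "0 < r \<Longrightarrow> 0 < q \<Longrightarrow> good q (treeN r q)"
  unfolding treeN_def by (intro TR.out_good psum_good)

lemma stripL_good: "0 < r \<Longrightarrow> 0 < q \<Longrightarrow> 0 < p \<Longrightarrow> good p (stripL r q p)"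
  unfolding stripL_def by (intro ST.out_good treeN_good)

lemma treeN_dual_bound:
  assumes "1 < r" "1 < q"
  obtains K where "dual_bound (treeN r q) (treeN (conj_exp r) (conj_exp q)) K"
  using TR.dual_bound_out[OF psum_good _ psum_good _ psum_dual_bound[OF assms(1)] assms(2)] assms conj_exp_props(1)[of r]
  unfolding treeN_def by auto

lemma stripL_dual_bound:
  assumes "1 < r" "1 < q" "1 < p"
  obtains K where "dual_bound (stripL r q p) (stripL (conj_exp r) (conj_exp q) (conj_exp p)) K"
proof -
  obtain K where K: "dual_bound (treeN r q) (treeN (conj_exp r) (conj_exp q)) K"
    using treeN_dual_bound assms by blast
  show ?thesis
    using ST.dual_bound_out[OF treeN_good _ treeN_good _ K assms(3)] assms conj_exp_props(1)[of r] conj_exp_props(1)[of q] that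
    unfolding stripL_def by auto
qed

text \<open>Selections at all levels become one family indexed by pairs, with weight
  \<open>a i\<close> where the generator was selected at level \<open>i\<close> and zero elsewhere,
  the form that \<open>tree_family\<close> takes.\<close>

lemma nsum_pairs:
  fixes G :: "'i::countable \<Rightarrow> 'g::countable set"
  shows "nsum UNIV (\<lambda>j. a (fst j) * indicator (G (fst j)) (snd j) * v (snd j)) = nsum UNIV (\<lambda>i. a i * nsum (G i) v)"
proof -
  have "nsum UNIV (\<lambda>j. a (fst j) * indicator (G (fst j)) (snd j) * v (snd j))
    = nsum UNIV (\<lambda>i. nsum UNIV (\<lambda>g. a i * indicator (G i) g * v g))"
    by (subst nn_integral_fst_count_space[symmetric]) simp
  also have "\<dots> = nsum UNIV (\<lambda>i. a i * nsum (G i) v)"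
  proof (intro nn_integral_cong)
    fix i
    have "nsum UNIV (\<lambda>g. a i * indicator (G i) g * v g) = nsum UNIV (\<lambda>g. a i * (v g * indicator (G i) g))"
      by (intro nn_integral_cong) (simp add: ac_simps)
    also have "\<dots> = a i * nsum (G i) v" unfolding nsum_ind[of "G i"] by (rule nn_integral_cmult) simp
    finally show "nsum UNIV (\<lambda>g. a i * indicator (G i) g * v g) = a i * nsum (G i) v" .
  qed
  finally show ?thesis .
qed

lemma tree_partner:
  assumes r: "1 < r" and q: "1 < q"
  shows "\<exists>D>0. \<forall>x. fsup x \<longrightarrow>
    (\<exists>a G y. TR.partner D 1 (treeN r q) (treeN (conj_exp r) (conj_exp q)) x a G y)"
  unfolding treeN_def using r q conj_exp_props(1)[OF r]
  by (intro TR.dual_partner[OF trees_select[OF r]] psum_good) auto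

lemma strip_level_bound:
  assumes "B < top" "\<And>I. I \<in> V \<Longrightarrow> ws I \<le> B"
  obtains b where "\<And>I. I \<in> V \<Longrightarrow> snd I \<le> b"
proof -
  obtain c where c: "B = ennreal c" "0 \<le> c" using assms(1) by (cases B rule: ennreal_cases) auto
  have "snd I \<le> \<lceil>log 2 (c + 1)\<rceil>" if "I \<in> V" for I
  proof -
    have "2 powr real_of_int (snd I) \<le> c + 1" using assms(2)[OF that] c by (simp add: ws_def)
    then have "real_of_int (snd I) \<le> log 2 (c + 1)" using c by (simp add: le_log_iff)
    then show ?thesis by linarith
  qed
  then show ?thesis using that by blast
qed

text \<open>The partner of the part of \<open>x\<close> above the stopping strips is removed from the strips on which too many
  trees pile up; Young's inequality shows that this loses at most half of the pairing, and what remains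
  satisfies the Carleson condition on every strip.\<close>

lemma strips_select:
  assumes r: "1 < r" and q: "1 < q"
  obtains c C where "0 < c" "0 < C"
    "ST.selects q (treeN r q) (treeN (conj_exp r) (conj_exp q)) c C"
proof -
  have r0: "0 < r" "0 < q" and r': "0 < conj_exp r" and q': "0 < conj_exp q"
    using r q conj_exp_props(1) by auto
  note gN = treeN_good[OF r0] and gN' = treeN_good[OF r' q']
  from tree_partner[OF r q] obtain D where D: "0 < D" and
    part: "\<And>x. fsup x \<Longrightarrow> \<exists>a G y. TR.partner D 1 (treeN r q) (treeN (conj_exp r) (conj_exp q)) x a G y"
    by blast
  obtain K where K: "dual_bound (treeN r q) (treeN (conj_exp r) (conj_exp q)) K"
    using treeN_dual_bound r q by blast
  have K0: "0 < K" using K by (simp add: dual_bound_def)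
  \<comment> \<open>The partner has dual value at most \<open>b powr conj_exp q * Q\<close>.
    \<open>A\<close> makes \<open>K * A * b = 1 / 4\<close>, which bounds the loss by
    \<open>Q / 2\<close>. The height \<open>lam\<close> solves
    \<open>lam * A powr q = 2 powr q\<close>: bad strips have total weight at most
    \<open>Q / lam\<close> and sizes at most 2, so they carry at most
    \<open>A powr q * Q\<close>.\<close>
  define b where "b = D powr (1 / conj_exp q)"
  define A where "A = 1 / (4 * K * b)"
  define lam where "lam = (2 / A) powr q"
  have b: "0 < b" "b powr conj_exp q = D" using D q' by (auto simp: b_def powr_powr)
  have A: "0 < A" using K0 b by (simp add: A_def)
  have lam: "0 < lam" using A by (simp add: lam_def)
  have lamA: "lam * A powr q = 2 powr q" using A by (simp add: lam_def powr_mult[symmetric])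
  show ?thesis
  proof (rule that[of "1 / (2 * D)" "D * lam"])
    show "0 < 1 / (2 * D)" "0 < D * lam" using D lam by auto
    show "ST.selects q (treeN r q) (treeN (conj_exp r) (conj_exp q)) (1 / (2 * D)) (D * lam)"
      unfolding ST.selects_def
    proof (intro allI impI)
      fix x assume x: "fsup x" and bd: "\<forall>I. treeN r q (cut x (stripT I)) \<le> ennreal (2 powr q) * ws I"
      \<comment> \<open>Stopping strips, those of size above the target level 1. Their weights are
        bounded by the finite value of the functional at \<open>x\<close>, so maximal ones
        exist.\<close>
      define V where "V = {I. ws I < treeN r q (cut x (stripT I))}"
      define G where "G = maxes V"
      have le: "ws I \<le> treeN r q x" if "I \<in> V" for I
      proof -
        have "ws I \<le> treeN r q (cut x (stripT I))" using that by (simp add: V_def)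
        also have "\<dots> \<le> treeN r q x" by (intro good_mono[OF gN] cut_le)
        finally show ?thesis .
      qed
      obtain bb where bb: "\<And>I. I \<in> V \<Longrightarrow> snd I \<le> bb"
        using strip_level_bound[OF good_fsup[OF gN x] le] by blast
      define U where "U = \<Union>(stripT ` G)"
      have VU: "stripT I \<subseteq> U" if "I \<in> V" for I
      proof -
        obtain J where "J \<in> G" "inside I J" unfolding G_def by (rule maxes_above[OF bb \<open>I \<in> V\<close>])
        then show ?thesis by (auto simp: U_def stripT_def intro: inside_trans)
      qed
      define z where "z = cut x U"
      have "fsup z" unfolding z_def by (rule fsup_cut[OF x])
      from part[OF this] obtain a Gn y where
        P: "TR.partner D 1 (treeN r q) (treeN (conj_exp r) (conj_exp q)) z a Gn y" by blast
      note y = TR.partnerD(1,2)[OF P] and Qfin = TR.partnerD(3)[OF P] and NQ = TR.partnerD(4)[OF P]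
        and Qp = TR.partnerD(5)[OF P] and N' = TR.partnerD(6)[OF P]
      define Q where "Q = (\<Sum>n. ennreal (a n) * nsum (Gn n) wt)"
      interpret F: tree_family "\<lambda>j. ennreal (a (fst j)) * indicator (Gn (fst j)) (snd j)" "snd :: nat \<times> tidx \<Rightarrow> tidx" .
      have tot: "F.total = Q"
        unfolding F.total_def Q_def
        using nsum_pairs[of "\<lambda>n. ennreal (a n)" Gn wt] by (simp add: nn_integral_count_space_nat)
      have F_fin: "F.total < top" using Qfin tot by (simp add: Q_def)
      have lam0: "0 < ennreal lam" using lam by simp
      define W where "W = F.bad_tiles (ennreal lam)"
      define M where "M = maxes (F.bad (ennreal lam))"
      note bm = F.bad_maxes[OF lam0 F_fin]
      have WM: "\<exists>J\<in>M. P \<in> stripT J" if "P \<in> W" for P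
      proof -
        obtain I where I: "I \<in> F.bad (ennreal lam)" "P \<in> stripT I" using \<open>P \<in> W\<close> unfolding W_def F.bad_tiles_def by blast
        obtain J where "J \<in> M" "inside I J" using bm(1)[OF I(1)] by (auto simp: M_def)
        then show ?thesis using I(2) by (auto simp: stripT_def intro: inside_trans)
      qed
      have NW: "treeN r q (cut z W) \<le> ennreal (A powr q) * Q"
      proof -
        have "treeN r q (cut z W) \<le> nsum M (\<lambda>I. treeN r q (cut (cut z W) (stripT I)))"
          unfolding treeN_def
        proof (rule out_le_strips[OF _ r0])
          show "disj M" unfolding M_def by (rule maxes_disj)
          fix P assume "cut z W P \<noteq> 0"
          then have "P \<in> W" by (auto simp: cut_def indicator_def split: if_splits)
          then show "\<exists>I\<in>M. P \<in> stripT I" by (rule WM)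
        qed
        also have "\<dots> \<le> nsum M (\<lambda>I. ennreal (2 powr q) * ws I)"
        proof (intro nn_integral_mono)
          fix I
          have "treeN r q (cut (cut z W) (stripT I)) \<le> treeN r q (cut x (stripT I))"
            by (intro good_mono[OF gN]) (auto simp: z_def cut_def indicator_def)
          also have "\<dots> \<le> ennreal (2 powr q) * ws I" using bd by blast
          finally show "treeN r q (cut (cut z W) (stripT I)) \<le> ennreal (2 powr q) * ws I" .
        qed
        also have "\<dots> = ennreal (A powr q) * (ennreal lam * nsum M ws)"
        proof -
          have *: "nsum M (\<lambda>I. ennreal (2 powr q) * ws I) = ennreal (2 powr q) * nsum M ws"
            by (rule nn_integral_cmult) simp
          have e: "ennreal (2 powr q) = ennreal (A powr q) * ennreal lam"
            using lam by (simp add: lamA[symmetric] ennreal_mult[symmetric] mult.commute)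
          show ?thesis by (rule trans[OF *]) (simp only: e mult.assoc)
        qed
        also have "\<dots> \<le> ennreal (A powr q) * Q"
          using bm(3) unfolding M_def tot by (intro mult_left_mono) auto
        finally show ?thesis .
      qed
      have Ny: "treeN (conj_exp r) (conj_exp q) y \<le> ennreal (b powr conj_exp q) * Q"
        using TR.partner_UNIV[OF P] b by (simp add: Q_def)
      have loss: "pairing (cut z W) y \<le> ennreal (1/2) * Q"
      proof -
        have "pairing (cut z W) y \<le> ennreal (K * A * b) * (Q + Q)"
          using dual_bound_scaled[OF K gN gN' A b(1), of "cut z W" Q y Q] NW Ny by blast
        also have "K * A * b = 1 / 4" using K0 b(1) by (simp add: A_def)
        also have "ennreal (1 / 4) * (Q + Q) = ennreal (1 / 2) * Q"
        proof -
          have "Q + Q = ennreal 2 * Q" by (simp add: mult_2)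
          then show ?thesis by (simp only: mult.assoc[symmetric] ennreal_mult[symmetric]) simp
        qed
        finally show ?thesis .
      qed
      define y' where "y' = cut y (- W)"
      have half: "ennreal (1/2) * Q \<le> pairing x y'"
      proof -
        have "Q \<le> pairing z y" using Qp by (simp add: Q_def)
        also have "\<dots> = pairing z y' + pairing (cut z W) y"
          unfolding pairing_def
          by (subst nn_integral_add[symmetric]) (auto simp: y'_def cut_def indicator_def intro!: nn_integral_cong)
        also have "\<dots> \<le> pairing x y' + ennreal (1/2) * Q"
          by (intro add_mono loss pairing_mono) (auto simp: z_def cut_le)
        finally have "Q \<le> pairing x y' + ennreal (1/2) * Q" .
        moreover have "Q = ennreal (1/2) * Q + ennreal (1/2) * Q"
          by (simp only: distrib_right[symmetric] ennreal_plus[symmetric]) simp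
        ultimately have "ennreal (1/2) * Q + ennreal (1/2) * Q \<le> ennreal (1/2) * Q + pairing x y'"
          by (metis add.commute)
        moreover have "ennreal (1/2) * Q < top"
          using Qfin[folded Q_def] ennreal_less_top[of "1/2"] unfolding ennreal_mult_less_top by blast
        ultimately show ?thesis unfolding ennreal_add_left_cancel_le by (metis infinity_ennreal_def less_irrefl)
      qed
      show "\<exists>G y. (\<forall>P. y P \<noteq> 0 \<longrightarrow> x P \<noteq> 0 \<and> P \<in> \<Union>(stripT ` G)) \<and> (\<forall>P. y P < top) \<and>
         ST.clears q (treeN r q) x 1 G \<and>
         (\<forall>I. treeN (conj_exp r) (conj_exp q) (cut y (stripT I)) \<le> ennreal (D * lam) * ws I) \<and>
         ennreal (1 / (2 * D)) * nsum G ws \<le> pairing x y"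
      proof (intro exI[of _ G] exI[of _ y'] conjI allI impI)
        fix P
        have "y' P \<noteq> 0 \<Longrightarrow> z P \<noteq> 0" using y(1)[of P] by (auto simp: y'_def cut_def)
        then show "y' P \<noteq> 0 \<Longrightarrow> x P \<noteq> 0" "y' P \<noteq> 0 \<Longrightarrow> P \<in> \<Union>(stripT ` G)"
          by (auto simp: z_def cut_def U_def indicator_def split: if_splits)
        show "y' P < top" using cut_le[of y "- W" P] y(2)[of P] by (simp add: y'_def)
      next
        show "ST.clears q (treeN r q) x 1 G"
          unfolding ST.clears_def
        proof
          fix I
          show "treeN r q (cut x (stripT I - \<Union>(stripT ` G))) \<le> ennreal (1 powr q) * ws I"
          proof (cases "I \<in> V")
            case True
            then have "stripT I - \<Union>(stripT ` G) = {}" using VU by (auto simp: U_def)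
            then show ?thesis by (simp only: cut_empty good_zero[OF gN]) simp
          next
            case False
            have "treeN r q (cut x (stripT I - \<Union>(stripT ` G))) \<le> treeN r q (cut x (stripT I))"
              by (intro good_cut_mono[OF gN]) auto
            also have "\<dots> \<le> ws I" using False by (simp add: V_def not_less)
            finally show ?thesis by simp
          qed
        qed
      next
        fix I
        \<comment> \<open>The local clause of \<open>partner\<close> is used with
          \<open>Z = stripT I - W\<close>: the trimmed trees cover the traces, and their weighted
          total is at most \<open>lam * ws I\<close>.\<close>
        have "treeN (conj_exp r) (conj_exp q) (cut y' (stripT I)) = treeN (conj_exp r) (conj_exp q) (cut y (stripT I - W))"
          unfolding y'_def cut_cut by (simp add: Diff_eq Int_commute)
        also have "\<dots> \<le> ennreal D * (\<Sum>n. ennreal (a n) * nsum (Gn n) (\<lambda>g. nsum (F.trim (ennreal lam) I g) wt))"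
          using F.trim_cover by (intro N') (simp add: W_def)
        also have "(\<Sum>n. ennreal (a n) * nsum (Gn n) (\<lambda>g. nsum (F.trim (ennreal lam) I g) wt)) \<le> ennreal lam * ws I"
          using F.trim_total[of "ennreal lam" I] nsum_pairs[of "\<lambda>n. ennreal (a n)" Gn "\<lambda>g. nsum (F.trim (ennreal lam) I g) wt"]
          by (simp add: nn_integral_count_space_nat)
        finally show "treeN (conj_exp r) (conj_exp q) (cut y' (stripT I)) \<le> ennreal (D * lam) * ws I"
          using D lam by (simp add: ennreal_mult mult.assoc mult_left_mono)
      next
        \<comment> \<open>On each stopping strip \<open>z\<close> has more than the weight of the
          strip, and additivity over disjoint strips bounds the sum by \<open>treeN r q z\<close>.
          Comparing \<open>D * Q\<close> with a pairing of at least \<open>Q / 2\<close> explains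
          \<open>1 / (2 * D)\<close>.\<close>
        have "nsum G ws \<le> nsum G (\<lambda>I. treeN r q (cut z (stripT I)))"
        proof (intro nn_integral_mono)
          fix I assume "I \<in> space (count_space G)"
          then have I: "I \<in> G" by simp
          then have "cut z (stripT I) = cut x (stripT I)"
            unfolding z_def cut_cut by (auto simp: U_def intro!: arg_cong2[where f = cut])
          moreover have "ws I < treeN r q (cut x (stripT I))" using I by (simp add: G_def maxes_def V_def)
          ultimately show "ws I \<le> treeN r q (cut z (stripT I))" by simp
        qed
        also have "\<dots> \<le> treeN r q z"
          unfolding treeN_def G_def by (intro strips_le_out maxes_disj r0)
        also have "\<dots> \<le> ennreal D * Q" using NQ by (simp add: Q_def)
        finally have "ennreal (1 / (2 * D)) * nsum G ws \<le> ennreal (1 / (2 * D)) * (ennreal D * Q)"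
          by (intro mult_left_mono) auto
        also have "\<dots> = ennreal (1/2) * Q" using D by (simp add: mult.assoc[symmetric] ennreal_mult[symmetric])
        also note half
        finally show "ennreal (1 / (2 * D)) * nsum G ws \<le> pairing x y'" .
      qed
    qed
  qed
qed

section \<open>Duality on tile sequences\<close>

text \<open>The scaling levels are the two norms themselves, with \<open>W = W' = 1\<close>. If one
  functional vanishes, definiteness makes the sequence zero, which settles products of the form
  \<open>0 * top\<close>.\<close>

lemma norm_bound:
  assumes \<Phi>: "good p \<Phi>" and \<Psi>: "good p' \<Psi>" and p: "0 < p" "0 < p'" and K: "dual_bound \<Phi> \<Psi> K"
  shows "pairing x y \<le> ennreal (2 * K) * (epow (\<Phi> x) (1 / p) * epow (\<Psi> y) (1 / p'))"
proof (cases "\<Phi> x = 0 \<or> \<Psi> y = 0")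
  case True
  then have "x = (\<lambda>P. 0) \<or> y = (\<lambda>P. 0)" using good_definite[OF \<Phi>] good_definite[OF \<Psi>] by blast
  then show ?thesis by (auto simp: pairing_def)
next
  case nz: False
  have K0: "0 < K" using K by (simp add: dual_bound_def)
  show ?thesis
  proof (cases "\<Phi> x = top \<or> \<Psi> y = top")
    case True
    then show ?thesis using nz K0 by (auto simp: ennreal_mult_top ennreal_top_mult)
  next
    case False
    then obtain a b where a: "\<Phi> x = ennreal a" "0 < a" and b: "\<Psi> y = ennreal b" "0 < b"
      using nz by (cases "\<Phi> x" rule: ennreal_cases; cases "\<Psi> y" rule: ennreal_cases) (auto simp: less_le)
    have "pairing x y \<le> ennreal (K * a powr (1 / p) * b powr (1 / p')) * (1 + 1)"
      using a b p by (intro dual_bound_scaled[OF K \<Phi> \<Psi>]) (auto simp: powr_powr)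
    also have "\<dots> = ennreal (K * a powr (1 / p) * b powr (1 / p') * 2)"
      using K0 by (simp add: ennreal_mult')
    also have "\<dots> = ennreal (2 * K) * (epow (\<Phi> x) (1 / p) * epow (\<Psi> y) (1 / p'))"
      using a b K0 by (simp add: epow_ennreal ennreal_mult[symmetric] ac_simps)
    finally show ?thesis .
  qed
qed

definition trunc :: "nat \<Rightarrow> tidx set" where
  "trunc n = {P. to_nat P \<le> n}"

lemma fsup_trunc:
  assumes "\<And>P. x P < top"
  shows "fsup (cut x (trunc n))"
  unfolding fsup_def
proof
  have "finite (trunc n)"
  proof (rule inj_on_finite)
    show "inj_on to_nat (trunc n)" by (rule inj_on_subset[OF inj_to_nat]) simp
    show "to_nat ` trunc n \<subseteq> {..n}" by (auto simp: trunc_def)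
  qed simp
  then show "finite {P. cut x (trunc n) P \<noteq> 0}"
    by (rule rev_finite_subset) (auto simp: cut_def indicator_def)
  show "\<forall>P. cut x (trunc n) P < top"
  proof
    fix P show "cut x (trunc n) P < top" using cut_le[of x "trunc n" P] assms[of P] by order
  qed
qed

lemma good_le_trunc:
  assumes \<Phi>: "good p \<Phi>" and le: "\<And>n. \<Phi> (cut x (trunc n)) \<le> B"
  shows "\<Phi> x \<le> B"
proof -
  have "x P \<le> liminf (\<lambda>n. cut x (trunc n) P)" for P
  proof (rule Liminf_bounded)
    show "\<forall>\<^sub>F n in sequentially. x P \<le> cut x (trunc n) P"
      using eventually_ge_at_top[of "to_nat P"] by eventually_elim (simp add: cut_def trunc_def)
  qed
  then have "\<Phi> x \<le> liminf (\<lambda>n. \<Phi> (cut x (trunc n)))" by (rule good_liminf[OF \<Phi>])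
  also have "\<dots> \<le> B" using le by (intro Liminf_le always_eventually) auto
  finally show ?thesis .
qed

text \<open>The partner of a truncation of \<open>x\<close>, scaled so that its dual value is at
  most one, is an admissible test sequence; the Fatou property then removes the truncation.\<close>

theorem stripL_le_dual:
  assumes r: "1 < r" and q: "1 < q" and p: "1 < p"
  shows "\<exists>C>0. \<forall>x s. (\<forall>P. x P < top) \<longrightarrow>
    (\<forall>y. fsup y \<longrightarrow> stripL (conj_exp r) (conj_exp q) (conj_exp p) y \<le> 1 \<longrightarrow> pairing x y \<le> s) \<longrightarrow>
    stripL r q p x \<le> ennreal C * epow s p"
proof -
  have r0: "0 < r" "0 < q" "0 < p" and r': "0 < conj_exp r" "0 < conj_exp q" and p': "0 < conj_exp p"
    using r q p conj_exp_props(1) by auto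
  let ?L = "stripL r q p" and ?L' = "stripL (conj_exp r) (conj_exp q) (conj_exp p)"
  note gL = stripL_good[OF r0] and gL' = stripL_good[OF r' p']
  obtain c C where c: "0 < c" and C: "0 < C" and sel: "ST.selects q (treeN r q) (treeN (conj_exp r) (conj_exp q)) c C"
    using strips_select[OF r q] by metis
  from ST.dual_partner[OF sel c C treeN_good[OF r0(1,2)] r0(2) treeN_good[OF r'] r'(2) p]
  obtain D where D: "0 < D" and part: "\<And>x. fsup x \<Longrightarrow> \<exists>a G y. ST.partner D c ?L ?L' x a G y"
    unfolding stripL_def by blast
  \<comment> \<open>The scaled partner gives \<open>k * c * Q \<le> s\<close> with
    \<open>k = (D * Q) powr (- (1 / conj_exp p))\<close>, that is,
    \<open>Q powr (1 / p) \<le> D powr (1 / conj_exp p) / c * s\<close>. Its \<open>p\<close>-th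
    power times \<open>D\<close> yields this constant.\<close>
  define E where "E = D * (D powr (1 / conj_exp p) / c) powr p"
  have E: "0 < E" using D c by (simp add: E_def)
  show ?thesis
  proof (intro exI[of _ E] conjI allI impI E)
    fix x s assume fin: "\<forall>P. x P < top" and s: "\<forall>y. fsup y \<longrightarrow> ?L' y \<le> 1 \<longrightarrow> pairing x y \<le> s"
    show "?L x \<le> ennreal E * epow s p"
    proof (rule good_le_trunc[OF gL])
      fix n
      let ?x = "cut x (trunc n)"
      have fx: "fsup ?x" using fin by (intro fsup_trunc) auto
      from part[OF this] obtain a G y where P: "ST.partner D c ?L ?L' ?x a G y" by blast
      note y = ST.partnerD(1,2)[OF P] and Qfin = ST.partnerD(3)[OF P] and LQ = ST.partnerD(4)[OF P]
        and Qp = ST.partnerD(5)[OF P]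
      define Q where "Q = (\<Sum>n. ennreal (a n) * nsum (G n) ws)"
      have L'Q: "?L' y \<le> ennreal D * Q"
        using ST.partner_UNIV[OF P] by (simp add: Q_def)
      have fy: "fsup y" using fx y unfolding fsup_def by (auto elim!: rev_finite_subset)
      show "?L ?x \<le> ennreal E * epow s p"
      proof (cases "Q = 0 \<or> s = top")
        case True
        then show ?thesis using LQ E by (auto simp: Q_def ennreal_mult_top)
      next
        case False
        then obtain \<rho> t where \<rho>: "Q = ennreal \<rho>" "0 < \<rho>" and t: "s = ennreal t" "0 \<le> t"
          using Qfin unfolding Q_def[symmetric]
          by (cases Q rule: ennreal_cases; cases s rule: ennreal_cases) (auto simp: less_le)
        define k where "k = (D * \<rho>) powr (- (1 / conj_exp p))"
        have k: "0 < k" using D \<rho> by (simp add: k_def)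
        have "?L' (\<lambda>P. ennreal k * y P) = ennreal (k powr conj_exp p) * ?L' y" by (rule good_scale[OF gL' k])
        also have "\<dots> \<le> ennreal (k powr conj_exp p) * (ennreal D * Q)" by (intro mult_left_mono L'Q) simp
        also have "\<dots> = 1"
        proof -
          have "k powr conj_exp p = 1 / (D * \<rho>)"
            unfolding k_def powr_powr using D \<rho> p' by (simp add: powr_minus_divide)
          then show ?thesis using D \<rho> by (simp add: ennreal_mult[symmetric])
        qed
        finally have "pairing x (\<lambda>P. ennreal k * y P) \<le> s" using s fsup_scale[OF fy] by blast
        moreover have "pairing x (\<lambda>P. ennreal k * y P) = ennreal k * pairing x y"
          using pairing_scale[of 1 x k y] by simp
        moreover have "ennreal k * (ennreal c * Q) \<le> ennreal k * pairing x y"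
        proof (intro mult_left_mono)
          have "ennreal c * Q \<le> pairing ?x y" using Qp by (simp add: Q_def)
          also have "\<dots> \<le> pairing x y" by (intro pairing_mono cut_le order_refl)
          finally show "ennreal c * Q \<le> pairing x y" .
        qed simp
        ultimately have "ennreal k * (ennreal c * Q) \<le> ennreal t" using t by simp
        then have "k * c * \<rho> \<le> t" using k c \<rho> t by (simp add: ennreal_mult[symmetric] mult.assoc)
        moreover have "k * c * \<rho> = c / D powr (1 / conj_exp p) * \<rho> powr (1 / p)"
        proof -
          have "1 / p = 1 - 1 / conj_exp p" using conj_exp_props(5)[OF p] by simp
          then have "\<rho> powr (1 / p) = \<rho> / \<rho> powr (1 / conj_exp p)" using \<rho> by (simp add: powr_diff)
          then show ?thesis using D \<rho> by (simp add: k_def powr_minus powr_mult field_simps)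
        qed
        ultimately have *: "c / D powr (1 / conj_exp p) * \<rho> powr (1 / p) \<le> t" by simp
        have "\<rho> powr (1 / p) \<le> D powr (1 / conj_exp p) / c * t"
          using * c D by (simp add: field_simps)
        then have "(\<rho> powr (1 / p)) powr p \<le> (D powr (1 / conj_exp p) / c * t) powr p"
          using r0 by (intro powr_mono2) auto
        then have "\<rho> \<le> (D powr (1 / conj_exp p) / c * t) powr p"
          using \<rho> r0 by (simp add: powr_powr)
        also have "\<dots> = (D powr (1 / conj_exp p) / c) powr p * t powr p"
          by (rule powr_mult)
        finally have "\<rho> \<le> (D powr (1 / conj_exp p) / c) powr p * t powr p" .
        then have "D * \<rho> \<le> E * t powr p" using D by (simp add: E_def mult.assoc)
        then have "ennreal D * Q \<le> ennreal E * epow s p"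
          using D \<rho> t E by (simp add: epow_ennreal ennreal_mult[symmetric] ennreal_leI)
        then show ?thesis using LQ by (simp add: Q_def)
      qed
    qed
  qed
qed


section \<open>Collapsing equal exponents\<close>

text \<open>By Fubini: for fixed \<open>t\<close> the levels with
  \<open>(lam / 2) powr q < c t\<close> lie below \<open>2 * epow (c t) (1 / q)\<close>, and these
  integrate to \<open>2 powr q * c t\<close>.\<close>

lemma layer_cake_le:
  fixes c :: "real \<Rightarrow> ennreal"
  assumes [measurable]: "c \<in> borel_measurable borel" and q: "0 < q"
  shows "wint q (\<lambda>lam. emeasure lborel {t. ennreal ((lam / 2) powr q) < c t}) \<le> ennreal (2 powr q) * (\<integral>\<^sup>+t. c t \<partial>lborel)"
proof -
  define f where "f lam t = ennreal (q * lam powr (q - 1)) * (indicator {t. ennreal ((lam / 2) powr q) < c t} t * indicator {0<..} lam)"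
    for lam t :: real
  have [measurable]: "(\<lambda>(lam, t). f lam t) \<in> borel_measurable (lborel \<Otimes>\<^sub>M lborel)"
    unfolding f_def by measurable
  have "wint q (\<lambda>lam. emeasure lborel {t. ennreal ((lam / 2) powr q) < c t}) = (\<integral>\<^sup>+lam. \<integral>\<^sup>+t. f lam t \<partial>lborel \<partial>lborel)"
    unfolding wint_alt
  proof (intro nn_integral_cong)
    fix lam :: real
    have "(\<integral>\<^sup>+t. f lam t \<partial>lborel) = (\<integral>\<^sup>+t. (ennreal (q * lam powr (q - 1)) * indicator {0<..} lam) * indicator {t. ennreal ((lam / 2) powr q) < c t} t \<partial>lborel)"
      unfolding f_def by (intro nn_integral_cong) (simp add: ac_simps)
    also have "\<dots> = ennreal (q * lam powr (q - 1)) * indicator {0<..} lam * emeasure lborel {t. ennreal ((lam / 2) powr q) < c t}"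
      by (rule nn_integral_cmult_indicator) measurable
    finally show "ennreal (q * lam powr (q - 1)) * (emeasure lborel {t. ennreal ((lam / 2) powr q) < c t} * indicator {0<..} lam) = (\<integral>\<^sup>+t. f lam t \<partial>lborel)"
      by (simp add: ac_simps)
  qed
  also have "\<dots> = (\<integral>\<^sup>+t. \<integral>\<^sup>+lam. f lam t \<partial>lborel \<partial>lborel)"
    by (rule lborel_pair.Fubini') measurable
  also have "\<dots> \<le> (\<integral>\<^sup>+t. ennreal (2 powr q) * c t \<partial>lborel)"
  proof (intro nn_integral_mono)
    fix t
    show "(\<integral>\<^sup>+lam. f lam t \<partial>lborel) \<le> ennreal (2 powr q) * c t"
    proof (cases "c t" rule: ennreal_cases)
      case (real v)
      have "(\<integral>\<^sup>+lam. f lam t \<partial>lborel) = wint q (\<lambda>lam. indicator {t. ennreal ((lam / 2) powr q) < c t} t)"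
        unfolding f_def wint_alt ..
      also have "\<dots> \<le> wint q (\<lambda>lam. indicator {..<2 * v powr (1 / q)} lam)"
      proof (rule wint_mono)
        fix lam :: real assume lam: "0 < lam"
        show "(indicator {t. ennreal ((lam / 2) powr q) < c t} t :: ennreal) \<le> indicator {..<2 * v powr (1 / q)} lam"
        proof (cases "ennreal ((lam / 2) powr q) < c t")
          case True
          then have "(lam / 2) powr q < v" using real by (simp add: ennreal_less_iff)
          then have "((lam / 2) powr q) powr (1 / q) < v powr (1 / q)" using q by (intro powr_less_mono2) auto
          then have "lam < 2 * v powr (1 / q)" using lam q by (simp add: powr_powr)
          then show ?thesis by (simp add: indicator_def)
        qed (simp add: indicator_def)
      qed
      also have "\<dots> = ennreal ((2 * v powr (1 / q)) powr q)" using q by (intro wint_indicator) auto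
      also have "(2 * v powr (1 / q)) powr q = 2 powr q * v" using q real by (simp add: powr_mult powr_powr)
      also have "ennreal (2 powr q * v) = ennreal (2 powr q) * c t" using real by (simp add: ennreal_mult)
      finally show ?thesis .
    next
      case top
      then show ?thesis by (simp add: ennreal_mult_top)
    qed
  qed
  also have "\<dots> = ennreal (2 powr q) * (\<integral>\<^sup>+t. c t \<partial>lborel)" by (rule nn_integral_cmult) simp
  finally show ?thesis .
qed

text \<open>Strips on which the nearly optimal trees pile up higher than \<open>(lam / 2) powr q\<close> clear \<open>x\<close> at level \<open>lam\<close>,
  and the integral of the counting function of the trees is their total weight.\<close>

lemma stripL_le_treeN:
  assumes r: "0 < r" and q: "0 < q"
  shows "\<exists>C>0. \<forall>x. stripL r q q x \<le> ennreal C * treeN r q x"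
proof -
  note g = psum_good[OF r, where 'p = tidx] and gN = treeN_good[OF r q]
  define D where "D = 1 / (1 - 2 powr - q)"
  have D: "0 < D" using q powr_less_one[of 2 "-q"] by (simp add: D_def)
  show ?thesis
  proof (intro exI[of _ "2 powr q * D"] conjI allI)
    show "0 < 2 powr q * D" using D by simp
    fix x
    show "stripL r q q x \<le> ennreal (2 powr q * D) * treeN r q x"
    proof (cases "treeN r q x = top")
      case True
      have "ennreal (2 powr q * D) \<noteq> 0" using D by simp
      then show ?thesis unfolding True by (simp add: ennreal_mult_top)
    next
      case fin: False
      show ?thesis
      proof (rule ennreal_le_epsilon)
        fix e' :: real assume e': "0 < e'"
        define e where "e = e' / 2 powr q"
        have e: "0 < e" using e' by (simp add: e_def)
        obtain G :: "int \<Rightarrow> tidx set" where G: "\<And>k. TR.clears r (psum r) x (2 powr real_of_int k) (G k)"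
          "nsum UNIV (\<lambda>k. ennreal (2 powr (q * real_of_int k)) * nsum (G k) wt) \<le> dysum 2 q (TR.super r (psum r) x) + ennreal e"
          using TR.near_family[OF g r _ e, of 2 x q] by auto
        interpret F: tree_family "\<lambda>j. ennreal (2 powr (q * real_of_int (fst j))) * indicator (G (fst j)) (snd j)" "snd :: int \<times> tidx \<Rightarrow> tidx" .
        have tot: "F.total \<le> ennreal D * treeN r q x + ennreal e"
        proof -
          have "F.total = nsum UNIV (\<lambda>k. ennreal (2 powr (q * real_of_int k)) * nsum (G k) wt)"
            unfolding F.total_def using nsum_pairs[of "\<lambda>k. ennreal (2 powr (q * real_of_int k))" G wt] .
          also have "\<dots> \<le> dysum 2 q (TR.super r (psum r) x) + ennreal e" by (rule G)
          also have "\<dots> \<le> ennreal D * treeN r q x + ennreal e"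
            unfolding treeN_def TR.out_def D_def
            by (intro add_right_mono dysum_le TR.decr_super[OF g r] q) simp
          finally show ?thesis .
        qed
        have tot_fin: "F.total < top"
          using fin tot D by (auto simp: ennreal_mult_less_top less_top[symmetric] ennreal_mult_eq_top_iff top_unique)
        have main: "ST.super q (treeN r q) x lam \<le> emeasure lborel {t. ennreal ((lam / 2) powr q) < F.count t}" if lam: "0 < lam" for lam
        proof -
          \<comment> \<open>Halving \<open>lam\<close> leaves room for the factor
            \<open>2 powr q\<close> that \<open>wint_le_dysum\<close> costs when the dyadic sum is
            turned back into the integral.\<close>
          let ?L = "ennreal ((lam / 2) powr q)"
          have L: "0 < ?L" using lam by simp
          note bm = F.bad_maxes[OF L tot_fin]
          define M where "M = maxes (F.bad ?L)"
          have WM: "F.bad_tiles ?L \<subseteq> \<Union>(stripT ` M)"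
          proof
            fix P assume "P \<in> F.bad_tiles ?L"
            then obtain I where I: "I \<in> F.bad ?L" "P \<in> stripT I" unfolding F.bad_tiles_def by blast
            obtain J where "J \<in> M" "inside I J" using bm(1)[OF I(1)] by (auto simp: M_def)
            then show "P \<in> \<Union>(stripT ` M)" using I(2) by (auto simp: stripT_def intro: inside_trans)
          qed
          have "ST.clears q (treeN r q) x lam M"
            unfolding ST.clears_def
          proof
            fix I
            let ?Z = "stripT I - F.bad_tiles ?L"
            have "treeN r q (cut x (stripT I - \<Union>(stripT ` M))) \<le> treeN r q (cut x ?Z)"
              using WM by (intro good_cut_mono[OF gN]) auto
            also have "\<dots> \<le> ennreal (2 powr q) * dysum 2 q (TR.super r (psum r) (cut x ?Z))"
              unfolding treeN_def TR.out_def by (intro wint_le_dysum TR.decr_super[OF g r] q) simp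
            also have "dysum 2 q (TR.super r (psum r) (cut x ?Z)) \<le>
              nsum UNIV (\<lambda>k. ennreal (2 powr (q * real_of_int k)) * nsum (G k) (\<lambda>T. nsum (F.trim ?L I T) wt))"
              unfolding dysum_def
            proof (intro nn_integral_mono mult_left_mono)
              fix k :: int
              \<comment> \<open>Off the bad tiles and inside the strip, the trimmed trees cover all
                that the original ones cover, so they clear the cut sequence at the same
                level.\<close>
              have "TR.clears r (psum r) (cut x ?Z) (2 powr real_of_int k) (\<Union>T\<in>G k. F.trim ?L I T)"
                unfolding TR.clears_def
              proof
                fix T
                have "psum r (cut (cut x ?Z) (treeT T - \<Union>(treeT ` (\<Union>T\<in>G k. F.trim ?L I T)))) \<le> psum r (cut x (treeT T - \<Union>(treeT ` G k)))"
                  unfolding cut_cut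
                proof (intro good_cut_mono[OF g] subsetI)
                  fix P assume P: "P \<in> ?Z \<inter> (treeT T - \<Union>(treeT ` (\<Union>T\<in>G k. F.trim ?L I T)))"
                  have "P \<notin> treeT S" if "S \<in> G k" for S
                    using F.trim_cover[of S I ?L] P that by blast
                  then show "P \<in> treeT T - \<Union>(treeT ` G k)" using P by blast
                qed
                also have "\<dots> \<le> ennreal ((2 powr real_of_int k) powr r) * wt T"
                  using G(1)[of k] unfolding TR.clears_def by (rule spec)
                finally show "psum r (cut (cut x ?Z) (treeT T - \<Union>(treeT ` (\<Union>T\<in>G k. F.trim ?L I T)))) \<le>
                  ennreal ((2 powr real_of_int k) powr r) * wt T" .
              qed
              then have "TR.super r (psum r) (cut x ?Z) (2 powr real_of_int k) \<le> nsum (\<Union>T\<in>G k. F.trim ?L I T) wt"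
                by (rule TR.super_le)
              also have "\<dots> \<le> nsum (G k) (\<lambda>T. nsum (F.trim ?L I T) wt)" by (rule nsum_UN_le) simp
              finally show "TR.super r (psum r) (cut x ?Z) (2 powr real_of_int k) \<le> nsum (G k) (\<lambda>T. nsum (F.trim ?L I T) wt)" .
            qed simp
            also have "\<dots> = nsum UNIV (\<lambda>j. ennreal (2 powr (q * real_of_int (fst j))) * indicator (G (fst j)) (snd j) * nsum (F.trim ?L I (snd j)) wt)"
              by (rule nsum_pairs[symmetric])
            also have "\<dots> \<le> ?L * ws I" by (rule F.trim_total)
            finally have "treeN r q (cut x (stripT I - \<Union>(stripT ` M))) \<le> ennreal (2 powr q) * (?L * ws I)"
              by (simp add: mult_left_mono)
            also have "\<dots> = ennreal (lam powr q) * ws I"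
            proof -
              have "2 powr q * (lam / 2) powr q = lam powr q" using lam by (simp add: powr_mult[symmetric])
              then show ?thesis by (simp add: mult.assoc[symmetric] ennreal_mult[symmetric])
            qed
            finally show "treeN r q (cut x (stripT I - \<Union>(stripT ` M))) \<le> ennreal (lam powr q) * ws I" .
          qed
          then have "ST.super q (treeN r q) x lam \<le> nsum M ws" by (rule ST.super_le)
          also have "\<dots> \<le> emeasure lborel {t. ?L < F.count t}" unfolding M_def by (rule bm(2))
          finally show ?thesis .
        qed
        have "stripL r q q x \<le> wint q (\<lambda>lam. emeasure lborel {t. ennreal ((lam / 2) powr q) < F.count t})"
          unfolding stripL_def ST.out_def by (rule wint_mono) (rule main)
        also have "\<dots> \<le> ennreal (2 powr q) * F.total"
          using layer_cake_le[OF F.count_measurable q] unfolding F.integral_count .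
        also have "\<dots> \<le> ennreal (2 powr q) * (ennreal D * treeN r q x + ennreal e)" by (intro mult_left_mono tot) simp
        also have "\<dots> = ennreal (2 powr q * D) * treeN r q x + ennreal e'"
        proof -
          have "ennreal (2 powr q) * ennreal e = ennreal e'" using e by (simp add: ennreal_mult[symmetric] e_def)
          then show ?thesis using D by (simp add: distrib_left ennreal_mult mult.assoc)
        qed
        finally show "stripL r q q x \<le> ennreal (2 powr q * D) * treeN r q x + ennreal e'" .
      qed
    qed
  qed
qed

text \<open>Pair \<open>x\<close> with its tree partner \<open>y\<close>. The opposite inequality,
  at the conjugate exponents, bounds the strip functional of \<open>y\<close> by its tree
  functional; Hoelder's inequality for strips then bounds \<open>Q\<close> by a multiple of the
  strip functional of \<open>x\<close> plus a part of \<open>Q\<close> that is absorbed.\<close>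

lemma treeN_le_stripL_gt1:
  assumes r: "1 < r" and q: "1 < q"
  shows "\<exists>C>0. \<forall>x. treeN r q x \<le> ennreal C * stripL r q q x"
proof -
  have r0: "0 < r" "0 < q" and r': "0 < conj_exp r" "0 < conj_exp q"
    using r q conj_exp_props(1) by auto
  note gN = treeN_good[OF r0] and gL = stripL_good[OF r0 r0(2)] and gL' = stripL_good[OF r' r'(2)]
  obtain D where D: "0 < D" and part: "\<And>x. fsup x \<Longrightarrow> \<exists>a G y. TR.partner D 1 (treeN r q) (treeN (conj_exp r) (conj_exp q)) x a G y"
    using tree_partner[OF r q] by blast
  obtain C1 where C1: "0 < C1" "\<And>y. stripL (conj_exp r) (conj_exp q) (conj_exp q) y \<le> ennreal C1 * treeN (conj_exp r) (conj_exp q) y"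
    using stripL_le_treeN[OF r'] by blast
  obtain K where K: "dual_bound (stripL r q q) (stripL (conj_exp r) (conj_exp q) (conj_exp q)) K"
    using stripL_dual_bound[OF r q q] by blast
  have K0: "0 < K" using K by (simp add: dual_bound_def)
  define b where "b = (C1 * D) powr (1 / conj_exp q)"
  \<comment> \<open>Then \<open>K * A * b = 1 / 2\<close>, so only half of \<open>Q\<close> appears
    on the right, and it can be absorbed because \<open>Q\<close> is finite.\<close>
  define A where "A = 1 / (2 * K * b)"
  have b: "0 < b" "b powr conj_exp q = C1 * D" using D C1 r' by (auto simp: b_def powr_powr)
  have A: "0 < A" using K0 b by (simp add: A_def)
  have fs: "treeN r q x \<le> ennreal (D * A powr - q) * stripL r q q x" if x: "fsup x" for x
  proof -
    obtain a G y where P: "TR.partner D 1 (treeN r q) (treeN (conj_exp r) (conj_exp q)) x a G y"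
      using part[OF x] by blast
    define Q where "Q = (\<Sum>n. ennreal (a n) * nsum (G n) wt)"
    have Qfin: "Q < top" using TR.partnerD(3)[OF P] by (simp add: Q_def)
    have Ly: "stripL (conj_exp r) (conj_exp q) (conj_exp q) y \<le> ennreal (b powr conj_exp q) * Q"
    proof -
      have "stripL (conj_exp r) (conj_exp q) (conj_exp q) y \<le> ennreal C1 * (ennreal D * Q)"
        using TR.partner_UNIV[OF P] by (intro order_trans[OF C1(2)] mult_left_mono) (auto simp: Q_def)
      then show ?thesis using C1 D by (simp add: b ennreal_mult mult.assoc)
    qed
    let ?X = "ennreal (A powr - q) * stripL r q q x"
    have Lx: "stripL r q q x \<le> ennreal (A powr q) * ?X"
    proof -
      have "ennreal (A powr q) * ennreal (A powr - q) = 1"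
        using A by (simp add: ennreal_mult[symmetric] powr_add[symmetric])
      then show ?thesis by (simp add: mult.assoc[symmetric])
    qed
    have "Q \<le> pairing x y" using TR.partnerD(5)[OF P] by (simp add: Q_def)
    also have "\<dots> \<le> ennreal (K * A * b) * (?X + Q)"
      using dual_bound_scaled[OF K gL gL' A b(1), of x ?X y Q] Lx Ly by blast
    also have "K * A * b = 1/2" using K0 b(1) by (simp add: A_def)
    finally have *: "Q \<le> ennreal (1/2) * (?X + Q)" .
    have "ennreal 2 * Q \<le> ennreal 2 * (ennreal (1/2) * (?X + Q))" by (intro mult_left_mono *) simp
    also have "\<dots> = ?X + Q" by (simp only: mult.assoc[symmetric] ennreal_mult[symmetric]) simp
    also have "ennreal 2 * Q = Q + Q" by (simp add: mult_2)
    finally have "Q + Q \<le> Q + ?X" by (simp add: add.commute)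
    then have QX: "Q \<le> ?X" unfolding ennreal_add_left_cancel_le using Qfin by auto
    have "treeN r q x \<le> ennreal D * Q" using TR.partnerD(4)[OF P] by (simp add: Q_def)
    also have "\<dots> \<le> ennreal D * ?X" by (intro mult_left_mono QX) simp
    finally show ?thesis using D by (simp add: ennreal_mult mult.assoc)
  qed
  have C0: "0 < D * A powr - q" using D A by simp
  show ?thesis
  proof (intro exI[of _ "D * A powr - q"] conjI allI C0)
    fix x
    show "treeN r q x \<le> ennreal (D * A powr - q) * stripL r q q x"
    proof (cases "stripL r q q x = top")
      case True
      have "ennreal (D * A powr - q) \<noteq> 0" using D A by simp
      then show ?thesis unfolding True by (simp add: ennreal_mult_top)
    next
      case False
      then have "\<And>P. x P < top" using good_less_top[OF gL r0(2)] by (simp add: less_top)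
      then have "treeN r q (cut x (trunc n)) \<le> ennreal (D * A powr - q) * stripL r q q x" for n
        by (intro order_trans[OF fs[OF fsup_trunc]] mult_left_mono good_mono[OF gL] cut_le) auto
      then show ?thesis by (rule good_le_trunc[OF gN])
    qed
  qed
qed

text \<open>Replacing \<open>x\<close> by its \<open>M\<close>-th root multiplies all exponents by \<open>M\<close>, which reduces the quasi-normed
  range to exponents larger than one.\<close>

lemma wint_powr:
  assumes q: "0 < q" and M: "0 < M"
  shows "\<exists>C>0. \<forall>S. decr S \<longrightarrow> wint (q * M) (\<lambda>u. S (u powr M)) \<le> ennreal C * wint q S \<and>
    wint q S \<le> ennreal C * wint (q * M) (\<lambda>u. S (u powr M))"
proof -
  \<comment> \<open>With this base \<open>(b powr k) powr M = 2 powr k\<close>, so the two dyadic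
    sums agree term by term.\<close>
  define b where "b = 2 powr (1 / M)"
  have b: "1 < b" using M by (simp add: b_def)
  have qM: "0 < q * M" using q M by simp
  have eq: "dysum b (q * M) (\<lambda>u. S (u powr M)) = dysum 2 q S" for S
    unfolding dysum_def using M by (intro nn_integral_cong) (simp add: b_def powr_powr field_simps)
  define C where "C = max (b powr (q * M) * (1 / (1 - 2 powr - q))) (2 powr q * (1 / (1 - b powr - (q * M))))"
  have p1: "0 < 1 - 2 powr - q" "0 < 1 - b powr - (q * M)"
    using q qM b powr_less_one[of 2 "-q"] powr_less_one[of b "- (q * M)"] by auto
  have "0 < b powr (q * M) * (1 / (1 - 2 powr - q))" using p1 b by simp
  then have C: "0 < C" by (simp add: C_def less_max_iff_disj)
  show ?thesis
  proof (intro exI[of _ C] conjI allI impI C)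
    fix S assume S: "decr S"
    have S': "decr (\<lambda>u. S (u powr M))" using S M by (auto simp: decr_def powr_mono2)
    have "wint (q * M) (\<lambda>u. S (u powr M)) \<le> ennreal (b powr (q * M)) * dysum 2 q S"
      using wint_le_dysum[OF S' b qM] by (simp add: eq)
    also have "\<dots> \<le> ennreal (b powr (q * M)) * (ennreal (1 / (1 - 2 powr - q)) * wint q S)"
      by (intro mult_left_mono dysum_le S q) auto
    also have "\<dots> = ennreal (b powr (q * M) * (1 / (1 - 2 powr - q))) * wint q S"
      using p1 by (subst ennreal_mult) (auto simp: mult.assoc)
    also have "\<dots> \<le> ennreal C * wint q S" by (intro mult_right_mono ennreal_leI) (auto simp: C_def)
    finally show "wint (q * M) (\<lambda>u. S (u powr M)) \<le> ennreal C * wint q S" .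
    have "wint q S \<le> ennreal (2 powr q) * dysum b (q * M) (\<lambda>u. S (u powr M))"
      using wint_le_dysum[OF S _ q, of 2] by (simp add: eq)
    also have "\<dots> \<le> ennreal (2 powr q) * (ennreal (1 / (1 - b powr - (q * M))) * wint (q * M) (\<lambda>u. S (u powr M)))"
      by (intro mult_left_mono dysum_le S' b qM) auto
    also have "\<dots> = ennreal (2 powr q * (1 / (1 - b powr - (q * M)))) * wint (q * M) (\<lambda>u. S (u powr M))"
      using p1 by (subst ennreal_mult) (auto simp: mult.assoc)
    also have "\<dots> \<le> ennreal C * wint (q * M) (\<lambda>u. S (u powr M))" by (intro mult_right_mono ennreal_leI) (auto simp: C_def)
    finally show "wint q S \<le> ennreal C * wint (q * M) (\<lambda>u. S (u powr M))" .
  qed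
qed

definition root_seq :: "real \<Rightarrow> (tidx \<Rightarrow> ennreal) \<Rightarrow> tidx \<Rightarrow> ennreal" where
  "root_seq M x P = epow (x P) (1 / M)"

lemma cut_root_seq: "cut (root_seq M x) A = root_seq M (cut x A)"
  by (rule ext) (auto simp: cut_def root_seq_def indicator_def)

lemma psum_root_seq:
  assumes "0 < M" shows "psum (r * M) (root_seq M x) = psum r x"
  using assms by (simp add: psum_def root_seq_def epow_epow)

lemma super_root_seq:
  assumes M: "0 < M"
  shows "TR.super (r * M) (psum (r * M)) (root_seq M x) u = TR.super r (psum r) x (u powr M)"
  unfolding TR.super_def TR.clears_def cut_root_seq psum_root_seq[OF M] powr_powr by (simp only: mult.commute)

lemma treeN_root_seq:
  assumes "0 < r" "0 < q" "0 < M"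
  shows "\<exists>C>0. \<forall>x. treeN (r * M) (q * M) (root_seq M x) \<le> ennreal C * treeN r q x \<and>
    treeN r q x \<le> ennreal C * treeN (r * M) (q * M) (root_seq M x)"
proof -
  obtain C where "0 < C" "\<And>S. decr S \<Longrightarrow> wint (q * M) (\<lambda>u. S (u powr M)) \<le> ennreal C * wint q S"
    "\<And>S. decr S \<Longrightarrow> wint q S \<le> ennreal C * wint (q * M) (\<lambda>u. S (u powr M))"
    using wint_powr[of q M] assms by blast
  moreover have "treeN (r * M) (q * M) (root_seq M x) = wint (q * M) (\<lambda>u. TR.super r (psum r) x (u powr M))" for x
    unfolding treeN_def TR.out_def super_root_seq[OF assms(3)] ..
  moreover have "decr (TR.super r (psum r) x)" for x
    using TR.decr_super[OF psum_good] assms by blast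
  ultimately show ?thesis
    unfolding treeN_def TR.out_def by (intro exI[of _ C]) auto
qed

text \<open>The inner tree functional changes by at most a constant factor \<open>C0\<close>. This
  moves the level at which a family clears by the factor \<open>c\<close> with
  \<open>C0 * c powr q = 1\<close>, and \<open>wint_scale\<close> turns the shift into a
  constant.\<close>

lemma stripL_root_seq:
  assumes r: "0 < r" and q: "0 < q" and M: "0 < M"
  shows "\<exists>C>0. \<forall>x. stripL (r * M) (q * M) (q * M) (root_seq M x) \<le> ennreal C * stripL r q q x"
proof -
  obtain C0 where C0: "0 < C0" "\<And>x. treeN (r * M) (q * M) (root_seq M x) \<le> ennreal C0 * treeN r q x"
    using treeN_root_seq[OF assms] by blast
  obtain C where C: "0 < C" "\<And>S. decr S \<Longrightarrow> wint (q * M) (\<lambda>u. S (u powr M)) \<le> ennreal C * wint q S"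
    using wint_powr[of q M] assms by blast
  define c where "c = (1 / C0) powr (1 / q)"
  have c: "0 < c" "C0 * c powr q = 1" using C0 q by (auto simp: c_def powr_powr)
  have dS: "decr (ST.super q (treeN r q) x)" for x by (rule ST.decr_super[OF treeN_good[OF r q] q])
  have CC: "0 < C * c powr - q" using C c by simp
  show ?thesis
  proof (intro exI[of _ "C * c powr - q"] conjI allI CC)
    fix x
    let ?S = "ST.super q (treeN r q) x"
    have "ST.super (q * M) (treeN (r * M) (q * M)) (root_seq M x) u \<le> ?S (c * u powr M)" if u: "0 < u" for u
      unfolding ST.super_def
    proof (rule INF_superset_mono, safe)
      fix G assume G: "ST.clears q (treeN r q) x (c * u powr M) G"
      show "ST.clears (q * M) (treeN (r * M) (q * M)) (root_seq M x) u G"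
        unfolding ST.clears_def
      proof
        fix I
        have "treeN (r * M) (q * M) (cut (root_seq M x) (stripT I - \<Union>(stripT ` G)))
          \<le> ennreal C0 * treeN r q (cut x (stripT I - \<Union>(stripT ` G)))"
          unfolding cut_root_seq by (rule C0)
        also have "\<dots> \<le> ennreal C0 * (ennreal ((c * u powr M) powr q) * ws I)"
          using G unfolding ST.clears_def by (intro mult_left_mono) (erule spec, simp)
        also have "\<dots> = ennreal (u powr (q * M)) * ws I"
        proof -
          have "C0 * (c * u powr M) powr q = u powr (q * M)"
            using c by (simp add: powr_mult powr_powr mult.assoc[symmetric] mult.commute)
          then show ?thesis using C0 by (simp add: mult.assoc[symmetric] ennreal_mult[symmetric])
        qed
        finally show "treeN (r * M) (q * M) (cut (root_seq M x) (stripT I - \<Union>(stripT ` G))) \<le> ennreal (u powr (q * M)) * ws I" .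
      qed
    qed
    then have "stripL (r * M) (q * M) (q * M) (root_seq M x) \<le> wint (q * M) (\<lambda>u. ?S (c * u powr M))"
      unfolding stripL_def ST.out_def by (rule wint_mono)
    also have "\<dots> \<le> ennreal C * wint q (\<lambda>v. ?S (c * v))"
      by (rule C(2)) (use dS[of x] c in \<open>auto simp: decr_def\<close>)
    also have "wint q (\<lambda>v. ?S (c * v)) = ennreal (c powr - q) * wint q ?S"
    proof -
      have "ennreal (c powr - q) * wint q ?S = ennreal (c powr - q) * (ennreal (c powr q) * wint q (\<lambda>v. ?S (c * v)))"
        by (subst wint_scale[OF dS c(1)]) rule
      also have "\<dots> = wint q (\<lambda>v. ?S (c * v))"
      proof -
        have "ennreal (c powr - q) * ennreal (c powr q) = 1"
          using c by (simp add: ennreal_mult[symmetric] powr_add[symmetric])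
        then show ?thesis by (simp add: mult.assoc[symmetric])
      qed
      finally show ?thesis by simp
    qed
    finally show "stripL (r * M) (q * M) (q * M) (root_seq M x) \<le> ennreal (C * c powr - q) * stripL r q q x"
      using C(1) by (simp add: stripL_def ST.out_def ennreal_mult mult.assoc)
  qed
qed

theorem treeN_stripL_equiv:
  assumes r: "0 < r" and q: "0 < q"
  shows "\<exists>C>0. \<forall>x. treeN r q x \<le> ennreal C * stripL r q q x \<and> stripL r q q x \<le> ennreal C * treeN r q x"
proof -
  \<comment> \<open>Here \<open>r * M = r + 1 + r / q\<close> and
    \<open>q * M = q + q / r + 1\<close>, both above one.\<close>
  define M where "M = 1 + 1 / r + 1 / q"
  have M: "0 < M" "1 < r * M" "1 < q * M"
    using r q by (simp_all add: M_def distrib_left add_pos_pos)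
  obtain C1 where C1: "0 < C1" "\<And>x. treeN r q x \<le> ennreal C1 * treeN (r * M) (q * M) (root_seq M x)"
    using treeN_root_seq[OF r q M(1)] by blast
  obtain C2 where C2: "0 < C2" "\<And>x. treeN (r * M) (q * M) x \<le> ennreal C2 * stripL (r * M) (q * M) (q * M) x"
    using treeN_le_stripL_gt1[OF M(2,3)] by blast
  obtain C3 where C3: "0 < C3" "\<And>x. stripL (r * M) (q * M) (q * M) (root_seq M x) \<le> ennreal C3 * stripL r q q x"
    using stripL_root_seq[OF r q M(1)] by blast
  obtain C4 where C4: "0 < C4" "\<And>x. stripL r q q x \<le> ennreal C4 * treeN r q x"
    using stripL_le_treeN[OF r q] by blast
  define C where "C = max (C1 * C2 * C3) C4"
  show ?thesis
  proof (intro exI[of _ C] conjI allI)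
    show "0 < C" using C4 by (simp add: C_def less_max_iff_disj)
    fix x
    have "treeN r q x \<le> ennreal C1 * (ennreal C2 * (ennreal C3 * stripL r q q x))"
      by (intro order_trans[OF C1(2)] mult_left_mono order_trans[OF C2(2)] C3(2)) auto
    also have "\<dots> = ennreal (C1 * C2 * C3) * stripL r q q x"
      using C1 C2 C3 by (simp add: ennreal_mult mult.assoc)
    also have "\<dots> \<le> ennreal C * stripL r q q x" by (intro mult_right_mono ennreal_leI) (auto simp: C_def)
    finally show "treeN r q x \<le> ennreal C * stripL r q q x" .
    have "ennreal C4 * treeN r q x \<le> ennreal C * treeN r q x" by (intro mult_right_mono ennreal_leI) (auto simp: C_def)
    then show "stripL r q q x \<le> ennreal C * treeN r q x" using C4(2)[of x] by order
  qed
qed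


section \<open>From functions on the upper half space to tile sequences\<close>

definition tl :: "tidx \<Rightarrow> pt set" where
  "tl = (\<lambda>(m, l, n). tile m l n)"

lemma mem_tl: "(t, s, u) \<in> tl (m, l, n) \<longleftrightarrow>
    pos l t = m \<and> 2 powr (real_of_int l - 1) < s \<and> s \<le> 2 powr real_of_int l \<and> pos (- l) u = n"
  by (auto simp: tl_def tile_def dyint_iff)

lemma scale_iff: "2 powr (real_of_int l - 1) < s \<and> s \<le> 2 powr real_of_int l \<longleftrightarrow> 0 < s \<and> \<lceil>log 2 s\<rceil> = l"
proof (cases "0 < s")
  case True
  then show ?thesis by (simp add: ceiling_eq_iff powr_less_iff le_powr_iff)
next
  case False
  then show ?thesis using powr_gt_zero[of 2 "real_of_int l - 1"] by (auto simp del: powr_gt_zero)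
qed

definition tile_of :: "pt \<Rightarrow> tidx" where
  "tile_of = (\<lambda>(t, s, u). let l = \<lceil>log 2 s\<rceil> in (pos l t, l, pos (- l) u))"

text \<open>The height \<open>s\<close> alone fixes the scale, and the scale fixes both positions;
  so the tiles partition \<open>Xset\<close>.\<close>

lemma mem_tl_iff: "z \<in> tl P \<longleftrightarrow> z \<in> Xset \<and> tile_of z = P"
proof -
  obtain t s u where z: "z = (t, s, u)" by (cases z)
  obtain m l n where P: "P = (m, l, n)" by (cases P)
  show ?thesis
    unfolding z P mem_tl using scale_iff[of l s] by (auto simp: tile_of_def Xset_def Let_def)
qed

lemma tl_nonempty: "\<exists>z. z \<in> tl P"
proof -
  obtain m l n where P: "P = (m, l, n)" by (cases P)
  have "(2 powr real_of_int l * (real_of_int m + 1), 2 powr real_of_int l, 2 powr real_of_int (- l) * (real_of_int n + 1)) \<in> tl P"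
    unfolding P tl_def tile_def using right_end_mem[of l m] right_end_mem[of "- l" n] by auto
  then show ?thesis by blast
qed

lemma tl_lebesgue [measurable]: "tl P \<in> sets lebesgue"
proof -
  obtain m l n where P: "P = (m, l, n)" by (cases P)
  have "tl P \<in> sets borel"
    unfolding P tl_def tile_def dyint_def by (simp add: borel_Times)
  then show ?thesis by (simp add: sets_completionI_sets)
qed

lemma UN_tl_lebesgue [measurable]: "\<Union>(tl ` S) \<in> sets lebesgue"
  by (intro sets.countable_UN') auto

lemma Xset_eq: "Xset = \<Union>(range tl)"
  by (auto simp: mem_tl_iff)

lemma mem_UN_tl: "z \<in> \<Union>(tl ` S) \<longleftrightarrow> z \<in> Xset \<and> tile_of z \<in> S"
  by (auto simp: mem_tl_iff)

lemma UN_tl_inject: "\<Union>(tl ` A) = \<Union>(tl ` B) \<longleftrightarrow> A = B"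
proof
  assume *: "\<Union>(tl ` A) = \<Union>(tl ` B)"
  have "P \<in> A \<longleftrightarrow> P \<in> B" for P
  proof -
    obtain z where z: "z \<in> tl P" using tl_nonempty by blast
    then have "z \<in> Xset" "tile_of z = P" by (auto simp: mem_tl_iff)
    then show ?thesis using * mem_UN_tl[of z A] mem_UN_tl[of z B] by simp
  qed
  then show "A = B" by blast
qed simp

section \<open>Trees and strips as unions of tiles, and the outer measure of one generator\<close>

definition tree_set :: "tidx \<Rightarrow> pt set" where
  "tree_set = (\<lambda>(m, l, n). tree m l n)"

definition strip_set :: "int \<times> int \<Rightarrow> pt set" where
  "strip_set = (\<lambda>(m, l). strip m l)"

lemma Nidx_eq: "l' \<le> l \<Longrightarrow> Nidx n l l' = anc n l l'"
  unfolding Nidx_def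
proof (rule the_equality)
  assume l: "l' \<le> l"
  have iff: "dyint n (- l) \<subseteq> dyint N (- l') \<longleftrightarrow> N = anc n l l'" for N
    using inside_iff_subset[of "(n, - l)" "(N, - l')"] l by (auto simp: ivl_def inside_def anc_def)
  show "dyint n (- l) \<subseteq> dyint (anc n l l') (- l')" by (simp add: iff)
  show "N = anc n l l'" if "dyint n (- l) \<subseteq> dyint N (- l')" for N using that by (simp add: iff)
qed

lemma tree_set_eq: "tree_set T = \<Union>(tl ` treeT T)"
proof -
  obtain m l n where T: "T = (m, l, n)" by (cases T)
  have "dyint m' l' \<subseteq> dyint m l \<longleftrightarrow> inside (m', l') (m, l)" if "l' \<le> l" for m' l'
    using inside_iff_subset[of "(m', l')" "(m, l)"] that by (simp add: ivl_def)
  then have "tree m l n = (\<Union>l'\<in>{l'. l' \<le> l}. \<Union>m'\<in>{m'. inside (m', l') (m, l)}. tl (m', l', anc n l l'))"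
    unfolding tree_def tl_def by (intro SUP_cong) (auto simp: Nidx_eq)
  also have "\<dots> = \<Union>(tl ` treeT (m, l, n))"
  proof safe
    fix z l' m' assume "l' \<le> l" "inside (m', l') (m, l)" "z \<in> tl (m', l', anc n l l')"
    then show "z \<in> \<Union>(tl ` treeT (m, l, n))" by (auto simp: treeT_def)
  next
    fix z P assume P: "P \<in> treeT (m, l, n)" "z \<in> tl P"
    obtain m' l' n' where P': "P = (m', l', n')" by (cases P)
    then have "inside (m', l') (m, l)" "n' = anc n l l'" using P by (auto simp: treeT_def)
    moreover then have "l' \<le> l" by (simp add: inside_def)
    ultimately show "z \<in> (\<Union>l'\<in>{l'. l' \<le> l}. \<Union>m'\<in>{m'. inside (m', l') (m, l)}. tl (m', l', anc n l l'))"
      using P P' by blast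
  qed
  finally show ?thesis by (simp add: T tree_set_def)
qed

lemma strip_set_eq: "strip_set I = \<Union>(tl ` stripT I)"
proof (rule set_eqI)
  fix z :: pt obtain t s u where z: "z = (t, s, u)" by (cases z)
  obtain m l where I: "I = (m, l)" by (cases I)
  let ?l = "\<lceil>log 2 s\<rceil>"
  have "z \<in> strip_set I \<longleftrightarrow> pos l t = m \<and> 0 < s \<and> s \<le> 2 powr real_of_int l"
    by (auto simp: z I strip_set_def strip_def dyint_iff)
  also have "\<dots> \<longleftrightarrow> pos l t = m \<and> 0 < s \<and> ?l \<le> l"
    using log_le_iff[of 2 s "real_of_int l"] by (auto simp: ceiling_le_iff)
  also have "\<dots> \<longleftrightarrow> 0 < s \<and> inside (pos ?l t, ?l) (m, l)"
    using pos_ancestor[of ?l l t] by (auto simp: inside_def)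
  also have "\<dots> \<longleftrightarrow> z \<in> \<Union>(tl ` stripT I)"
    unfolding mem_UN_tl z I by (simp add: tile_of_def Let_def stripT_def top_ivl_def Xset_def)
  finally show "z \<in> strip_set I \<longleftrightarrow> z \<in> \<Union>(tl ` stripT I)" .
qed

text \<open>A tree contains its own top tile, so equal trees have their top tiles in each other,
  which fixes the time interval and then the frequency index. This gives the definite description in
  \<open>tau_w\<close> its value.\<close>

lemma inj_tree_set: "inj tree_set"
proof (rule injI)
  fix S T assume "tree_set S = tree_set T"
  then have "treeT S = treeT T" by (simp add: tree_set_eq UN_tl_inject)
  then have *: "S \<in> treeT T" "T \<in> treeT S" using self_in_treeT[of S] self_in_treeT[of T] by simp_all
  obtain m l n where S: "S = (m, l, n)" by (cases S)
  obtain m' l' n' where T: "T = (m', l', n')" by (cases T)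
  have "inside (m, l) (m', l')" "inside (m', l') (m, l)" "n = anc n' l' l"
    using * by (auto simp: S T treeT_def)
  moreover from this have "(m, l) = (m', l')" by (intro inside_antisym)
  ultimately show "S = T" by (simp add: S T anc_def)
qed

lemma inj_strip_set: "inj strip_set"
proof (rule injI)
  fix I J assume "strip_set I = strip_set J"
  then have *: "stripT I = stripT J" by (simp add: strip_set_eq UN_tl_inject)
  have mem: "(fst K, snd K, 0) \<in> stripT L \<longleftrightarrow> inside K L" for K L by (simp add: stripT_def top_ivl_def)
  have "inside I J" "inside J I" using mem[of I I] mem[of I J] mem[of J J] mem[of J I] * by simp_all
  then show "I = J" by (rule inside_antisym)
qed

lemma trees_eq: "trees = range tree_set"
  by (auto simp: trees_def tree_set_def image_def)

lemma strips_eq: "strips = range strip_set"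
  by (auto simp: strips_def strip_set_def image_def)

lemma tau_w_eq: "tau_w (tree_set T) = wt T"
proof -
  obtain m l n where T: "T = (m, l, n)" by (cases T)
  have "(THE l'. \<exists>m' n'. tree_set T = tree m' l' n') = l"
  proof (rule the_equality)
    show "\<exists>m' n'. tree_set T = tree m' l n'" by (auto simp: T tree_set_def)
    fix l' assume "\<exists>m' n'. tree_set T = tree m' l' n'"
    then obtain m' n' where "tree_set T = tree_set (m', l', n')" by (auto simp: tree_set_def)
    then have "T = (m', l', n')" by (rule injD[OF inj_tree_set])
    then show "l' = l" using T by simp
  qed
  then show ?thesis by (simp add: tau_w_def wt_def ws_def T top_ivl_def)
qed

lemma sigma_w_eq: "sigma_w (strip_set I) = ws I"
proof -
  obtain m l where I: "I = (m, l)" by (cases I)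
  have "(THE l'. \<exists>m'. strip_set I = strip m' l') = l"
  proof (rule the_equality)
    show "\<exists>m'. strip_set I = strip m' l" by (auto simp: I strip_set_def)
    fix l' assume "\<exists>m'. strip_set I = strip m' l'"
    then obtain m' where "strip_set I = strip_set (m', l')" by (auto simp: strip_set_def)
    then have "I = (m', l')" by (rule injD[OF inj_strip_set])
    then show "l' = l" using I by simp
  qed
  then show ?thesis by (simp add: sigma_w_def ws_def I)
qed

lemma infsum_eq_nsum:
  fixes f :: "'a::countable \<Rightarrow> ennreal"
  shows "infsum f A = nsum A f"
proof (rule antisym)
  have eq: "infsum f A = (SUP F\<in>{F. finite F \<and> F \<subseteq> A}. sum f F)"
    by (rule nonneg_infsum_complete) simp
  show "infsum f A \<le> nsum A f"
    unfolding eq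
    by (intro SUP_least) (auto simp: nn_integral_count_space_finite[symmetric] intro: nsum_mono_set)
  show "nsum A f \<le> infsum f A"
    unfolding eq by (intro nsum_le_finite SUP_upper) auto
qed

lemma gen_outer_range:
  fixes t :: "'g::countable \<Rightarrow> pt set"
  assumes inj: "inj t" and w: "\<And>g. w' (t g) = w g"
  shows "gen_outer (range t) w' A = (INF G\<in>{G. A \<subseteq> \<Union>(t ` G)}. nsum G w)"
proof -
  have eq: "infsum w' (t ` G) = nsum G w" for G
    using inj by (subst infsum_reindex) (auto simp: o_def w infsum_eq_nsum intro: inj_on_subset)
  show ?thesis
    unfolding gen_outer_def
  proof (rule antisym)
    show "(INF S'\<in>{S'. S' \<subseteq> range t \<and> A \<subseteq> \<Union>S'}. infsum w' S') \<le> (INF G\<in>{G. A \<subseteq> \<Union>(t ` G)}. nsum G w)"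
      by (rule INF_greatest, subst eq[symmetric], rule INF_lower) auto
    show "(INF G\<in>{G. A \<subseteq> \<Union>(t ` G)}. nsum G w) \<le> (INF S'\<in>{S'. S' \<subseteq> range t \<and> A \<subseteq> \<Union>S'}. infsum w' S')"
    proof (rule INF_greatest)
      fix S' assume "S' \<in> {S'. S' \<subseteq> range t \<and> A \<subseteq> \<Union>S'}"
      then have "S' = t ` (t -` S')" "A \<subseteq> \<Union>S'" by auto
      then show "(INF G\<in>{G. A \<subseteq> \<Union>(t ` G)}. nsum G w) \<le> infsum w' S'"
        using eq[of "t -` S'"] by (metis (mono_tags, lifting) INF_lower mem_Collect_eq)
    qed
  qed
qed

lemma ws_le_cover:
  assumes "ivl I \<subseteq> (\<Union>g\<in>G. ivl (h (g :: 'g::countable)))"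
  shows "ws I \<le> nsum G (\<lambda>g. ws (h g))"
proof -
  have "ws I = (\<integral>\<^sup>+t. indicator (ivl I) t \<partial>lborel)" by (simp add: emeasure_ivl)
  also have "\<dots> \<le> (\<integral>\<^sup>+t. nsum G (\<lambda>g. indicator (ivl (h g)) t) \<partial>lborel)"
  proof (intro nn_integral_mono)
    fix t
    show "(indicator (ivl I) t :: ennreal) \<le> nsum G (\<lambda>g. indicator (ivl (h g)) t)"
    proof (cases "t \<in> ivl I")
      case True
      then obtain g where "g \<in> G" "t \<in> ivl (h g)" using assms by blast
      then show ?thesis using nsum_ge[of g G "\<lambda>g. indicator (ivl (h g)) t :: ennreal"] by (simp add: True)
    qed simp
  qed
  also have "\<dots> = nsum G (\<lambda>g. \<integral>\<^sup>+t. indicator (ivl (h g)) t \<partial>lborel)"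
    by (rule nn_integral_count_space_nn_integral) auto
  finally show ?thesis by (simp add: emeasure_ivl)
qed

text \<open>A strip containing a point of height \<open>2 powr snd I\<close> over \<open>t\<close>
  has \<open>t\<close> in its interval. So the intervals of a covering cover \<open>ivl I\<close>,
  and length is countably subadditive.\<close>

lemma mu_strip: "mu (strip_set I) = ws I"
proof -
  have eq: "mu A = (INF G\<in>{G. A \<subseteq> \<Union>(strip_set ` G)}. nsum G ws)" for A
    unfolding mu_def strips_eq by (rule gen_outer_range[where t = strip_set and w' = sigma_w and w = ws, OF inj_strip_set sigma_w_eq])
  show ?thesis
    unfolding eq
  proof (rule antisym)
    have "(INF G\<in>{G. strip_set I \<subseteq> \<Union>(strip_set ` G)}. nsum G ws) \<le> nsum {I} ws" by (rule INF_lower) simp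
    then show "(INF G\<in>{G. strip_set I \<subseteq> \<Union>(strip_set ` G)}. nsum G ws) \<le> ws I"
      by (simp add: nn_integral_count_space_finite)
    show "ws I \<le> (INF G\<in>{G. strip_set I \<subseteq> \<Union>(strip_set ` G)}. nsum G ws)"
    proof (rule INF_greatest)
      fix G assume "G \<in> {G. strip_set I \<subseteq> \<Union>(strip_set ` G)}"
      then have G: "strip_set I \<subseteq> \<Union>(strip_set ` G)" by simp
      have "ivl I \<subseteq> (\<Union>g\<in>G. ivl g)"
      proof
        fix t assume t: "t \<in> ivl I"
        then have "(t, 2 powr real_of_int (snd I), 0) \<in> strip_set I" by (auto simp: strip_set_def strip_def ivl_def)
        then obtain J where "J \<in> G" "(t, 2 powr real_of_int (snd I), 0) \<in> strip_set J" using G by blast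
        then show "t \<in> (\<Union>g\<in>G. ivl g)" by (auto simp: strip_set_def strip_def ivl_def)
      qed
      then show "ws I \<le> nsum G ws" using ws_le_cover[where I = I and G = G and h = "\<lambda>g. g"] by simp
    qed
  qed
qed

text \<open>Points of the top tile suffice: a tree containing one of them contains that tile, so its
  top interval contains the one of \<open>T\<close>.\<close>

lemma nu_tree: "nu (tree_set T) = wt T"
proof -
  have eq: "nu A = (INF G\<in>{G. A \<subseteq> \<Union>(tree_set ` G)}. nsum G wt)" for A
    unfolding nu_def trees_eq by (rule gen_outer_range[where t = tree_set and w' = tau_w and w = wt, OF inj_tree_set tau_w_eq])
  show ?thesis
    unfolding eq
  proof (rule antisym)
    have "(INF G\<in>{G. tree_set T \<subseteq> \<Union>(tree_set ` G)}. nsum G wt) \<le> nsum {T} wt" by (rule INF_lower) simp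
    then show "(INF G\<in>{G. tree_set T \<subseteq> \<Union>(tree_set ` G)}. nsum G wt) \<le> wt T"
      by (simp add: nn_integral_count_space_finite)
    show "wt T \<le> (INF G\<in>{G. tree_set T \<subseteq> \<Union>(tree_set ` G)}. nsum G wt)"
    proof (rule INF_greatest)
      fix G assume "G \<in> {G. tree_set T \<subseteq> \<Union>(tree_set ` G)}"
      then have G: "\<Union>(tl ` treeT T) \<subseteq> (\<Union>S\<in>G. \<Union>(tl ` treeT S))" by (simp add: tree_set_eq)
      obtain m l n where T: "T = (m, l, n)" by (cases T)
      have "ivl (top_ivl T) \<subseteq> (\<Union>S\<in>G. ivl (top_ivl S))"
      proof
        fix t assume t: "t \<in> ivl (top_ivl T)"
        let ?z = "(t, 2 powr real_of_int l, 2 powr real_of_int (- l) * (real_of_int n + 1))"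
        have "?z \<in> tl T"
          using t right_end_mem[of "- l" n] unfolding T tl_def tile_def by (auto simp: top_ivl_def ivl_def)
        then have z: "?z \<in> \<Union>(tl ` treeT T)" "tile_of ?z = T" using self_in_treeT[of T] by (auto simp: mem_tl_iff)
        then obtain S where S: "S \<in> G" "?z \<in> \<Union>(tl ` treeT S)" using G by blast
        then have "T \<in> treeT S" using z(2) unfolding mem_UN_tl by metis
        then have "inside (top_ivl T) (top_ivl S)" by (auto simp: treeT_def top_ivl_def split: prod.splits)
        then show "t \<in> (\<Union>S\<in>G. ivl (top_ivl S))" using t S inside_mem by blast
      qed
      then show "wt T \<le> nsum G wt" using ws_le_cover[where I = "top_ivl T" and G = G and h = top_ivl] by (simp add: wt_def[abs_def])
    qed
  qed
qed

section \<open>Quasi-norms of functions in terms of tile coefficients\<close>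

definition coef :: "real \<Rightarrow> (pt \<Rightarrow> complex) \<Rightarrow> tidx \<Rightarrow> ennreal" where
  "coef r f P = epow (\<integral>\<^sup>+z\<in>tl P. ennreal (norm (f z) powr r) \<partial>lebesgue) (1 / r)"

lemma nn_integral_tiles:
  assumes [measurable]: "h \<in> borel_measurable lebesgue"
  shows "(\<integral>\<^sup>+z\<in>Xset. h z \<partial>lebesgue) = nsum UNIV (\<lambda>P. \<integral>\<^sup>+z\<in>tl P. h z \<partial>lebesgue)"
proof -
  have "h z * indicator Xset z = nsum UNIV (\<lambda>P. h z * indicator (tl P) z)" for z
  proof (cases "z \<in> Xset")
    case True
    then show ?thesis
      by (subst nn_integral_count_space'[of "{tile_of z}"]) (auto simp: indicator_def mem_tl_iff)
  next
    case False
    then show ?thesis by (simp add: mem_tl_iff indicator_def)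
  qed
  then have "(\<integral>\<^sup>+z\<in>Xset. h z \<partial>lebesgue) = (\<integral>\<^sup>+z. nsum UNIV (\<lambda>P. h z * indicator (tl P) z) \<partial>lebesgue)"
    by (intro nn_integral_cong) auto
  also have "\<dots> = nsum UNIV (\<lambda>P. \<integral>\<^sup>+z\<in>tl P. h z \<partial>lebesgue)"
    by (rule nn_integral_count_space_nn_integral) auto
  finally show ?thesis .
qed

lemma restr_measurable [measurable]:
  assumes [measurable]: "A \<in> sets lebesgue" "f \<in> borel_measurable lebesgue"
  shows "restr f A \<in> borel_measurable lebesgue"
  unfolding restr_def by measurable

lemma Lr_omega_eq:
  assumes r: "0 < r" and [measurable]: "f \<in> borel_measurable lebesgue"
  shows "Lr_omega r f = epow (psum r (coef r f)) (1 / r)"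
  unfolding Lr_omega_def enn_root_epow psum_def coef_def
  using r by (subst nn_integral_tiles) (auto simp: epow_epow)

lemma coef_cong:
  assumes "\<And>z. z \<in> tl P \<Longrightarrow> norm (f z) = norm (g z)"
  shows "coef r f P = coef r g P"
  unfolding coef_def using assms by (intro arg_cong2[where f = epow] nn_integral_cong refl) (auto simp: indicator_def)

lemma coef_zero: "(\<And>z. z \<in> tl P \<Longrightarrow> f z = 0) \<Longrightarrow> coef r f P = 0"
proof -
  assume *: "\<And>z. z \<in> tl P \<Longrightarrow> f z = 0"
  have "(\<integral>\<^sup>+z\<in>tl P. ennreal (norm (f z) powr r) \<partial>lebesgue) = (\<integral>\<^sup>+(z::pt). 0 \<partial>lebesgue)"
    by (intro nn_integral_cong) (auto simp: indicator_def *)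
  then show ?thesis by (simp add: coef_def)
qed

lemma coef_restr: "coef r (restr f (\<Union>(tl ` S))) = cut (coef r f) S"
proof (rule ext)
  fix P
  show "coef r (restr f (\<Union>(tl ` S))) P = cut (coef r f) S P"
  proof (cases "P \<in> S")
    case True
    have "coef r (restr f (\<Union>(tl ` S))) P = coef r f P"
      using True by (intro coef_cong) (auto simp: restr_def indicator_def)
    then show ?thesis using True by (simp add: cut_def)
  next
    case False
    then have "coef r (restr f (\<Union>(tl ` S))) P = 0"
      by (intro coef_zero) (auto simp: restr_def indicator_def mem_tl_iff)
    then show ?thesis using False by (simp add: cut_def)
  qed
qed

text \<open>Translates a bound for a normalised root mean into the powered inequality of
  \<open>clears\<close>; the weight must be neither zero nor infinite.\<close>

lemma root_mean_le:
  assumes r: "0 < r" and w: "0 < w" "w < top" and lam: "0 < lam"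
  shows "enn_root r (inverse w) * epow u (1 / r) \<le> ennreal lam \<longleftrightarrow> u \<le> ennreal (lam powr r) * w"
proof -
  obtain v where v: "w = ennreal v" "0 < v" using w by (cases w rule: ennreal_cases) auto
  have inv: "w * inverse w = 1" using v by (simp add: inverse_ennreal ennreal_mult[symmetric])
  have "enn_root r (inverse w) * epow u (1 / r) \<le> ennreal lam \<longleftrightarrow> inverse w * u \<le> ennreal (lam powr r)"
    unfolding enn_root_epow epow_mult[symmetric] using r lam by (simp add: epow_swap_le epow_ennreal)
  also have "\<dots> \<longleftrightarrow> u \<le> ennreal (lam powr r) * w"
  proof
    assume "inverse w * u \<le> ennreal (lam powr r)"
    then have "w * (inverse w * u) \<le> w * ennreal (lam powr r)" by (intro mult_left_mono) auto
    then have "u \<le> w * ennreal (lam powr r)" by (simp only: mult.assoc[symmetric] inv mult_1)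
    then show "u \<le> ennreal (lam powr r) * w" by (simp only: mult.commute)
  next
    assume "u \<le> ennreal (lam powr r) * w"
    then have "inverse w * u \<le> inverse w * (ennreal (lam powr r) * w)" by (intro mult_left_mono) auto
    also have "\<dots> = ennreal (lam powr r) * (w * inverse w)" by (simp only: ac_simps)
    finally show "inverse w * u \<le> ennreal (lam powr r)" by (simp add: inv)
  qed
  finally show ?thesis .
qed

text \<open>A clearing family yields the measurable union of its tiles as exceptional set.
  Conversely, every covering of an admissible \<open>B\<close> clears, because tiles outside the
  covering miss \<open>B\<close> and keep their coefficients. The general form serves trees and
  strips alike.\<close>

lemma super_bridge:
  fixes m :: "'g::countable \<Rightarrow> tidx set" and t :: "'g \<Rightarrow> pt set"
  assumes O: "outer m w" and t: "\<And>g. t g = \<Union>(tl ` m g)" and inj: "inj t" and w': "\<And>g. w' (t g) = w g"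
    and \<Phi>: "good q \<Phi>" and q: "0 < q" and f [measurable]: "f \<in> borel_measurable lebesgue"
    and Linf: "\<And>h. h \<in> borel_measurable lebesgue \<Longrightarrow>
      Linf h \<le> ennreal lam \<longleftrightarrow> (\<forall>g. \<Phi> (cut (coef r h) (m g)) \<le> ennreal (lam powr q) * w g)"
  shows "(INF B \<in> {B. B \<in> sets lebesgue \<and> B \<subseteq> Xset \<and> Linf (restr f (Xset - B)) \<le> ennreal lam}. gen_outer (range t) w' B)
    = outer.super m w q \<Phi> (coef r f) lam" (is "?L = ?R")
proof (rule antisym)
  have X [measurable]: "Xset \<in> sets lebesgue" unfolding Xset_eq by measurable
  note out = gen_outer_range[of t w' w, OF inj w']
  show "?L \<le> ?R"
    unfolding outer.super_def[OF O]
  proof (rule INF_greatest)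
    fix G assume "G \<in> {G. outer.clears m w q \<Phi> (coef r f) lam G}"
    then have G: "outer.clears m w q \<Phi> (coef r f) lam G" by simp
    define B where "B = \<Union>(tl ` \<Union>(m ` G))"
    have B: "B \<in> sets lebesgue" "B \<subseteq> Xset" unfolding B_def by (measurable, auto simp: mem_tl_iff)
    have "Xset - B = \<Union>(tl ` (- \<Union>(m ` G)))" unfolding B_def by (auto simp: mem_tl_iff)
    then have c: "coef r (restr f (Xset - B)) = cut (coef r f) (- \<Union>(m ` G))" by (simp only: coef_restr)
    have "Linf (restr f (Xset - B)) \<le> ennreal lam"
    proof (subst Linf)
      show "restr f (Xset - B) \<in> borel_measurable lebesgue" using B by measurable
      have "- \<Union>(m ` G) \<inter> m g = m g - \<Union>(m ` G)" for g by auto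
      then show "\<forall>g. \<Phi> (cut (coef r (restr f (Xset - B))) (m g)) \<le> ennreal (lam powr q) * w g"
        using G unfolding c cut_cut outer.clears_def[OF O] by simp
    qed
    then have "?L \<le> gen_outer (range t) w' B" using B by (intro INF_lower) simp
    also have "\<dots> \<le> nsum G w" unfolding out by (rule INF_lower) (auto simp: B_def t)
    finally show "?L \<le> nsum G w" .
  qed
  show "?R \<le> ?L"
  proof (rule INF_greatest)
    fix B assume "B \<in> {B. B \<in> sets lebesgue \<and> B \<subseteq> Xset \<and> Linf (restr f (Xset - B)) \<le> ennreal lam}"
    then have B [measurable]: "B \<in> sets lebesgue" and BX: "B \<subseteq> Xset" and L: "Linf (restr f (Xset - B)) \<le> ennreal lam" by auto
    have "restr f (Xset - B) \<in> borel_measurable lebesgue" by measurable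
    with L have L': "\<And>g. \<Phi> (cut (coef r (restr f (Xset - B))) (m g)) \<le> ennreal (lam powr q) * w g"
      using Linf by blast
    show "?R \<le> gen_outer (range t) w' B"
      unfolding out
    proof (rule INF_greatest)
      fix G assume "G \<in> {G. B \<subseteq> \<Union>(t ` G)}"
      then have G: "B \<subseteq> (\<Union>g\<in>G. \<Union>(tl ` m g))" by (simp add: t)
      have "outer.clears m w q \<Phi> (coef r f) lam G"
        unfolding outer.clears_def[OF O]
      proof
        fix g
        have "cut (coef r f) (m g - \<Union>(m ` G)) P \<le> cut (coef r (restr f (Xset - B))) (m g) P" for P
        proof (cases "P \<in> m g - \<Union>(m ` G)")
          case True
          have "coef r (restr f (Xset - B)) P = coef r f P"
          proof (rule coef_cong)
            fix z assume z: "z \<in> tl P"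
            then have "z \<in> Xset" "tile_of z = P" by (auto simp: mem_tl_iff)
            then have "z \<notin> B" using G True mem_UN_tl[of z] by blast
            then show "norm (restr f (Xset - B) z) = norm (f z)" using \<open>z \<in> Xset\<close> by (simp add: restr_def)
          qed
          then show ?thesis using True by (simp add: cut_def)
        qed (simp add: cut_def)
        then have "\<Phi> (cut (coef r f) (m g - \<Union>(m ` G))) \<le> \<Phi> (cut (coef r (restr f (Xset - B))) (m g))"
          by (rule good_mono[OF \<Phi>])
        also note L'
        finally show "\<Phi> (cut (coef r f) (m g - \<Union>(m ` G))) \<le> ennreal (lam powr q) * w g" .
      qed
      then show "?R \<le> nsum G w" by (rule outer.super_le[OF O])
    qed
  qed
qed

lemma Lq_nu_eq:
  assumes r: "0 < r" and q: "0 < q" and f: "f \<in> borel_measurable lebesgue"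
  shows "Lq_nu q r f = epow (treeN r q (coef r f)) (1 / q)"
proof -
  have Linf: "Linf_nu r h \<le> ennreal lam \<longleftrightarrow> (\<forall>T. psum r (cut (coef r h) (treeT T)) \<le> ennreal (lam powr r) * wt T)"
    if h [measurable]: "h \<in> borel_measurable lebesgue" and lam: "0 < lam" for h lam
  proof -
    have "ell_omega r h (tree_set T) \<le> ennreal lam \<longleftrightarrow> psum r (cut (coef r h) (treeT T)) \<le> ennreal (lam powr r) * wt T" for T
    proof -
      have "Lr_omega r (restr h (tree_set T)) = epow (psum r (cut (coef r h) (treeT T))) (1 / r)"
        unfolding tree_set_eq by (subst Lr_omega_eq[OF r]) (auto simp: coef_restr)
      then show ?thesis
        unfolding ell_omega_def nu_tree using root_mean_le[OF r TR.w_pos TR.w_fin lam] by simp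
    qed
    then show ?thesis unfolding Linf_nu_def trees_eq by (simp add: SUP_le_iff)
  qed
  have "nu_super r f lam = TR.super r (psum r) (coef r f) lam" if "0 < lam" for lam
    unfolding nu_super_def nu_def trees_eq
    by (rule super_bridge[OF TR.outer_axioms tree_set_eq inj_tree_set tau_w_eq psum_good[OF r] r f Linf[OF _ that]])
  then have "treeN r q (coef r f) = (\<integral>\<^sup>+lam\<in>{0<..}. ennreal (q * lam powr (q - 1)) * nu_super r f lam \<partial>lborel)"
    unfolding treeN_def TR.out_def wint_def by (intro nn_integral_cong) (auto simp: indicator_def)
  then show ?thesis unfolding Lq_nu_def enn_root_epow by simp
qed

lemma Lp_mu_eq:
  assumes r: "0 < r" and q: "0 < q" and p: "0 < p" and f: "f \<in> borel_measurable lebesgue"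
  shows "Lp_mu p q r f = epow (stripL r q p (coef r f)) (1 / p)"
proof -
  have Linf: "Linf_mu q r h \<le> ennreal lam \<longleftrightarrow> (\<forall>I. treeN r q (cut (coef r h) (stripT I)) \<le> ennreal (lam powr q) * ws I)"
    if h [measurable]: "h \<in> borel_measurable lebesgue" and lam: "0 < lam" for h lam
  proof -
    have "ell_nu q r h (strip_set I) \<le> ennreal lam \<longleftrightarrow> treeN r q (cut (coef r h) (stripT I)) \<le> ennreal (lam powr q) * ws I" for I
    proof -
      have "Lq_nu q r (restr h (strip_set I)) = epow (treeN r q (cut (coef r h) (stripT I))) (1 / q)"
        unfolding strip_set_eq by (subst Lq_nu_eq[OF r q]) (auto simp: coef_restr)
      then show ?thesis
        unfolding ell_nu_def mu_strip using root_mean_le[OF q ST.w_pos ST.w_fin lam] by simp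
    qed
    then show ?thesis unfolding Linf_mu_def strips_eq by (simp add: SUP_le_iff)
  qed
  have "mu_super q r f lam = ST.super q (treeN r q) (coef r f) lam" if "0 < lam" for lam
    unfolding mu_super_def mu_def strips_eq
    by (rule super_bridge[OF ST.outer_axioms strip_set_eq inj_strip_set sigma_w_eq treeN_good[OF r q] q f Linf[OF _ that]])
  then have "stripL r q p (coef r f) = (\<integral>\<^sup>+lam\<in>{0<..}. ennreal (p * lam powr (p - 1)) * mu_super q r f lam \<partial>lborel)"
    unfolding stripL_def ST.out_def wint_def by (intro nn_integral_cong) (auto simp: indicator_def)
  then show ?thesis unfolding Lp_mu_def enn_root_epow by simp
qed


section \<open>Duality and the triangle inequality for functions\<close>

text \<open>With both norms scaled to one, \<open>young\<close> under the integral gives 1 + 1,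
  hence the constant 2. Zero and infinite norms are separated because of products
  \<open>0 * top\<close>.\<close>

lemma holder_crude:
  fixes u v :: "'a \<Rightarrow> real"
  assumes r: "1 < r" and [measurable]: "u \<in> borel_measurable M" "v \<in> borel_measurable M"
    and nn: "\<And>z. 0 \<le> u z" "\<And>z. 0 \<le> v z"
  shows "(\<integral>\<^sup>+z. ennreal (u z * v z) \<partial>M) \<le>
    ennreal 2 * (epow (\<integral>\<^sup>+z. ennreal (u z powr r) \<partial>M) (1 / r) * epow (\<integral>\<^sup>+z. ennreal (v z powr conj_exp r) \<partial>M) (1 / conj_exp r))"
    (is "?I \<le> ennreal 2 * (?A * ?B)")
proof -
  note r' = conj_exp_props[OF r]
  have zero: "?I = 0" if "(\<integral>\<^sup>+z. ennreal (w z powr s) \<partial>M) = 0" "w \<in> borel_measurable M" "\<And>z. u z * v z \<noteq> 0 \<Longrightarrow> w z \<noteq> 0" for w s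
  proof -
    have "AE z in M. ennreal (w z powr s) = 0" using that by (subst nn_integral_0_iff_AE[symmetric]) auto
    then have "AE z in M. ennreal (u z * v z) = 0"
    proof eventually_elim
      case (elim z)
      have "w z = 0"
      proof (rule ccontr)
        assume "w z \<noteq> 0"
        then have "0 < w z powr s" by simp
        with elim show False by (simp del: powr_gt_zero)
      qed
      then have "u z * v z = 0" using that(3)[of z] by blast
      then show ?case by (simp only: ennreal_0)
    qed
    then show ?thesis by (subst nn_integral_0_iff_AE) auto
  qed
  show ?thesis
  proof (cases "?A = 0 \<or> ?B = 0")
    case True
    then have "?I = 0" using zero[of u r] zero[of v "conj_exp r"] by auto
    then show ?thesis by simp
  next
    case nz: False
    show ?thesis
    proof (cases "?A = top \<or> ?B = top")
      case True
      then show ?thesis using nz by (auto simp: ennreal_mult_top ennreal_top_mult)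
    next
      case False
      obtain a where a: "?A = ennreal a" "0 < a"
        using nz False by (cases ?A rule: ennreal_cases) (auto simp: less_le)
      obtain b where b: "?B = ennreal b" "0 < b"
        using nz False by (cases ?B rule: ennreal_cases) (auto simp: less_le)
      have Ia: "(\<integral>\<^sup>+z. ennreal (u z powr r) \<partial>M) = ennreal (a powr r)"
        using arg_cong[OF a(1), of "\<lambda>x. epow x r"] a(2) r by (simp add: epow_epow epow_ennreal)
      have Ib: "(\<integral>\<^sup>+z. ennreal (v z powr conj_exp r) \<partial>M) = ennreal (b powr conj_exp r)"
        using arg_cong[OF b(1), of "\<lambda>x. epow x (conj_exp r)"] b(2) r'(1) by (simp add: epow_epow epow_ennreal)
      have pt: "ennreal (u z * v z) \<le> ennreal (a * b) * (ennreal (a powr - r) * ennreal (u z powr r) + ennreal (b powr - conj_exp r) * ennreal (v z powr conj_exp r))" for z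
      proof -
        have "ennreal (u z * v z) = ennreal (a * b) * (ennreal (u z / a) * ennreal (v z / b))"
          using a b nn[of z] by (simp add: ennreal_mult[symmetric])
        also have "\<dots> \<le> ennreal (a * b) * (epow (ennreal (u z / a)) r + epow (ennreal (v z / b)) (conj_exp r))"
          by (intro mult_left_mono young r) simp
        also have "epow (ennreal (u z / a)) r = ennreal (a powr - r) * ennreal (u z powr r)"
          using a nn[of z] by (simp add: epow_ennreal powr_divide powr_minus ennreal_mult[symmetric] field_simps)
        also have "epow (ennreal (v z / b)) (conj_exp r) = ennreal (b powr - conj_exp r) * ennreal (v z powr conj_exp r)"
          using b nn[of z] by (simp add: epow_ennreal powr_divide powr_minus ennreal_mult[symmetric] field_simps)
        finally show ?thesis .
      qed
      have "?I \<le> (\<integral>\<^sup>+z. ennreal (a * b) * (ennreal (a powr - r) * ennreal (u z powr r) + ennreal (b powr - conj_exp r) * ennreal (v z powr conj_exp r)) \<partial>M)"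
        by (intro nn_integral_mono pt)
      also have "\<dots> = ennreal (a * b) * (ennreal (a powr - r) * ennreal (a powr r) + ennreal (b powr - conj_exp r) * ennreal (b powr conj_exp r))"
        by (simp add: nn_integral_cmult nn_integral_add Ia Ib)
      also have "\<dots> = ennreal 2 * (?A * ?B)"
      proof -
        have "ennreal (a powr - r) * ennreal (a powr r) = 1" "ennreal (b powr - conj_exp r) * ennreal (b powr conj_exp r) = 1"
          using a b by (simp_all add: ennreal_mult[symmetric] powr_add[symmetric])
        moreover have "(1::ennreal) + 1 = ennreal 2" by simp
        ultimately show ?thesis using a b by (simp add: ennreal_mult[symmetric] mult.commute)
      qed
      finally show ?thesis .
    qed
  qed
qed

lemma tile_holder:
  assumes r: "1 < r" and [measurable]: "f \<in> borel_measurable lebesgue" "g \<in> borel_measurable lebesgue"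
  shows "(\<integral>\<^sup>+z\<in>tl P. ennreal (norm (f z * g z)) \<partial>lebesgue) \<le> ennreal 2 * (coef r f P * coef (conj_exp r) g P)"
proof -
  have eq: "ennreal (norm (h z) powr s) * indicator (tl P) z = ennreal ((norm (h z) * indicator (tl P) z) powr s)" for h :: "pt \<Rightarrow> complex" and s z
    by (auto simp: indicator_def)
  have "(\<integral>\<^sup>+z\<in>tl P. ennreal (norm (f z * g z)) \<partial>lebesgue)
    = (\<integral>\<^sup>+z. ennreal ((norm (f z) * indicator (tl P) z) * (norm (g z) * indicator (tl P) z)) \<partial>lebesgue)"
    by (intro nn_integral_cong) (auto simp: indicator_def norm_mult)
  also have "\<dots> \<le> ennreal 2 * (coef r f P * coef (conj_exp r) g P)"
    unfolding coef_def eq by (intro holder_crude r) auto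
  finally show ?thesis .
qed

lemma integral_mult_le:
  assumes p: "1 < p" and q: "1 < q" and r: "1 < r"
  shows "\<exists>K>0. \<forall>f g. f \<in> borel_measurable lebesgue \<longrightarrow> g \<in> borel_measurable lebesgue \<longrightarrow>
    (\<integral>\<^sup>+z\<in>Xset. ennreal (norm (f z * g z)) \<partial>lebesgue) \<le>
      ennreal K * (Lp_mu p q r f * Lp_mu (conj_exp p) (conj_exp q) (conj_exp r) g)"
proof -
  have pos: "0 < p" "0 < q" "0 < r" "0 < conj_exp p" "0 < conj_exp q" "0 < conj_exp r"
    using p q r conj_exp_props(1) by auto
  obtain K where K: "dual_bound (stripL r q p) (stripL (conj_exp r) (conj_exp q) (conj_exp p)) K"
    using stripL_dual_bound[OF r q p] by blast
  have K0: "0 < K" using K by (simp add: dual_bound_def)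
  show ?thesis
  \<comment> \<open>A factor 2 from Hoelder's inequality on each tile, and \<open>2 * K\<close> from
    the one for sequences.\<close>
  proof (intro exI[of _ "4 * K"] conjI allI impI)
    show "0 < 4 * K" using K0 by simp
    fix f g :: "pt \<Rightarrow> complex"
    assume [measurable]: "f \<in> borel_measurable lebesgue" "g \<in> borel_measurable lebesgue"
    have "(\<integral>\<^sup>+z\<in>Xset. ennreal (norm (f z * g z)) \<partial>lebesgue) = nsum UNIV (\<lambda>P. \<integral>\<^sup>+z\<in>tl P. ennreal (norm (f z * g z)) \<partial>lebesgue)"
      by (rule nn_integral_tiles) measurable
    also have "\<dots> \<le> nsum UNIV (\<lambda>P. ennreal 2 * (coef r f P * coef (conj_exp r) g P))"
      by (intro nn_integral_mono tile_holder r) measurable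
    also have "\<dots> = ennreal 2 * pairing (coef r f) (coef (conj_exp r) g)"
      unfolding pairing_def by (rule nn_integral_cmult) simp
    also have "\<dots> \<le> ennreal 2 * (ennreal (2 * K) * (Lp_mu p q r f * Lp_mu (conj_exp p) (conj_exp q) (conj_exp r) g))"
      using pos by (subst (1 2) Lp_mu_eq) (auto intro!: mult_left_mono norm_bound[OF stripL_good stripL_good _ _ K])
    also have "\<dots> = ennreal (4 * K) * (Lp_mu p q r f * Lp_mu (conj_exp p) (conj_exp q) (conj_exp r) g)"
    proof -
      have "ennreal 2 * ennreal (2 * K) = ennreal (4 * K)" using K0 by (subst ennreal_mult[symmetric]) auto
      then show ?thesis by (simp only: mult.assoc[symmetric])
    qed
    finally show "(\<integral>\<^sup>+z\<in>Xset. ennreal (norm (f z * g z)) \<partial>lebesgue) \<le>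
      ennreal (4 * K) * (Lp_mu p q r f * Lp_mu (conj_exp p) (conj_exp q) (conj_exp r) g)" .
  qed
qed

text \<open>A label with countably many values, \<open>None\<close> off \<open>Xset\<close>; a
  function prescribed tile by tile is measurable through it.\<close>

definition tile_opt :: "pt \<Rightarrow> tidx option" where
  "tile_opt z = (if z \<in> Xset then Some (tile_of z) else None)"

lemma tile_opt_eq: "z \<in> tl P \<Longrightarrow> tile_opt z = Some P"
  by (simp add: tile_opt_def mem_tl_iff)

lemma tile_opt_measurable [measurable]: "tile_opt \<in> lebesgue \<rightarrow>\<^sub>M count_space UNIV"
proof (subst measurable_count_space_eq2_countable, safe)
  fix a
  show "tile_opt -` {a} \<inter> space lebesgue \<in> sets lebesgue"
  proof (cases a)
    case None
    then have "tile_opt -` {a} \<inter> space lebesgue = space lebesgue - Xset" by (auto simp: tile_opt_def)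
    moreover have "Xset \<in> sets lebesgue" unfolding Xset_eq by measurable
    moreover from this have "space lebesgue - Xset \<in> sets lebesgue" by (intro sets.compl_sets)
    ultimately show ?thesis by (simp only:)
  next
    case (Some P)
    have "tile_opt z = Some P \<longleftrightarrow> z \<in> tl P" for z by (simp add: tile_opt_def mem_tl_iff)
    then have "tile_opt -` {a} \<inter> space lebesgue = tl P" using Some by auto
    then show ?thesis by simp
  qed
qed auto

text \<open>The equality case of Hoelder's inequality on each tile: there \<open>norm (g z)\<close>
  is a multiple of \<open>norm (f z) powr (r - 1)\<close>.\<close>

lemma realize_partner:
  assumes r: "1 < r" and [measurable]: "f \<in> borel_measurable lebesgue"
    and fin: "\<And>P. coef r f P < top" and y: "\<And>P. y P < top"
  obtains g where "g \<in> borel_measurable lebesgue" "\<And>P. coef (conj_exp r) g P \<le> y P"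
    "(\<integral>\<^sup>+z\<in>Xset. ennreal (norm (f z * g z)) \<partial>lebesgue) = pairing (coef r f) y"
proof -
  note r' = conj_exp_props[OF r]
  \<comment> \<open>Normalised so that the coefficient of \<open>g\<close> on \<open>P\<close> is
    \<open>y P\<close>. If \<open>coef r f P = 0\<close>, the convention for powers of zero makes
    \<open>c P = 0\<close>, which is why the coefficient is only claimed to be at most
    \<open>y P\<close>.\<close>
  define c where "c P = enn2real (y P) * enn2real (coef r f P) powr (1 - r)" for P
  define g where "g z = (case tile_opt z of None \<Rightarrow> 0 | Some P \<Rightarrow> complex_of_real (c P * norm (f z) powr (r - 1)))" for z
  have g_meas: "g \<in> borel_measurable lebesgue"
    unfolding g_def
  proof (rule measurable_compose_countable[OF _ tile_opt_measurable])
    fix i show "(\<lambda>z. case i of None \<Rightarrow> 0 | Some P \<Rightarrow> complex_of_real (c P * norm (f z) powr (r - 1))) \<in> borel_measurable lebesgue"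
      by (cases i) auto
  qed
  have gz: "norm (g z) = c P * norm (f z) powr (r - 1)" if "z \<in> tl P" for z P
    by (simp add: g_def tile_opt_eq[OF that] c_def norm_mult)
  have c0: "0 \<le> c P" for P by (simp add: c_def)
  let ?I = "\<lambda>P. \<integral>\<^sup>+z\<in>tl P. ennreal (norm (f z) powr r) \<partial>lebesgue"
  have I: "?I P = epow (coef r f P) r" for P using r by (simp add: coef_def epow_epow)
  have Ireal: "?I P = ennreal (enn2real (coef r f P) powr r)" for P
    using I[of P] fin[of P] by (simp add: epow_def)
  have gI: "(\<integral>\<^sup>+z\<in>tl P. ennreal (norm (g z) powr conj_exp r) \<partial>lebesgue) = ennreal (c P powr conj_exp r) * ?I P" for P
  proof -
    have "(\<integral>\<^sup>+z\<in>tl P. ennreal (norm (g z) powr conj_exp r) \<partial>lebesgue) =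
      (\<integral>\<^sup>+z. ennreal (c P powr conj_exp r) * (ennreal (norm (f z) powr r) * indicator (tl P) z) \<partial>lebesgue)"
    proof (intro nn_integral_cong)
      fix z
      show "ennreal (norm (g z) powr conj_exp r) * indicator (tl P) z =
        ennreal (c P powr conj_exp r) * (ennreal (norm (f z) powr r) * indicator (tl P) z)"
      proof (cases "z \<in> tl P")
        case True
        have "norm (g z) powr conj_exp r = c P powr conj_exp r * norm (f z) powr r"
          using c0[of P] r'(3) by (simp add: gz[OF True] powr_mult powr_powr)
        then show ?thesis using True by (simp add: ennreal_mult)
      qed simp
    qed
    also have "\<dots> = ennreal (c P powr conj_exp r) * ?I P" by (rule nn_integral_cmult) measurable
    finally show ?thesis .
  qed
  have fgI: "(\<integral>\<^sup>+z\<in>tl P. ennreal (norm (f z * g z)) \<partial>lebesgue) = ennreal (c P) * ?I P" for P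
  proof -
    have "(\<integral>\<^sup>+z\<in>tl P. ennreal (norm (f z * g z)) \<partial>lebesgue) =
      (\<integral>\<^sup>+z. ennreal (c P) * (ennreal (norm (f z) powr r) * indicator (tl P) z) \<partial>lebesgue)"
    proof (intro nn_integral_cong)
      fix z
      show "ennreal (norm (f z * g z)) * indicator (tl P) z = ennreal (c P) * (ennreal (norm (f z) powr r) * indicator (tl P) z)"
      proof (cases "z \<in> tl P")
        case True
        have "norm (f z) * norm (f z) powr (r - 1) = norm (f z) powr r"
          using powr_add[of "norm (f z)" 1 "r - 1"] by (cases "f z = 0") auto
        then have "norm (f z * g z) = c P * norm (f z) powr r" by (simp add: norm_mult gz[OF True] mult.left_commute)
        then show ?thesis using True c0[of P] by (simp add: ennreal_mult)
      qed simp
    qed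
    also have "\<dots> = ennreal (c P) * ?I P" by (rule nn_integral_cmult) measurable
    finally show ?thesis .
  qed
  show ?thesis
  proof (rule that[OF g_meas])
    fix P
    show "coef (conj_exp r) g P \<le> y P"
    proof (cases "coef r f P = 0")
      case True
      then have "?I P = 0" by (simp add: I)
      then show ?thesis unfolding coef_def gI by simp
    next
      case False
      define X where "X = enn2real (coef r f P)"
      define Y where "Y = enn2real (y P)"
      have X: "0 < X" using False fin[of P] by (cases "coef r f P" rule: ennreal_cases) (auto simp: X_def less_le)
      have "c P powr conj_exp r * X powr r = Y powr conj_exp r"
      proof -
        have "(1 - r) * conj_exp r = - r" using r'(3) by (simp add: left_diff_distrib)
        then have "c P powr conj_exp r = Y powr conj_exp r * X powr (- r)"
          by (simp add: c_def X_def[symmetric] Y_def powr_mult powr_powr)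
        then show ?thesis using X by (simp add: mult.assoc powr_add[symmetric])
      qed
      moreover have "coef (conj_exp r) g P = epow (ennreal (c P powr conj_exp r) * ?I P) (1 / conj_exp r)"
        unfolding coef_def gI ..
      ultimately have "coef (conj_exp r) g P = epow (ennreal (Y powr conj_exp r)) (1 / conj_exp r)"
        using Ireal[of P] by (simp add: X_def[symmetric] ennreal_mult[symmetric])
      also have "\<dots> = ennreal Y" using r'(1) by (simp add: epow_ennreal powr_powr Y_def)
      also have "\<dots> = y P" using y[of P] by (simp add: Y_def)
      finally show ?thesis by simp
    qed
  next
    have "(\<integral>\<^sup>+z\<in>Xset. ennreal (norm (f z * g z)) \<partial>lebesgue) = nsum UNIV (\<lambda>P. \<integral>\<^sup>+z\<in>tl P. ennreal (norm (f z * g z)) \<partial>lebesgue)"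
      using g_meas by (intro nn_integral_tiles) measurable
    also have "\<dots> = pairing (coef r f) y"
      unfolding pairing_def fgI
    proof (intro nn_integral_cong)
      fix P
      define X where "X = enn2real (coef r f P)"
      define Y where "Y = enn2real (y P)"
      have X: "0 \<le> X" "coef r f P = ennreal X" using fin[of P] by (auto simp: X_def)
      have Y: "0 \<le> Y" "y P = ennreal Y" using y[of P] by (auto simp: Y_def)
      have "c P * X powr r = X * Y"
      proof (cases "X = 0")
        case False
        then have "X powr (1 - r) * X powr r = X" using X by (simp add: powr_add[symmetric])
        then show ?thesis by (simp add: c_def X_def[symmetric] Y_def[symmetric] mult.assoc mult.commute)
      qed simp
      then show "ennreal (c P) * ?I P = coef r f P * y P"
        unfolding Ireal X_def[symmetric] X(2) Y(2) using X Y c0[of P] by (simp add: ennreal_mult[symmetric])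
    qed
    finally show "(\<integral>\<^sup>+z\<in>Xset. ennreal (norm (f z * g z)) \<partial>lebesgue) = pairing (coef r f) y" .
  qed
qed

lemma Lp_mu_scale:
  assumes pos: "0 < p" "0 < q" "0 < r" and [measurable]: "g \<in> borel_measurable lebesgue" and c: "0 < c"
  shows "Lp_mu p q r (\<lambda>z. complex_of_real c * g z) = ennreal c * Lp_mu p q r g"
proof -
  have "coef r (\<lambda>z. complex_of_real c * g z) P = ennreal c * coef r g P" for P
  proof -
    have "(\<integral>\<^sup>+z\<in>tl P. ennreal (norm (complex_of_real c * g z) powr r) \<partial>lebesgue) =
      (\<integral>\<^sup>+z. ennreal (c powr r) * (ennreal (norm (g z) powr r) * indicator (tl P) z) \<partial>lebesgue)"
      using c by (intro nn_integral_cong) (simp add: norm_mult powr_mult ennreal_mult mult.assoc)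
    also have "\<dots> = ennreal (c powr r) * (\<integral>\<^sup>+z\<in>tl P. ennreal (norm (g z) powr r) \<partial>lebesgue)"
      by (rule nn_integral_cmult) measurable
    finally show ?thesis
      using c pos by (simp add: coef_def epow_mult epow_ennreal powr_powr)
  qed
  then have "coef r (\<lambda>z. complex_of_real c * g z) = (\<lambda>P. ennreal c * coef r g P)" by (rule ext)
  moreover have "(\<lambda>z. complex_of_real c * g z) \<in> borel_measurable lebesgue" by measurable
  ultimately show ?thesis
    using c pos by (simp add: Lp_mu_eq good_scale[OF stripL_good] epow_mult epow_ennreal powr_powr)
qed

lemma coef_finite:
  assumes "0 < p" "0 < q" "0 < r" "f \<in> borel_measurable lebesgue" "Lp_mu p q r f < top"
  shows "coef r f P < top"
proof (rule good_less_top[OF stripL_good[of r q p]])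
  show "stripL r q p (coef r f) < top" using assms by (simp add: Lp_mu_eq)
qed (use assms in auto)

text \<open>Finiteness is asked of each coefficient rather than of the quasi-norm, so that the bound
  applies to partial sums before their quasi-norm is known to be finite.\<close>

lemma Lp_mu_le_dual:
  assumes p: "1 < p" and q: "1 < q" and r: "1 < r"
  shows "\<exists>C>0. \<forall>f s. f \<in> borel_measurable lebesgue \<longrightarrow> (\<forall>P. coef r f P < top) \<longrightarrow>
    (\<forall>g. g \<in> borel_measurable lebesgue \<longrightarrow> Lp_mu (conj_exp p) (conj_exp q) (conj_exp r) g \<le> 1 \<longrightarrow>
       (\<integral>\<^sup>+z\<in>Xset. ennreal (norm (f z * g z)) \<partial>lebesgue) \<le> s) \<longrightarrow>
    stripL r q p (coef r f) \<le> ennreal C * epow s p"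
proof -
  have pos: "0 < conj_exp p" "0 < conj_exp q" "0 < conj_exp r"
    using p q r conj_exp_props(1) by auto
  obtain C where C: "0 < C" "\<And>x s. (\<forall>P. x P < top) \<Longrightarrow>
    (\<forall>y. fsup y \<longrightarrow> stripL (conj_exp r) (conj_exp q) (conj_exp p) y \<le> 1 \<longrightarrow> pairing x y \<le> s) \<Longrightarrow>
    stripL r q p x \<le> ennreal C * epow s p" using stripL_le_dual[OF r q p] by blast
  show ?thesis
  proof (intro exI[of _ C] conjI allI impI C(1))
    fix f s assume f: "f \<in> borel_measurable lebesgue" and fin: "\<forall>P. coef r f P < top"
      and s: "\<forall>g. g \<in> borel_measurable lebesgue \<longrightarrow> Lp_mu (conj_exp p) (conj_exp q) (conj_exp r) g \<le> 1 \<longrightarrow>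
       (\<integral>\<^sup>+z\<in>Xset. ennreal (norm (f z * g z)) \<partial>lebesgue) \<le> s"
    have "pairing (coef r f) y \<le> s" if y: "fsup y" "stripL (conj_exp r) (conj_exp q) (conj_exp p) y \<le> 1" for y
    proof -
      have yfin: "y P < top" for P using y(1) unfolding fsup_def by blast
      obtain g where g: "g \<in> borel_measurable lebesgue" "\<And>P. coef (conj_exp r) g P \<le> y P"
        "(\<integral>\<^sup>+z\<in>Xset. ennreal (norm (f z * g z)) \<partial>lebesgue) = pairing (coef r f) y"
        by (rule realize_partner[where y = y, OF r f spec[OF fin] yfin]) blast
      have "stripL (conj_exp r) (conj_exp q) (conj_exp p) (coef (conj_exp r) g) \<le> stripL (conj_exp r) (conj_exp q) (conj_exp p) y"
        by (rule good_mono[OF stripL_good[OF pos(3,2,1)] g(2)])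
      also note y(2)
      finally have "stripL (conj_exp r) (conj_exp q) (conj_exp p) (coef (conj_exp r) g) \<le> 1" .
      then have *: "epow (stripL (conj_exp r) (conj_exp q) (conj_exp p) (coef (conj_exp r) g)) (1 / conj_exp p) \<le> epow 1 (1 / conj_exp p)"
        using pos by (intro epow_mono) auto
      have "Lp_mu (conj_exp p) (conj_exp q) (conj_exp r) g \<le> 1"
        using * pos g(1) epow_ennreal[of 1] by (simp add: Lp_mu_eq)
      from s[rule_format, OF g(1) this] show ?thesis unfolding g(3) .
    qed
    then show "stripL r q p (coef r f) \<le> ennreal C * epow s p" using fin by (intro C(2)) auto
  qed
qed

lemma ennreal_inverse_mult_le:
  assumes "0 < C" "a \<le> ennreal C * b"
  shows "ennreal (1 / C) * a \<le> b"
proof -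
  have "ennreal (1 / C) * a \<le> ennreal (1 / C) * (ennreal C * b)" by (intro mult_left_mono assms) simp
  also have "\<dots> = b" using assms(1) by (simp add: mult.assoc[symmetric] ennreal_mult[symmetric])
  finally show ?thesis .
qed

lemma epow_le_cmult:
  assumes "a \<le> ennreal C * b" "0 < C" "0 < p"
  shows "epow a (1 / p) \<le> ennreal (C powr (1 / p)) * epow b (1 / p)"
proof -
  have "epow a (1 / p) \<le> epow (ennreal C * b) (1 / p)" using assms by (intro epow_mono) auto
  then show ?thesis using assms by (simp add: epow_mult epow_ennreal)
qed

section \<open>The three assertions for functions\<close>

lemma collapse_equal_exponents:
  assumes q: "0 < q" and r: "0 < r"
  shows "\<exists>C::real. 0 < C \<and> (\<forall>f. f \<in> borel_measurable lebesgue \<and> Lp_mu q q r f < top \<longrightarrow>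
    ennreal (1 / C) * Lq_nu q r f \<le> Lp_mu q q r f \<and> Lp_mu q q r f \<le> ennreal C * Lq_nu q r f)"
proof -
  obtain C where C: "0 < C" "\<And>x. treeN r q x \<le> ennreal C * stripL r q q x" "\<And>x. stripL r q q x \<le> ennreal C * treeN r q x"
    using treeN_stripL_equiv[OF r q] by blast
  show ?thesis
  proof (intro exI[of _ "C powr (1 / q)"] conjI allI impI)
    show "0 < C powr (1 / q)" using C by simp
    fix f :: "pt \<Rightarrow> complex" assume f: "f \<in> borel_measurable lebesgue \<and> Lp_mu q q r f < top"
    show "ennreal (1 / C powr (1 / q)) * Lq_nu q r f \<le> Lp_mu q q r f"
      using f C q r by (intro ennreal_inverse_mult_le) (auto simp: Lq_nu_eq Lp_mu_eq intro: epow_le_cmult)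
    show "Lp_mu q q r f \<le> ennreal (C powr (1 / q)) * Lq_nu q r f"
      using f C q r by (auto simp: Lq_nu_eq Lp_mu_eq intro: epow_le_cmult)
  qed
qed

lemma root_of_dual_bound:
  assumes "L \<le> ennreal C * epow s p" "0 < C" "0 < p"
  shows "epow L (1 / p) \<le> ennreal (C powr (1 / p)) * s"
  using epow_le_cmult[OF assms] assms(3) by (simp add: epow_epow)

lemma duality:
  assumes p: "1 < p" and q: "1 < q" and r: "1 < r"
  shows "\<exists>C::real. 0 < C \<and> (\<forall>f. f \<in> borel_measurable lebesgue \<and> Lp_mu p q r f < top \<longrightarrow>
     (let S = (SUP g \<in> {g. g \<in> borel_measurable lebesgue \<and> Lp_mu (conj_exp p) (conj_exp q) (conj_exp r) g = 1}.
                 \<integral>\<^sup>+x\<in>Xset. ennreal (norm (f x * g x)) \<partial>lebesgue)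
      in ennreal (1 / C) * Lp_mu p q r f \<le> S \<and> S \<le> ennreal C * Lp_mu p q r f))"
proof -
  have pos: "0 < p" "0 < q" "0 < r" and pos': "0 < conj_exp p" "0 < conj_exp q" "0 < conj_exp r"
    using p q r conj_exp_props(1) by auto
  let ?L' = "Lp_mu (conj_exp p) (conj_exp q) (conj_exp r)"
  obtain K where K: "0 < K" "\<And>f g. f \<in> borel_measurable lebesgue \<Longrightarrow> g \<in> borel_measurable lebesgue \<Longrightarrow>
    (\<integral>\<^sup>+z\<in>Xset. ennreal (norm (f z * g z)) \<partial>lebesgue) \<le> ennreal K * (Lp_mu p q r f * ?L' g)"
    using integral_mult_le[OF p q r] by blast
  obtain C where C: "0 < C" "\<And>f s. f \<in> borel_measurable lebesgue \<Longrightarrow> (\<forall>P. coef r f P < top) \<Longrightarrow>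
    (\<forall>g. g \<in> borel_measurable lebesgue \<longrightarrow> ?L' g \<le> 1 \<longrightarrow> (\<integral>\<^sup>+z\<in>Xset. ennreal (norm (f z * g z)) \<partial>lebesgue) \<le> s) \<Longrightarrow>
    stripL r q p (coef r f) \<le> ennreal C * epow s p" using Lp_mu_le_dual[OF p q r] by blast
  define E where "E = max K (C powr (1 / p))"
  have E: "0 < E" using K by (simp add: E_def less_max_iff_disj)
  show ?thesis
    unfolding Let_def
  proof (intro exI[of _ E] conjI allI impI E)
    fix f :: "pt \<Rightarrow> complex" assume f: "f \<in> borel_measurable lebesgue \<and> Lp_mu p q r f < top"
    then have f' [measurable]: "f \<in> borel_measurable lebesgue" by simp
    let ?I = "\<lambda>g. \<integral>\<^sup>+x\<in>Xset. ennreal (norm (f x * g x)) \<partial>lebesgue"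
    let ?S = "SUP g \<in> {g. g \<in> borel_measurable lebesgue \<and> ?L' g = 1}. ?I g"
    show "?S \<le> ennreal E * Lp_mu p q r f"
    proof (rule SUP_least)
      fix g assume "g \<in> {g. g \<in> borel_measurable lebesgue \<and> ?L' g = 1}"
      then have "?I g \<le> ennreal K * Lp_mu p q r f" using K(2)[OF f', of g] by simp
      also have "\<dots> \<le> ennreal E * Lp_mu p q r f" by (intro mult_right_mono ennreal_leI) (auto simp: E_def)
      finally show "?I g \<le> ennreal E * Lp_mu p q r f" .
    qed
    have "stripL r q p (coef r f) \<le> ennreal C * epow ?S p"
    proof (rule C(2)[OF f'])
      show "\<forall>P. coef r f P < top" using coef_finite[OF pos f'] f by blast
      show "\<forall>g. g \<in> borel_measurable lebesgue \<longrightarrow> ?L' g \<le> 1 \<longrightarrow> ?I g \<le> ?S"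
      proof (intro allI impI)
        fix g :: "pt \<Rightarrow> complex" assume g [measurable]: "g \<in> borel_measurable lebesgue" and g1: "?L' g \<le> 1"
        \<comment> \<open>The supremum runs over quasi-norm exactly one. A test function of
          quasi-norm zero pairs to zero; any other is divided by its value \<open>v \<le> 1\<close>,
          and undoing this can only lower the integral.\<close>
        show "?I g \<le> ?S"
        proof (cases "?L' g = 0")
          case True
          then have "?I g = 0" using K(2)[OF f' g] by simp
          then show ?thesis by simp
        next
          case False
          then obtain v where v: "?L' g = ennreal v" "0 < v" "v \<le> 1"
            using g1 by (cases "?L' g" rule: ennreal_cases) (auto simp: less_le top_unique)
          define h where "h z = complex_of_real (1 / v) * g z" for z
          have h [measurable]: "h \<in> borel_measurable lebesgue" unfolding h_def by measurable
          have "?L' h = ennreal (1 / v) * ?L' g"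
            unfolding h_def using v by (intro Lp_mu_scale pos' g) auto
          then have "?L' h = 1" using v by (simp add: ennreal_mult[symmetric])
          then have hS: "?I h \<le> ?S" using h by (intro SUP_upper) simp
          have "?I g = (\<integral>\<^sup>+x. ennreal v * (ennreal (norm (f x * h x)) * indicator Xset x) \<partial>lebesgue)"
          proof (intro nn_integral_cong)
            fix x
            have "norm (f x * g x) = v * norm (f x * h x)" using v by (simp add: h_def norm_mult norm_divide)
            then show "ennreal (norm (f x * g x)) * indicator Xset x = ennreal v * (ennreal (norm (f x * h x)) * indicator Xset x)"
              using v by (simp add: ennreal_mult mult.assoc)
          qed
          also have "\<dots> = ennreal v * ?I h"
          proof (rule nn_integral_cmult)
            have [measurable]: "Xset \<in> sets lebesgue" unfolding Xset_eq by measurable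
            show "(\<lambda>x. ennreal (norm (f x * h x)) * indicator Xset x) \<in> borel_measurable lebesgue" by measurable
          qed
          also have "\<dots> \<le> 1 * ?S" using v hS by (intro mult_mono) auto
          finally show ?thesis by simp
        qed
      qed
    qed
    then have "Lp_mu p q r f \<le> ennreal (C powr (1 / p)) * ?S"
      unfolding Lp_mu_eq[OF pos(3,2,1) f'] using C(1) pos by (intro root_of_dual_bound)
    also have "\<dots> \<le> ennreal E * ?S" by (intro mult_right_mono ennreal_leI) (auto simp: E_def)
    finally show "ennreal (1 / E) * Lp_mu p q r f \<le> ?S" using E by (intro ennreal_inverse_mult_le)
  qed
qed

text \<open>When the series does not converge absolutely the right-hand side is infinite, so the unspecified value of a
  divergent \<open>suminf\<close> is harmless.\<close>

lemma norm_suminf_le_liminf: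
  fixes a :: "nat \<Rightarrow> complex"
  assumes r: "0 < r"
  shows "ennreal (norm (\<Sum>n. a n) powr r) \<le> liminf (\<lambda>N. ennreal ((\<Sum>n<N. norm (a n)) powr r))"
proof (cases "summable (\<lambda>n. norm (a n))")
  case True
  have "(\<lambda>N. \<Sum>n<N. norm (a n)) \<longlonglongrightarrow> (\<Sum>n. norm (a n))" using True by (rule summable_LIMSEQ)
  then have "(\<lambda>N. ennreal ((\<Sum>n<N. norm (a n)) powr r)) \<longlonglongrightarrow> ennreal ((\<Sum>n. norm (a n)) powr r)"
    using r by (intro tendsto_intros tendsto_powr') (auto intro!: always_eventually sum_nonneg)
  then have "liminf (\<lambda>N. ennreal ((\<Sum>n<N. norm (a n)) powr r)) = ennreal ((\<Sum>n. norm (a n)) powr r)"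
    by (intro lim_imp_Liminf) auto
  moreover have "norm (\<Sum>n. a n) powr r \<le> (\<Sum>n. norm (a n)) powr r"
    using r summable_norm[OF True] by (intro powr_mono2) auto
  ultimately show ?thesis by (simp add: ennreal_leI)
next
  case False
  let ?c = "norm (\<Sum>n. a n)"
  have "\<exists>N. ?c < (\<Sum>n<N. norm (a n))"
  proof (rule ccontr)
    assume "\<nexists>N. ?c < (\<Sum>n<N. norm (a n))"
    then have "summable (\<lambda>n. norm (a n))" by (intro summableI_nonneg_bounded[of _ ?c]) (auto simp: not_less)
    with False show False by simp
  qed
  then obtain N0 where N0: "?c < (\<Sum>n<N0. norm (a n))" by blast
  show ?thesis
  proof (rule Liminf_bounded)
    show "\<forall>\<^sub>F N in sequentially. ennreal (?c powr r) \<le> ennreal ((\<Sum>n<N. norm (a n)) powr r)"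
      using eventually_ge_at_top[of N0]
    proof eventually_elim
      case (elim N)
      have "(\<Sum>n<N0. norm (a n)) \<le> (\<Sum>n<N. norm (a n))" using elim by (intro sum_mono2) auto
      then show ?case using N0 r by (intro ennreal_leI powr_mono2) auto
    qed
  qed
qed

text \<open>Bounding the sum by twice the larger norm costs \<open>2 powr r\<close>, which is
  harmless where only finiteness is at stake.\<close>

lemma coef_add_finite:
  assumes r: "0 < r" and [measurable]: "f \<in> borel_measurable lebesgue" "g \<in> borel_measurable lebesgue"
    and fin: "coef r f P < top" "coef r g P < top"
  shows "coef r (\<lambda>z. complex_of_real (norm (f z) + norm (g z))) P < top"
proof -
  have pt: "ennreal (norm (complex_of_real (norm (f z) + norm (g z))) powr r) * indicator (tl P) z \<le>
    ennreal (2 powr r) * (ennreal (norm (f z) powr r) * indicator (tl P) z + ennreal (norm (g z) powr r) * indicator (tl P) z)" for z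
  proof (cases "z \<in> tl P")
    case True
    have "(norm (f z) + norm (g z)) powr r \<le> (2 * max (norm (f z)) (norm (g z))) powr r"
      using r by (intro powr_mono2) auto
    also have "\<dots> = 2 powr r * max (norm (f z)) (norm (g z)) powr r" by (simp add: powr_mult)
    also have "\<dots> \<le> 2 powr r * (norm (f z) powr r + norm (g z) powr r)"
      by (intro mult_left_mono) (auto simp: max_def)
    finally have "ennreal ((norm (f z) + norm (g z)) powr r) \<le> ennreal (2 powr r * (norm (f z) powr r + norm (g z) powr r))"
      by (rule ennreal_leI)
    also have "\<dots> = ennreal (2 powr r) * (ennreal (norm (f z) powr r) + ennreal (norm (g z) powr r))"
      by (simp add: ennreal_mult)
    finally show ?thesis using True by (simp add: norm_of_real del: of_real_add)
  qed simp
  have "(\<integral>\<^sup>+z\<in>tl P. ennreal (norm (complex_of_real (norm (f z) + norm (g z))) powr r) \<partial>lebesgue) \<le>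
    (\<integral>\<^sup>+z. ennreal (2 powr r) * (ennreal (norm (f z) powr r) * indicator (tl P) z + ennreal (norm (g z) powr r) * indicator (tl P) z) \<partial>lebesgue)"
    by (intro nn_integral_mono pt)
  also have "\<dots> = ennreal (2 powr r) * ((\<integral>\<^sup>+z\<in>tl P. ennreal (norm (f z) powr r) \<partial>lebesgue) + (\<integral>\<^sup>+z\<in>tl P. ennreal (norm (g z) powr r) \<partial>lebesgue))"
    by (simp add: nn_integral_cmult nn_integral_add)
  also have "\<dots> < top" using fin by (simp add: coef_def ennreal_mult_less_top)
  finally show ?thesis by (simp add: coef_def)
qed

text \<open>Pairing with a test function is additive, so duality gives a bound for the partial sums
  that is uniform in \<open>N\<close>. Fatou's lemma, first on each tile and then for
  \<open>stripL\<close>, passes to the series.\<close>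

lemma countable_triangle:
  assumes p: "1 < p" and q: "1 < q" and r: "1 < r"
  shows "\<exists>C::real. 0 < C \<and> (\<forall>fs :: nat \<Rightarrow> pt \<Rightarrow> complex.
    (\<forall>n. fs n \<in> borel_measurable lebesgue \<and> Lp_mu p q r (fs n) < top) \<longrightarrow>
    Lp_mu p q r (\<lambda>x. \<Sum>n. fs n x) \<le> ennreal C * (\<Sum>n. Lp_mu p q r (fs n)))"
proof -
  have pos: "0 < p" "0 < q" "0 < r" using p q r by auto
  let ?L' = "Lp_mu (conj_exp p) (conj_exp q) (conj_exp r)"
  obtain K where K: "0 < K" "\<And>f g. f \<in> borel_measurable lebesgue \<Longrightarrow> g \<in> borel_measurable lebesgue \<Longrightarrow>
    (\<integral>\<^sup>+z\<in>Xset. ennreal (norm (f z * g z)) \<partial>lebesgue) \<le> ennreal K * (Lp_mu p q r f * ?L' g)"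
    using integral_mult_le[OF p q r] by blast
  obtain C where C: "0 < C" "\<And>f s. f \<in> borel_measurable lebesgue \<Longrightarrow> (\<forall>P. coef r f P < top) \<Longrightarrow>
    (\<forall>g. g \<in> borel_measurable lebesgue \<longrightarrow> ?L' g \<le> 1 \<longrightarrow> (\<integral>\<^sup>+z\<in>Xset. ennreal (norm (f z * g z)) \<partial>lebesgue) \<le> s) \<Longrightarrow>
    stripL r q p (coef r f) \<le> ennreal C * epow s p" using Lp_mu_le_dual[OF p q r] by blast
  show ?thesis
  proof (intro exI[of _ "C powr (1 / p) * K"] conjI allI impI)
    show "0 < C powr (1 / p) * K" using C K by simp
    fix fs :: "nat \<Rightarrow> pt \<Rightarrow> complex"
    assume fs: "\<forall>n. fs n \<in> borel_measurable lebesgue \<and> Lp_mu p q r (fs n) < top"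
    then have fm [measurable]: "fs n \<in> borel_measurable lebesgue" for n by simp
    define T where "T = (\<Sum>n. Lp_mu p q r (fs n))"
    \<comment> \<open>Sums of absolute values dominate the partial sums of \<open>fs\<close>, and
      the absolute value of their product with \<open>g\<close> splits exactly into a sum.\<close>
    define S where "S N z = complex_of_real (\<Sum>n<N. norm (fs n z))" for N z
    have S_norm: "norm (S N z) = (\<Sum>n<N. norm (fs n z))" for N z
      unfolding S_def norm_of_real by (simp add: sum_nonneg)
    have Sm [measurable]: "S N \<in> borel_measurable lebesgue" for N unfolding S_def by measurable
    have S_fin: "coef r (S N) P < top" for N P
    proof (induction N)
      case 0
      have "coef r (S 0) P = 0" by (intro coef_zero) (simp add: S_def)
      then show ?case by simp
    next
      case (Suc N)
      have "coef r (fs N) P < top" using coef_finite[OF pos fm] fs by blast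
      from coef_add_finite[OF pos(3) Sm fm Suc this]
      have "coef r (\<lambda>z. complex_of_real (norm (S N z) + norm (fs N z))) P < top" .
      also have "(\<lambda>z. complex_of_real (norm (S N z) + norm (fs N z))) = S (Suc N)"
        unfolding S_norm by (rule ext) (simp add: S_def)
      finally show ?case .
    qed
    have LS: "stripL r q p (coef r (S N)) \<le> ennreal C * epow (ennreal K * T) p" for N
    proof (rule C(2)[OF Sm])
      show "\<forall>P. coef r (S N) P < top" using S_fin by blast
      show "\<forall>g. g \<in> borel_measurable lebesgue \<longrightarrow> ?L' g \<le> 1 \<longrightarrow>
        (\<integral>\<^sup>+z\<in>Xset. ennreal (norm (S N z * g z)) \<partial>lebesgue) \<le> ennreal K * T"
      proof (intro allI impI)
        fix g :: "pt \<Rightarrow> complex" assume g [measurable]: "g \<in> borel_measurable lebesgue" and g1: "?L' g \<le> 1"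
        have [measurable]: "Xset \<in> sets lebesgue" unfolding Xset_eq by measurable
        have "(\<integral>\<^sup>+z\<in>Xset. ennreal (norm (S N z * g z)) \<partial>lebesgue) =
          (\<integral>\<^sup>+z. (\<Sum>n<N. ennreal (norm (fs n z * g z)) * indicator Xset z) \<partial>lebesgue)"
          by (intro nn_integral_cong)
             (simp add: norm_mult S_norm sum_distrib_right sum_ennreal[symmetric] del: sum_ennreal)
        also have "\<dots> = (\<Sum>n<N. \<integral>\<^sup>+z\<in>Xset. ennreal (norm (fs n z * g z)) \<partial>lebesgue)"
          by (rule nn_integral_sum) measurable
        also have "\<dots> \<le> (\<Sum>n<N. ennreal K * Lp_mu p q r (fs n))"
        proof (rule sum_mono)
          fix n
          have "(\<integral>\<^sup>+z\<in>Xset. ennreal (norm (fs n z * g z)) \<partial>lebesgue) \<le> ennreal K * (Lp_mu p q r (fs n) * ?L' g)"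
            by (rule K(2)) measurable
          also have "\<dots> \<le> ennreal K * (Lp_mu p q r (fs n) * 1)" by (intro mult_left_mono g1) auto
          finally show "(\<integral>\<^sup>+z\<in>Xset. ennreal (norm (fs n z * g z)) \<partial>lebesgue) \<le> ennreal K * Lp_mu p q r (fs n)" by simp
        qed
        also have "\<dots> = ennreal K * (\<Sum>n<N. Lp_mu p q r (fs n))" by (simp add: sum_distrib_left)
        also have "\<dots> \<le> ennreal K * T" unfolding T_def by (intro mult_left_mono sum_le_suminf) auto
        finally show "(\<integral>\<^sup>+z\<in>Xset. ennreal (norm (S N z * g z)) \<partial>lebesgue) \<le> ennreal K * T" .
      qed
    qed
    define f where "f x = (\<Sum>n. fs n x)" for x
    have f [measurable]: "f \<in> borel_measurable lebesgue" unfolding f_def by measurable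
    have "coef r f P \<le> liminf (\<lambda>N. coef r (S N) P)" for P
    proof -
      have "ennreal (norm (f z) powr r) * indicator (tl P) z \<le> liminf (\<lambda>N. ennreal (norm (S N z) powr r) * indicator (tl P) z)" for z
        using norm_suminf_le_liminf[OF pos(3), of "\<lambda>n. fs n z"] unfolding S_norm f_def by (cases "z \<in> tl P") auto
      then have "(\<integral>\<^sup>+z\<in>tl P. ennreal (norm (f z) powr r) \<partial>lebesgue) \<le> (\<integral>\<^sup>+z. liminf (\<lambda>N. ennreal (norm (S N z) powr r) * indicator (tl P) z) \<partial>lebesgue)"
        by (intro nn_integral_mono)
      also have "\<dots> \<le> liminf (\<lambda>N. \<integral>\<^sup>+z\<in>tl P. ennreal (norm (S N z) powr r) \<partial>lebesgue)"
        by (rule nn_integral_liminf) measurable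
      finally have "coef r f P \<le> epow (liminf (\<lambda>N. \<integral>\<^sup>+z\<in>tl P. ennreal (norm (S N z) powr r) \<partial>lebesgue)) (1 / r)"
        unfolding coef_def using pos by (intro epow_mono) auto
      also have "\<dots> \<le> liminf (\<lambda>N. coef r (S N) P)"
        unfolding coef_def using pos by (intro epow_liminf_le) auto
      finally show ?thesis .
    qed
    then have "stripL r q p (coef r f) \<le> liminf (\<lambda>N. stripL r q p (coef r (S N)))"
      by (rule good_liminf[OF stripL_good[OF pos(3,2,1)]])
    also have "\<dots> \<le> ennreal C * epow (ennreal K * T) p"
      using LS by (intro Liminf_le always_eventually) auto
    finally have "epow (stripL r q p (coef r f)) (1 / p) \<le> ennreal (C powr (1 / p)) * (ennreal K * T)"
      using C(1) pos by (intro root_of_dual_bound)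
    then have "Lp_mu p q r f \<le> ennreal (C powr (1 / p) * K) * T"
      using K(1) unfolding Lp_mu_eq[OF pos(3,2,1) f] by (simp add: ennreal_mult mult.assoc)
    then show "Lp_mu p q r (\<lambda>x. \<Sum>n. fs n x) \<le> ennreal (C powr (1 / p) * K) * (\<Sum>n. Lp_mu p q r (fs n))"
      by (simp add: f_def[abs_def] T_def)
  qed
qed

theorem theorem1p3:
  shows
   "(\<forall>q r. 0 < q \<and> 0 < r \<longrightarrow> (\<exists>C::real. 0 < C \<and>
       (\<forall>f. f \<in> borel_measurable lebesgue \<and> Lp_mu q q r f < top \<longrightarrow>
          ennreal (1 / C) * Lq_nu q r f \<le> Lp_mu q q r f \<and>
          Lp_mu q q r f \<le> ennreal C * Lq_nu q r f)))
  \<and> (\<forall>p q r. 1 < p \<and> 1 < q \<and> 1 < r \<longrightarrow> (\<exists>C::real. 0 < C \<and>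
       (\<forall>f. f \<in> borel_measurable lebesgue \<and> Lp_mu p q r f < top \<longrightarrow>
          (let S = (SUP g \<in> {g. g \<in> borel_measurable lebesgue \<and>
                        Lp_mu (conj_exp p) (conj_exp q) (conj_exp r) g = 1}.
                     \<integral>\<^sup>+x\<in>Xset. ennreal (norm (f x * g x)) \<partial>lebesgue)
           in ennreal (1 / C) * Lp_mu p q r f \<le> S \<and> S \<le> ennreal C * Lp_mu p q r f))))
  \<and> (\<forall>p q r. 1 < p \<and> 1 < q \<and> 1 < r \<longrightarrow> (\<exists>C::real. 0 < C \<and>
       (\<forall>fs :: nat \<Rightarrow> pt \<Rightarrow> complex.
          (\<forall>n. fs n \<in> borel_measurable lebesgue \<and> Lp_mu p q r (fs n) < top) \<longrightarrow>
          Lp_mu p q r (\<lambda>x. \<Sum>n. fs n x) \<le> ennreal C * (\<Sum>n. Lp_mu p q r (fs n)))))"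
  using collapse_equal_exponents duality countable_triangle by blast

end
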